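(* Let $L$ be a torsion-free semibasic vector $1$-form on $TM$, i.e. a semibasic vector $1$-form with $[J,L]=0$. Then there is a vertical vector field $V_L$ on $TM$ such that $L=[J,V_L]$. Moreover, the set of all vertical vector fields $V$ on $TM$ satisfying $L=[J,V]$ is $\{V_L+X^v : X\in\mathfrak{X}(M)\}$.
   Context: $M$ is a connected smooth $n$-dimensional manifold (Hausdorff, countable base), $TM$ its tangent bundle, $\mathfrak{X}(M)$ the smooth vector fields on $M$; $X^v$ is the vertical lift to $TM$ of $X\in\mathfrak{X}(M)$. $C$ is the Liouville vector field on $TM$ and $J$ is the vertical endomorphism of $TM$ (the $(1,1)$ tensor with image and kernel the vertical vector fields, $[J,J]=0$, $[J,C]=J$). A vector $1$-form on $TM$ is a $(1,1)$ tensor field on $TM$. A vector $1$-form $L$ is semibasic if $L\circ J=0$ and $J\circ L=0$. For a vector $1$-form $K$ and a vector field $Y$ on $TM$, $[K,Y]$ is the vector $1$-form $[K,Y]X=[KX,Y]-K[X,Y]$. For vector $1$-forms $K,L$, $[K,L]$ is the Frölicher–Nijenhuis bracket, the vector $2$-form determined by $d_{[K,L]}=d_K d_L+d_L d_K$, where $d_K=i_K\circ d-d\circ i_K$ and $i_K$ is the degree-$0$ derivation of differential forms with $i_K\varphi=0$ on functions and $i_K\alpha=\alpha\circ K$ on $1$-forms. *)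

theory Defs
  imports "HOL-Analysis.Analysis" "HOL-Library.Function_Algebras"
begin

section \<open>Smooth maps between Euclidean spaces\<close>

text \<open>Only used on open sets; in finite dimension this is the usual notion of a \<open>C\<^sup>k\<close> map.\<close>

primrec Ck_on :: "nat \<Rightarrow> ('a::real_normed_vector \<Rightarrow> 'b::real_normed_vector) \<Rightarrow> 'a set \<Rightarrow> bool" where
  "Ck_on 0 f S \<longleftrightarrow> continuous_on S f"
| "Ck_on (Suc k) f S \<longleftrightarrow> (\<forall>x\<in>S. f differentiable (at x)) \<and>
     (\<forall>v. Ck_on k (\<lambda>x. frechet_derivative f (at x) v) S)"

definition smooth_on :: "'a::real_normed_vector set \<Rightarrow> ('a \<Rightarrow> 'b::real_normed_vector) \<Rightarrow> bool" where
  "smooth_on S f \<longleftrightarrow> (\<forall>k. Ck_on k f S)"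


section \<open>Smooth manifolds\<close>

text \<open>
  A manifold is a set of points with an indexed smooth atlas modelled on a Euclidean space
  \<open>'e\<close>, so its dimension is \<open>DIM('e)\<close>. It carries the topology induced by the atlas. The atlas
  need not be maximal: no notion below changes when compatible charts are added.
\<close>

record ('p, 'i, 'e) atlas =
  points :: "'p set"
  chart_index :: "'i set"
  chart_dom :: "'i \<Rightarrow> 'p set"
  chart_map :: "'i \<Rightarrow> 'p \<Rightarrow> 'e"

definition charts_at :: "('p, 'i, 'e) atlas \<Rightarrow> 'p \<Rightarrow> 'i set" where
  "charts_at M p = {i \<in> chart_index M. p \<in> chart_dom M i}"

definition chart_inv :: "('p, 'i, 'e) atlas \<Rightarrow> 'i \<Rightarrow> 'e \<Rightarrow> 'p" where
  "chart_inv M i = inv_into (chart_dom M i) (chart_map M i)"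

definition transition :: "('p, 'i, 'e) atlas \<Rightarrow> 'i \<Rightarrow> 'i \<Rightarrow> 'e \<Rightarrow> 'e" where
  "transition M i j = (\<lambda>x. chart_map M j (chart_inv M i x))"

definition smooth_atlas :: "('p, 'i, 'e::euclidean_space) atlas \<Rightarrow> bool" where
  "smooth_atlas M \<longleftrightarrow>
     (\<Union>i\<in>chart_index M. chart_dom M i) = points M \<and>
     (\<forall>i\<in>chart_index M. inj_on (chart_map M i) (chart_dom M i) \<and>
        open (chart_map M i ` chart_dom M i)) \<and>
     (\<forall>i\<in>chart_index M. \<forall>j\<in>chart_index M.
        open (chart_map M i ` (chart_dom M i \<inter> chart_dom M j)) \<and>
        smooth_on (chart_map M i ` (chart_dom M i \<inter> chart_dom M j)) (transition M i j))"

definition atlas_topology :: "('p, 'i, 'e::euclidean_space) atlas \<Rightarrow> 'p topology" where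
  "atlas_topology M = topology (\<lambda>W. W \<subseteq> points M \<and>
     (\<forall>i\<in>chart_index M. open (chart_map M i ` (W \<inter> chart_dom M i))))"

lemma openin_atlas_topology:
  assumes "smooth_atlas M"
  shows "openin (atlas_topology M) W \<longleftrightarrow> W \<subseteq> points M \<and>
     (\<forall>i\<in>chart_index M. open (chart_map M i ` (W \<inter> chart_dom M i)))"
proof -
  have inj: "inj_on (chart_map M i) (chart_dom M i)" if "i \<in> chart_index M" for i
    using assms that by (auto simp: smooth_atlas_def)
  have "istopology (\<lambda>W. W \<subseteq> points M \<and>
     (\<forall>i\<in>chart_index M. open (chart_map M i ` (W \<inter> chart_dom M i))))"
    unfolding istopology_def
  proof (intro conjI allI impI ballI; (elim conjE)?)
    fix S T i
    assume *: "\<forall>i\<in>chart_index M. open (chart_map M i ` (S \<inter> chart_dom M i))"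
      "\<forall>i\<in>chart_index M. open (chart_map M i ` (T \<inter> chart_dom M i))" and i: "i \<in> chart_index M"
    have "chart_map M i ` (S \<inter> T \<inter> chart_dom M i) =
        chart_map M i ` (S \<inter> chart_dom M i) \<inter> chart_map M i ` (T \<inter> chart_dom M i)"
      using inj[OF i] by (auto simp: inj_on_def)
    then show "open (chart_map M i ` (S \<inter> T \<inter> chart_dom M i))"
      using * i by auto
  next
    fix K i
    assume *: "\<forall>S\<in>K. S \<subseteq> points M \<and>
        (\<forall>i\<in>chart_index M. open (chart_map M i ` (S \<inter> chart_dom M i)))" and i: "i \<in> chart_index M"
    have "chart_map M i ` (\<Union>K \<inter> chart_dom M i) = (\<Union>S\<in>K. chart_map M i ` (S \<inter> chart_dom M i))"
      by auto
    then show "open (chart_map M i ` (\<Union>K \<inter> chart_dom M i))"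
      using * i by auto
  qed blast+
  then show ?thesis
    by (simp add: atlas_topology_def)
qed

definition smooth_manifold :: "('p, 'i, 'e::euclidean_space) atlas \<Rightarrow> bool" where
  "smooth_manifold M \<longleftrightarrow> smooth_atlas M \<and>
     Hausdorff_space (atlas_topology M) \<and> second_countable (atlas_topology M)"


section \<open>Functions, tangent vectors, vector fields\<close>

text \<open>
  Functions and vector fields are taken to be zero off the set of points, so that equality as
  HOL functions is equality as functions or vector fields on the manifold.
\<close>

definition smooth_functions :: "('p, 'i, 'e::euclidean_space) atlas \<Rightarrow> ('p \<Rightarrow> real) set" where
  "smooth_functions M = {f. (\<forall>p. p \<notin> points M \<longrightarrow> f p = 0) \<and>
     (\<forall>i\<in>chart_index M. smooth_on (chart_map M i ` chart_dom M i) (\<lambda>x. f (chart_inv M i x)))}"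

text \<open>
  A tangent vector at \<open>p\<close> is the family of its coordinate vectors in all charts around \<open>p\<close>,
  related by the derivatives of the transition maps (and zero at all other indices).
\<close>

definition tangent_space :: "('p, 'i, 'e::euclidean_space) atlas \<Rightarrow> 'p \<Rightarrow> ('i \<Rightarrow> 'e) set" where
  "tangent_space M p = {v. (\<forall>i. i \<notin> charts_at M p \<longrightarrow> v i = 0) \<and>
     (\<forall>i\<in>charts_at M p. \<forall>j\<in>charts_at M p.
        v j = frechet_derivative (transition M i j) (at (chart_map M i p)) (v i))}"

definition vector_fields :: "('p, 'i, 'e::euclidean_space) atlas \<Rightarrow> ('p \<Rightarrow> 'i \<Rightarrow> 'e) set" where
  "vector_fields M = {X. (\<forall>p\<in>points M. X p \<in> tangent_space M p) \<and>
     (\<forall>p. p \<notin> points M \<longrightarrow> X p = 0) \<and>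
     (\<forall>i\<in>chart_index M. smooth_on (chart_map M i ` chart_dom M i) (\<lambda>x. X (chart_inv M i x) i))}"

definition scale_field :: "('p \<Rightarrow> real) \<Rightarrow> ('p \<Rightarrow> 'i \<Rightarrow> 'e::real_vector) \<Rightarrow> 'p \<Rightarrow> 'i \<Rightarrow> 'e" where
  "scale_field f X = (\<lambda>p i. f p *\<^sub>R X p i)"

text \<open>The function \<open>X f\<close>, computed in any chart around the point.\<close>

definition apply_field ::
  "('p, 'i, 'e::euclidean_space) atlas \<Rightarrow> ('p \<Rightarrow> 'i \<Rightarrow> 'e) \<Rightarrow> ('p \<Rightarrow> real) \<Rightarrow> 'p \<Rightarrow> real" where
  "apply_field M X f p =
     (if p \<in> points M then
        let i = (SOME i. i \<in> charts_at M p)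
        in frechet_derivative (\<lambda>x. f (chart_inv M i x)) (at (chart_map M i p)) (X p i)
      else 0)"

definition lie_bracket ::
  "('p, 'i, 'e::euclidean_space) atlas \<Rightarrow> ('p \<Rightarrow> 'i \<Rightarrow> 'e) \<Rightarrow> ('p \<Rightarrow> 'i \<Rightarrow> 'e) \<Rightarrow> 'p \<Rightarrow> 'i \<Rightarrow> 'e" where
  "lie_bracket M X Y p i =
     (if i \<in> charts_at M p then
        frechet_derivative (\<lambda>x. Y (chart_inv M i x) i) (at (chart_map M i p)) (X p i) -
        frechet_derivative (\<lambda>x. X (chart_inv M i x) i) (at (chart_map M i p)) (Y p i)
      else 0)"


section \<open>Differential forms and vector-valued forms\<close>

text \<open>
  Tensor fields are identified with \<open>C\<^sup>\<infinity>\<close>-multilinear maps on vector fields. A \<open>k\<close>-form takes a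
  list of \<open>k\<close> vector fields and is zero on all other lists; a \<open>0\<close>-form \<open>\<omega>\<close> is the function
  \<open>\<omega> []\<close>. The maps are extensional, so equality of forms is equality of HOL functions.
\<close>

type_synonym ('p, 'i, 'e) form = "('p \<Rightarrow> 'i \<Rightarrow> 'e) list \<Rightarrow> 'p \<Rightarrow> real"

definition forms :: "('p, 'i, 'e::euclidean_space) atlas \<Rightarrow> nat \<Rightarrow> ('p, 'i, 'e) form set" where
  "forms M k = {\<omega>.
     (\<forall>Xs. \<not> (length Xs = k \<and> set Xs \<subseteq> vector_fields M) \<longrightarrow> \<omega> Xs = 0) \<and>
     (\<forall>Xs. length Xs = k \<and> set Xs \<subseteq> vector_fields M \<longrightarrow>
        \<omega> Xs \<in> smooth_functions M \<and>
        (\<forall>i<k. \<forall>X\<in>vector_fields M. \<forall>Y\<in>vector_fields M.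
           \<omega> (Xs[i := X + Y]) = \<omega> (Xs[i := X]) + \<omega> (Xs[i := Y])) \<and>
        (\<forall>i<k. \<forall>f\<in>smooth_functions M. \<forall>X\<in>vector_fields M.
           \<omega> (Xs[i := scale_field f X]) = f * \<omega> (Xs[i := X])) \<and>
        (\<forall>j<k. \<forall>i<j. Xs ! i = Xs ! j \<longrightarrow> \<omega> Xs = 0))}"

text \<open>The exterior derivative (\<open>nths Xs (- A)\<close> is \<open>Xs\<close> with the positions in \<open>A\<close> omitted).\<close>

definition ext_deriv ::
  "('p, 'i, 'e::euclidean_space) atlas \<Rightarrow> ('p, 'i, 'e) form \<Rightarrow> ('p, 'i, 'e) form" where
  "ext_deriv M \<omega> Xs =
     (if set Xs \<subseteq> vector_fields M then
        (\<lambda>p. (\<Sum>i<length Xs. (- 1) ^ i * apply_field M (Xs ! i) (\<omega> (nths Xs (- {i}))) p) +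
             (\<Sum>j<length Xs. \<Sum>i<j. (- 1) ^ (i + j) *
                \<omega> (lie_bracket M (Xs ! i) (Xs ! j) # nths Xs (- {i, j})) p))
      else 0)"

definition vector_1_forms ::
  "('p, 'i, 'e::euclidean_space) atlas \<Rightarrow> (('p \<Rightarrow> 'i \<Rightarrow> 'e) \<Rightarrow> 'p \<Rightarrow> 'i \<Rightarrow> 'e) set" where
  "vector_1_forms M = {K \<in> vector_fields M \<rightarrow>\<^sub>E vector_fields M.
     (\<forall>X\<in>vector_fields M. \<forall>Y\<in>vector_fields M. K (X + Y) = K X + K Y) \<and>
     (\<forall>f\<in>smooth_functions M. \<forall>X\<in>vector_fields M. K (scale_field f X) = scale_field f (K X))}"

definition vector_2_forms ::
  "('p, 'i, 'e::euclidean_space) atlas \<Rightarrow>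
     (('p \<Rightarrow> 'i \<Rightarrow> 'e) \<Rightarrow> ('p \<Rightarrow> 'i \<Rightarrow> 'e) \<Rightarrow> 'p \<Rightarrow> 'i \<Rightarrow> 'e) set" where
  "vector_2_forms M = {P \<in> vector_fields M \<rightarrow>\<^sub>E vector_1_forms M.
     (\<forall>X\<in>vector_fields M. P X X = 0) \<and>
     (\<forall>X\<in>vector_fields M. \<forall>Y\<in>vector_fields M. \<forall>Z\<in>vector_fields M.
        P (X + Y) Z = P X Z + P Y Z) \<and>
     (\<forall>f\<in>smooth_functions M. \<forall>X\<in>vector_fields M. \<forall>Y\<in>vector_fields M.
        P (scale_field f X) Y = scale_field f (P X Y))}"

definition zero_vector_2_form ::
  "('p, 'i, 'e::euclidean_space) atlas \<Rightarrow>
     ('p \<Rightarrow> 'i \<Rightarrow> 'e) \<Rightarrow> ('p \<Rightarrow> 'i \<Rightarrow> 'e) \<Rightarrow> 'p \<Rightarrow> 'i \<Rightarrow> 'e" where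
  "zero_vector_2_form M = (\<lambda>X\<in>vector_fields M. \<lambda>Y\<in>vector_fields M. 0)"

text \<open>
  For a vector \<open>1\<close>-form \<open>K\<close>, \<open>i\<^sub>K\<close> is the derivation of degree \<open>0\<close> with \<open>i\<^sub>K f = 0\<close> and
  \<open>i\<^sub>K \<alpha> = \<alpha> \<circ> K\<close>; for a vector \<open>2\<close>-form \<open>P\<close>, \<open>i\<^sub>P\<close> is the derivation of degree \<open>1\<close> with
  \<open>i\<^sub>P f = 0\<close> and \<open>i\<^sub>P \<alpha> = \<alpha> \<circ> P\<close>. The sign in \<open>i\<^sub>P\<close> is that of the permutation moving
  positions \<open>i < j\<close> to the front.
\<close>

definition insert_1 ::
  "('p, 'i, 'e::euclidean_space) atlas \<Rightarrow> (('p \<Rightarrow> 'i \<Rightarrow> 'e) \<Rightarrow> 'p \<Rightarrow> 'i \<Rightarrow> 'e) \<Rightarrow>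
     ('p, 'i, 'e) form \<Rightarrow> ('p, 'i, 'e) form" where
  "insert_1 M K \<omega> Xs =
     (if set Xs \<subseteq> vector_fields M then (\<Sum>i<length Xs. \<omega> (Xs[i := K (Xs ! i)])) else 0)"

definition insert_2 ::
  "('p, 'i, 'e::euclidean_space) atlas \<Rightarrow>
     (('p \<Rightarrow> 'i \<Rightarrow> 'e) \<Rightarrow> ('p \<Rightarrow> 'i \<Rightarrow> 'e) \<Rightarrow> 'p \<Rightarrow> 'i \<Rightarrow> 'e) \<Rightarrow>
     ('p, 'i, 'e) form \<Rightarrow> ('p, 'i, 'e) form" where
  "insert_2 M P \<omega> Xs =
     (if set Xs \<subseteq> vector_fields M then
        (\<lambda>p. \<Sum>j<length Xs. \<Sum>i<j. (- 1) ^ (i + j + 1) * \<omega> (P (Xs ! i) (Xs ! j) # nths Xs (- {i, j})) p)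
      else 0)"

lemma insert_degree_0:
  assumes "\<omega> \<in> forms M 0"
  shows "insert_1 M K \<omega> = 0" and "insert_2 M P \<omega> = 0"
proof -
  have *: "\<omega> Xs = 0" if "Xs \<noteq> []" for Xs
    using assms that by (auto simp: forms_def)
  have "\<omega> (Xs[i := K (Xs ! i)]) = 0" if "i < length Xs" for Xs i
    using that by (intro *) auto
  then show "insert_1 M K \<omega> = 0"
    by (intro ext) (simp add: insert_1_def)
  show "insert_2 M P \<omega> = 0"
    by (auto simp: insert_2_def fun_eq_iff *)
qed

lemma insert_degree_1:
  assumes "X \<in> vector_fields M" "Y \<in> vector_fields M"
  shows "insert_1 M K \<omega> [X] = \<omega> [K X]" and "insert_2 M P \<omega> [X, Y] = \<omega> [P X Y]"
  using assms by (auto simp: insert_1_def insert_2_def fun_eq_iff nths_Cons lessThan_Suc)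

text \<open>
  \<open>d\<^sub>K = [i\<^sub>K, d]\<close> is a graded commutator, whence the different signs in degrees \<open>1\<close> and \<open>2\<close>.
\<close>

definition deriv_1 ::
  "('p, 'i, 'e::euclidean_space) atlas \<Rightarrow> (('p \<Rightarrow> 'i \<Rightarrow> 'e) \<Rightarrow> 'p \<Rightarrow> 'i \<Rightarrow> 'e) \<Rightarrow>
     ('p, 'i, 'e) form \<Rightarrow> ('p, 'i, 'e) form" where
  "deriv_1 M K \<omega> = insert_1 M K (ext_deriv M \<omega>) - ext_deriv M (insert_1 M K \<omega>)"

definition deriv_2 ::
  "('p, 'i, 'e::euclidean_space) atlas \<Rightarrow>
     (('p \<Rightarrow> 'i \<Rightarrow> 'e) \<Rightarrow> ('p \<Rightarrow> 'i \<Rightarrow> 'e) \<Rightarrow> 'p \<Rightarrow> 'i \<Rightarrow> 'e) \<Rightarrow>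
     ('p, 'i, 'e) form \<Rightarrow> ('p, 'i, 'e) form" where
  "deriv_2 M P \<omega> = insert_2 M P (ext_deriv M \<omega>) + ext_deriv M (insert_2 M P \<omega>)"

text \<open>\<open>FN_bracket M K L P\<close> says that \<open>P\<close> is the Froelicher--Nijenhuis bracket \<open>[K, L]\<close>.\<close>

definition FN_bracket ::
  "('p, 'i, 'e::euclidean_space) atlas \<Rightarrow>
     (('p \<Rightarrow> 'i \<Rightarrow> 'e) \<Rightarrow> 'p \<Rightarrow> 'i \<Rightarrow> 'e) \<Rightarrow> (('p \<Rightarrow> 'i \<Rightarrow> 'e) \<Rightarrow> 'p \<Rightarrow> 'i \<Rightarrow> 'e) \<Rightarrow>
     (('p \<Rightarrow> 'i \<Rightarrow> 'e) \<Rightarrow> ('p \<Rightarrow> 'i \<Rightarrow> 'e) \<Rightarrow> 'p \<Rightarrow> 'i \<Rightarrow> 'e) \<Rightarrow> bool" where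
  "FN_bracket M K L P \<longleftrightarrow> P \<in> vector_2_forms M \<and>
     (\<forall>k. \<forall>\<omega>\<in>forms M k. deriv_2 M P \<omega> = deriv_1 M K (deriv_1 M L \<omega>) + deriv_1 M L (deriv_1 M K \<omega>))"

text \<open>The bracket \<open>[K, Y]\<close> of a vector \<open>1\<close>-form and a vector field.\<close>

definition form_field_bracket ::
  "('p, 'i, 'e::euclidean_space) atlas \<Rightarrow>
     (('p \<Rightarrow> 'i \<Rightarrow> 'e) \<Rightarrow> 'p \<Rightarrow> 'i \<Rightarrow> 'e) \<Rightarrow> ('p \<Rightarrow> 'i \<Rightarrow> 'e) \<Rightarrow>
     ('p \<Rightarrow> 'i \<Rightarrow> 'e) \<Rightarrow> 'p \<Rightarrow> 'i \<Rightarrow> 'e" where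
  "form_field_bracket M K Y =
     (\<lambda>X\<in>vector_fields M. lie_bracket M (K X) Y - K (lie_bracket M X Y))"


section \<open>The tangent bundle\<close>

text \<open>
  Each chart \<open>x\<close> of \<open>M\<close> induces the chart \<open>(x, y)\<close> of \<open>TM\<close>, where \<open>y\<close> is the coordinate vector
  in the chart \<open>x\<close>; both have the same index. A tangent vector of \<open>TM\<close> therefore has coordinates
  \<open>(a, b)\<close>, where \<open>a\<close> are the coordinates of its image under the derivative of the projection
  \<open>\<pi>\<close>, and the vertical lift of a tangent vector of \<open>M\<close> with coordinates \<open>a\<close> has
  coordinates \<open>(0, a)\<close>.
\<close>

definition tangent_bundle ::
  "('p, 'i, 'e::euclidean_space) atlas \<Rightarrow> ('p \<times> ('i \<Rightarrow> 'e), 'i, 'e \<times> 'e) atlas" where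
  "tangent_bundle M =
     \<lparr> points = {(p, v). p \<in> points M \<and> v \<in> tangent_space M p},
       chart_index = chart_index M,
       chart_dom = (\<lambda>i. {(p, v). p \<in> chart_dom M i \<and> v \<in> tangent_space M p}),
       chart_map = (\<lambda>i (p, v). (chart_map M i p, v i)) \<rparr>"

definition proj_deriv :: "('i \<Rightarrow> 'e \<times> 'e) \<Rightarrow> 'i \<Rightarrow> 'e" where
  "proj_deriv w = (\<lambda>i. fst (w i))"

definition vlift :: "('i \<Rightarrow> 'e::zero) \<Rightarrow> 'i \<Rightarrow> 'e \<times> 'e" where
  "vlift u = (\<lambda>i. (0, u i))"

definition vertical_fields ::
  "('p, 'i, 'e::euclidean_space) atlas \<Rightarrow> ('p \<times> ('i \<Rightarrow> 'e) \<Rightarrow> 'i \<Rightarrow> 'e \<times> 'e) set" where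
  "vertical_fields M = {V \<in> vector_fields (tangent_bundle M). \<forall>q. proj_deriv (V q) = 0}"

definition vertical_lift ::
  "('p, 'i, 'e::euclidean_space) atlas \<Rightarrow> ('p \<Rightarrow> 'i \<Rightarrow> 'e) \<Rightarrow>
     'p \<times> ('i \<Rightarrow> 'e) \<Rightarrow> 'i \<Rightarrow> 'e \<times> 'e" where
  "vertical_lift M X = (\<lambda>q. if q \<in> points (tangent_bundle M) then vlift (X (fst q)) else 0)"

definition vertical_endo ::
  "('p, 'i, 'e::euclidean_space) atlas \<Rightarrow>
     ('p \<times> ('i \<Rightarrow> 'e) \<Rightarrow> 'i \<Rightarrow> 'e \<times> 'e) \<Rightarrow> 'p \<times> ('i \<Rightarrow> 'e) \<Rightarrow> 'i \<Rightarrow> 'e \<times> 'e" where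
  "vertical_endo M = (\<lambda>X\<in>vector_fields (tangent_bundle M). \<lambda>q. vlift (proj_deriv (X q)))"

definition semibasic_1_forms ::
  "('p, 'i, 'e::euclidean_space) atlas \<Rightarrow>
     (('p \<times> ('i \<Rightarrow> 'e) \<Rightarrow> 'i \<Rightarrow> 'e \<times> 'e) \<Rightarrow> 'p \<times> ('i \<Rightarrow> 'e) \<Rightarrow> 'i \<Rightarrow> 'e \<times> 'e) set" where
  "semibasic_1_forms M = {L \<in> vector_1_forms (tangent_bundle M).
     \<forall>X\<in>vector_fields (tangent_bundle M).
       L (vertical_endo M X) = 0 \<and> vertical_endo M (L X) = 0}"

definition torsion_free ::
  "('p, 'i, 'e::euclidean_space) atlas \<Rightarrow>
     (('p \<times> ('i \<Rightarrow> 'e) \<Rightarrow> 'i \<Rightarrow> 'e \<times> 'e) \<Rightarrow> 'p \<times> ('i \<Rightarrow> 'e) \<Rightarrow> 'i \<Rightarrow> 'e \<times> 'e) \<Rightarrow> bool" where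
  "torsion_free M L \<longleftrightarrow>
     FN_bracket (tangent_bundle M) (vertical_endo M) L (zero_vector_2_form (tangent_bundle M))"

end

theory Submission
  imports Defs
begin

text \<open>
  In the chart \<open>(x, y)\<close> of \<open>TM\<close> induced by a chart of \<open>M\<close>, a semibasic vector \<open>1\<close>-form acts on
  tangent vectors by \<open>L (a, b) = (0, \<lambda>(x, y) a)\<close> with \<open>\<lambda>(x, y)\<close> linear, and for a vertical field
  \<open>V = (0, v)\<close> one has \<open>[J, V] (a, b) = (0, D\<^sub>y v a)\<close> (lemma \<open>form_field_bracket_vertical\<close>). So
  \<open>L = [J, V]\<close> says that, on each fibre, \<open>v\<close> is a potential of \<open>\<lambda>\<close>, seen as a vector-valued
  \<open>1\<close>-form of \<open>y\<close> (lemma \<open>L_eq_bracket_iff\<close>). Two facts finish the argument.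

  Existence. Evaluating \<open>[J, L] = 0\<close> on coordinate fields shows that this \<open>1\<close>-form is closed:
  \<open>D\<^sub>y (\<lambda> b) a = D\<^sub>y (\<lambda> a) b\<close> (lemma \<open>vcoeff_symmetric\<close>). A fibre is a vector space, so the
  Poincare lemma gives a potential on the whole fibre, the radial integral
  \<open>v(x, y) = \<integral>\<^sub>0\<^sup>1 \<lambda>(x, t y) y dt\<close> (lemma \<open>potential_derivative\<close>). Because the transition maps
  are linear on fibres, they carry the segment from \<open>0\<close> to \<open>y\<close> to another such segment; hence these
  local potentials agree on overlaps and form one vertical field \<open>V\<^sub>L\<close>, without any partition of
  unity.

  Uniqueness. The difference of two solutions is a vertical field with \<open>D\<^sub>y v = 0\<close>. It is constant on
  each fibre, that is, the vertical lift of a vector field on \<open>M\<close>.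

  Since \<open>L\<close> is given as an operator on global fields, its coefficients \<open>\<lambda>\<close> are found by applying it to
  coordinate fields multiplied by cutoff functions (lemma \<open>vector_1_form_local\<close>). The cutoff functions
  are pulled back from \<open>M\<close>, where the Hausdorff property provides them (lemma \<open>exists_cutoff\<close>). The rest
  is calculus for the notion of smoothness used here: chain rule, symmetry of second derivatives,
  integrals with a parameter, and bump functions.
\<close>

section \<open>Calculus of smooth maps\<close>

lemma Ck_on_cong:
  assumes "open S" "\<And>x. x \<in> S \<Longrightarrow> f x = g x" "Ck_on k f S"
  shows "Ck_on k g S"
  using assms(2,3)
proof (induction k arbitrary: f g)
  case 0
  then show ?case by (simp cong: continuous_on_cong)
next
  case (Suc k)
  have *: "(g has_derivative frechet_derivative f (at x)) (at x)" if "x \<in> S" for x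
  proof (rule has_derivative_transform_within_open[OF _ assms(1) that])
    show "(f has_derivative frechet_derivative f (at x)) (at x)"
      using Suc.prems(2) that by (simp add: frechet_derivative_works[symmetric])
  qed (rule Suc.prems(1))
  have "frechet_derivative g (at x) = frechet_derivative f (at x)" if "x \<in> S" for x
    by (rule frechet_derivative_at[OF *[OF that], symmetric])
  then have "Ck_on k (\<lambda>x. frechet_derivative g (at x) v) S" for v
    using Suc.prems(2) by - (rule Suc.IH[of "\<lambda>x. frechet_derivative f (at x) v"], simp_all)
  then show ?case
    using * by (auto simp: differentiable_def)
qed

text \<open>
  Derivatives are usually known through \<open>has_derivative\<close>, not through the choice made by
  \<open>frechet_derivative\<close>; this is the form in which \<open>C\<^sup>k\<close> is proved below.
\<close>

lemma Ck_on_SucI: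
  assumes "open S" "\<And>x. x \<in> S \<Longrightarrow> (f has_derivative f' x) (at x)" "\<And>v. Ck_on k (\<lambda>x. f' x v) S"
  shows "Ck_on (Suc k) f S"
proof -
  have "Ck_on k (\<lambda>x. frechet_derivative f (at x) v) S" for v
    by (rule Ck_on_cong[OF assms(1) _ assms(3)[of v]]) (simp add: frechet_derivative_at[OF assms(2), symmetric])
  then show ?thesis
    using assms(2) by (auto simp: differentiable_def)
qed

lemma Ck_on_SucD: "Ck_on (Suc k) f S \<Longrightarrow> Ck_on k f S"
proof (induction k arbitrary: f)
  case 0
  then show ?case
    by (simp add: differentiable_imp_continuous_on differentiable_on_def differentiable_at_withinI)
next
  case (Suc k)
  then show ?case unfolding Ck_on.simps(2)[of "Suc k"] Ck_on.simps(2)[of k f] by blast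
qed

lemma Ck_on_subset: "Ck_on k f S \<Longrightarrow> T \<subseteq> S \<Longrightarrow> Ck_on k f T"
  by (induction k arbitrary: f) (auto intro: continuous_on_subset)

lemma Ck_on_has_derivative:
  "Ck_on (Suc k) f S \<Longrightarrow> x \<in> S \<Longrightarrow> (f has_derivative frechet_derivative f (at x)) (at x)"
  by (simp add: frechet_derivative_works[symmetric])

lemma Ck_on_const: "Ck_on k (\<lambda>x. c) S"
  by (induction k arbitrary: c) auto

lemma Ck_on_add:
  assumes "open S" "Ck_on k f S" "Ck_on k g S"
  shows "Ck_on k (\<lambda>x. f x + g x) S"
  using assms(2,3)
proof (induction k arbitrary: f g)
  case (Suc k)
  show ?case
    by (rule Ck_on_SucI[OF assms(1), OF has_derivative_add[OF
          Ck_on_has_derivative[OF Suc.prems(1)] Ck_on_has_derivative[OF Suc.prems(2)]]])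
      (use Suc in \<open>auto intro!: Suc.IH\<close>)
qed (simp add: continuous_on_add)

lemma Ck_on_bounded_linear:
  assumes "open S" "bounded_linear h" "Ck_on k f S"
  shows "Ck_on k (\<lambda>x. h (f x)) S"
  using assms(3)
proof (induction k arbitrary: f)
  case 0
  then show ?case by (simp add: bounded_linear.continuous_on[OF assms(2)])
next
  case (Suc k)
  show ?case
    by (rule Ck_on_SucI[OF assms(1), OF bounded_linear.has_derivative[OF assms(2)
          Ck_on_has_derivative[OF Suc.prems]]])
      (use Suc in auto)
qed

lemma Ck_on_linear:
  assumes "open S" "bounded_linear h"
  shows "Ck_on k h S"
proof (cases k)
  case 0
  then show ?thesis by (simp add: bounded_linear.continuous_on[OF assms(2)])
next
  case (Suc k)
  show ?thesis unfolding Suc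
    by (rule Ck_on_SucI[OF assms(1) bounded_linear.has_derivative[OF assms(2) has_derivative_ident]])
      (simp add: Ck_on_const)
qed

lemma Ck_on_bounded_bilinear:
  assumes "open S" "bounded_bilinear h" "Ck_on k f S" "Ck_on k g S"
  shows "Ck_on k (\<lambda>x. h (f x) (g x)) S"
  using assms(3,4)
proof (induction k arbitrary: f g)
  case 0
  then show ?case by (simp add: bounded_bilinear.continuous_on[OF assms(2)])
next
  case (Suc k)
  show ?case
    by (rule Ck_on_SucI[OF assms(1), OF bounded_bilinear.FDERIV[OF assms(2)
          Ck_on_has_derivative[OF Suc.prems(1)] Ck_on_has_derivative[OF Suc.prems(2)]]])
      (use Suc.prems in \<open>auto intro!: Ck_on_add[OF assms(1)] Suc.IH
        Ck_on_SucD[OF Suc.prems(1)] Ck_on_SucD[OF Suc.prems(2)]\<close>)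
qed

lemma Ck_on_sum:
  assumes "open S" "\<And>i. i \<in> I \<Longrightarrow> Ck_on k (f i) S"
  shows "Ck_on k (\<lambda>x. \<Sum>i\<in>I. f i x) S"
  using assms(2)
  by (induction I rule: infinite_finite_induct) (auto intro!: Ck_on_const Ck_on_add[OF assms(1)])

text \<open>
  The partial derivatives of \<open>f \<circ> g\<close> are \<open>\<Sum>b. (\<partial>\<^sub>v g \<bullet> b) (\<partial>\<^sub>b f \<circ> g)\<close>; expanding in a basis
  keeps the induction within functions of the form \<open>f \<circ> g\<close>.
\<close>

lemma Ck_on_compose:
  fixes g :: "'a::real_normed_vector \<Rightarrow> 'b::euclidean_space"
    and f :: "'b \<Rightarrow> 'c::real_normed_vector"
  assumes "open S" "Ck_on k g S" "Ck_on k f T" "g ` S \<subseteq> T"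
  shows "Ck_on k (\<lambda>x. f (g x)) S"
  using assms(2,3)
proof (induction k arbitrary: f)
  case 0
  then show ?case using assms(4) by (auto intro: continuous_on_compose2)
next
  case (Suc k)
  have eq: "frechet_derivative f (at y) w =
      (\<Sum>b\<in>Basis. (w \<bullet> b) *\<^sub>R frechet_derivative f (at y) b)" if "y \<in> T" for y w
  proof -
    have "linear (frechet_derivative f (at y))"
      using Suc.prems that by (intro linear_frechet_derivative) auto
    then have "frechet_derivative f (at y) (\<Sum>b\<in>Basis. (w \<bullet> b) *\<^sub>R b) =
        (\<Sum>b\<in>Basis. (w \<bullet> b) *\<^sub>R frechet_derivative f (at y) b)"
      by (simp add: linear_sum linear_cmul)
    then show ?thesis by (simp add: euclidean_representation)
  qed
  have "((\<lambda>x. f (g x)) has_derivative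
      (\<lambda>v. \<Sum>b\<in>Basis. (frechet_derivative g (at x) v \<bullet> b) *\<^sub>R frechet_derivative f (at (g x)) b)) (at x)"
    if "x \<in> S" for x
  proof (rule has_derivative_eq_rhs)
    have gx: "g x \<in> T" using that assms(4) by auto
    show "((\<lambda>x. f (g x)) has_derivative
        (\<lambda>v. frechet_derivative f (at (g x)) (frechet_derivative g (at x) v))) (at x)"
      by (rule has_derivative_compose[OF Ck_on_has_derivative[OF Suc.prems(1) that]
            Ck_on_has_derivative[OF Suc.prems(2) gx]])
    show "(\<lambda>v. frechet_derivative f (at (g x)) (frechet_derivative g (at x) v)) =
        (\<lambda>v. \<Sum>b\<in>Basis. (frechet_derivative g (at x) v \<bullet> b) *\<^sub>R frechet_derivative f (at (g x)) b)"
      by (rule ext) (rule eq[OF gx])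
  qed
  then show ?case
  proof (rule Ck_on_SucI[OF assms(1)])
    fix v
    show "Ck_on k (\<lambda>x. \<Sum>b\<in>Basis. (frechet_derivative g (at x) v \<bullet> b) *\<^sub>R
        frechet_derivative f (at (g x)) b) S"
    proof (intro Ck_on_sum Ck_on_bounded_bilinear[OF _ bounded_bilinear_scaleR] assms(1))
      fix b
      show "Ck_on k (\<lambda>x. frechet_derivative g (at x) v \<bullet> b) S"
        using Suc.prems(1) by (intro Ck_on_bounded_linear[OF assms(1) bounded_linear_inner_left]) simp
      show "Ck_on k (\<lambda>x. frechet_derivative f (at (g x)) b) S"
        using Suc.prems(2) by (intro Suc.IH[of "\<lambda>y. frechet_derivative f (at y) b"]
            Ck_on_SucD[OF Suc.prems(1)]) simp
    qed
  qed
qed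

lemma Ck_on_local:
  assumes "\<And>x. x \<in> S \<Longrightarrow> \<exists>T. open T \<and> x \<in> T \<and> Ck_on k f T"
  shows "Ck_on k f S"
  using assms
proof (induction k arbitrary: f)
  case 0
  then show ?case
    by (metis Ck_on.simps(1) continuous_at_imp_continuous_on continuous_on_eq_continuous_at)
next
  case (Suc k)
  show ?case
    unfolding Ck_on.simps
  proof (intro conjI allI ballI)
    show "f differentiable at x" if "x \<in> S" for x
      using Suc.prems[OF that] by auto
    show "Ck_on k (\<lambda>x. frechet_derivative f (at x) v) S" for v
    proof (rule Suc.IH)
      fix x assume "x \<in> S"
      then show "\<exists>T. open T \<and> x \<in> T \<and> Ck_on k (\<lambda>x. frechet_derivative f (at x) v) T"
        using Suc.prems[of x] by auto
    qed
  qed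
qed

lemma smooth_on_cong:
  "open S \<Longrightarrow> (\<And>x. x \<in> S \<Longrightarrow> f x = g x) \<Longrightarrow> smooth_on S f \<Longrightarrow> smooth_on S g"
  by (auto simp: smooth_on_def intro: Ck_on_cong)

lemma smooth_on_subset: "smooth_on S f \<Longrightarrow> T \<subseteq> S \<Longrightarrow> smooth_on T f"
  by (auto simp: smooth_on_def intro: Ck_on_subset)

lemma smooth_on_local:
  assumes "\<And>x. x \<in> S \<Longrightarrow> \<exists>T. open T \<and> x \<in> T \<and> smooth_on T f"
  shows "smooth_on S f"
  using assms unfolding smooth_on_def by (intro allI Ck_on_local) blast

lemma smooth_on_const: "smooth_on S (\<lambda>x. c)"
  by (simp add: smooth_on_def Ck_on_const)

lemma smooth_on_add:
  "open S \<Longrightarrow> smooth_on S f \<Longrightarrow> smooth_on S g \<Longrightarrow> smooth_on S (\<lambda>x. f x + g x)"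
  by (simp add: smooth_on_def Ck_on_add)

lemma smooth_on_linear: "open S \<Longrightarrow> bounded_linear h \<Longrightarrow> smooth_on S h"
  by (simp add: smooth_on_def Ck_on_linear)

lemma smooth_on_bounded_linear:
  "open S \<Longrightarrow> bounded_linear h \<Longrightarrow> smooth_on S f \<Longrightarrow> smooth_on S (\<lambda>x. h (f x))"
  by (simp add: smooth_on_def Ck_on_bounded_linear)

lemma smooth_on_diff:
  assumes "open S" "smooth_on S f" "smooth_on S g"
  shows "smooth_on S (\<lambda>x. f x - g x)"
  using smooth_on_add[OF assms(1,2) smooth_on_bounded_linear[OF assms(1)
        bounded_linear_minus[OF bounded_linear_ident] assms(3)]]
  by simp

lemma smooth_on_bounded_bilinear:
  "open S \<Longrightarrow> bounded_bilinear h \<Longrightarrow> smooth_on S f \<Longrightarrow> smooth_on S g \<Longrightarrow> smooth_on S (\<lambda>x. h (f x) (g x))"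
  by (simp add: smooth_on_def Ck_on_bounded_bilinear)

lemmas smooth_on_scaleR = smooth_on_bounded_bilinear[OF _ bounded_bilinear_scaleR]
lemmas smooth_on_mult = smooth_on_bounded_bilinear[OF _ bounded_bilinear_mult]

lemma smooth_on_sum:
  "open S \<Longrightarrow> (\<And>i. i \<in> I \<Longrightarrow> smooth_on S (f i)) \<Longrightarrow> smooth_on S (\<lambda>x. \<Sum>i\<in>I. f i x)"
  by (simp add: smooth_on_def Ck_on_sum)

lemma smooth_on_Pair:
  assumes "open S" "smooth_on S f" "smooth_on S g"
  shows "smooth_on S (\<lambda>x. (f x, g x))"
  using smooth_on_add[OF assms(1)
      smooth_on_bounded_linear[OF assms(1) bounded_linear_Pair[OF bounded_linear_ident bounded_linear_zero] assms(2)]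
      smooth_on_bounded_linear[OF assms(1) bounded_linear_Pair[OF bounded_linear_zero bounded_linear_ident] assms(3)]]
  by simp

lemma smooth_on_compose:
  fixes g :: "'a::real_normed_vector \<Rightarrow> 'b::euclidean_space"
  assumes "open S" "smooth_on S g" "smooth_on T f" "g ` S \<subseteq> T"
  shows "smooth_on S (\<lambda>x. f (g x))"
  using assms Ck_on_compose unfolding smooth_on_def by blast

lemma smooth_on_has_derivative:
  assumes "smooth_on S f" "x \<in> S"
  shows "(f has_derivative frechet_derivative f (at x)) (at x)"
  using assms Ck_on_has_derivative unfolding smooth_on_def by blast

lemma smooth_on_differentiable: "smooth_on S f \<Longrightarrow> x \<in> S \<Longrightarrow> f differentiable (at x)"
  using smooth_on_has_derivative by (auto simp: differentiable_def)

lemma smooth_on_linear_derivative: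
  "smooth_on S f \<Longrightarrow> x \<in> S \<Longrightarrow> linear (frechet_derivative f (at x))"
  by (simp add: linear_frechet_derivative smooth_on_differentiable)

lemma smooth_on_imp_continuous_on: "smooth_on S f \<Longrightarrow> continuous_on S f"
  unfolding smooth_on_def using Ck_on.simps(1) by blast

lemma smooth_on_frechet_derivative:
  "smooth_on S f \<Longrightarrow> smooth_on S (\<lambda>x. frechet_derivative f (at x) v)"
  unfolding smooth_on_def using Ck_on.simps(2) by blast

lemma linear_expand_Basis:
  fixes f :: "'a::euclidean_space \<Rightarrow> 'b::real_vector"
  assumes "linear f"
  shows "f w = (\<Sum>b\<in>Basis. (w \<bullet> b) *\<^sub>R f b)"
  using linear_sum[OF assms, of "\<lambda>b. (w \<bullet> b) *\<^sub>R b" Basis]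
  by (simp add: euclidean_representation linear_cmul[OF assms])

lemma smooth_on_frechet_derivative_apply:
  fixes f :: "'a::euclidean_space \<Rightarrow> 'b::real_normed_vector"
    and g :: "'c::real_normed_vector \<Rightarrow> 'a"
  assumes "open S" "smooth_on T f" "smooth_on S g" "smooth_on S h" "g ` S \<subseteq> T"
  shows "smooth_on S (\<lambda>x. frechet_derivative f (at (g x)) (h x))"
proof -
  have "smooth_on S (\<lambda>x. \<Sum>b\<in>Basis. (h x \<bullet> b) *\<^sub>R frechet_derivative f (at (g x)) b)"
    by (intro smooth_on_sum smooth_on_scaleR
        smooth_on_bounded_linear[OF _ bounded_linear_inner_left]
        smooth_on_compose[OF _ assms(3) smooth_on_frechet_derivative[OF assms(2)] assms(5)] assms(1,4))
  then show ?thesis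
  proof (rule smooth_on_cong[OF assms(1), rotated])
    fix x assume "x \<in> S"
    then have "g x \<in> T" using assms(5) by auto
    from linear_expand_Basis[OF smooth_on_linear_derivative[OF assms(2) this], of "h x"]
    show "(\<Sum>b\<in>Basis. (h x \<bullet> b) *\<^sub>R frechet_derivative f (at (g x)) b) =
        frechet_derivative f (at (g x)) (h x)" ..
  qed
qed



section \<open>Symmetry of second derivatives\<close>

text \<open>
  The mean value theorem, applied first in the direction \<open>v\<close> to
  \<open>s \<mapsto> f (x + h w + s v) - f (x + s v)\<close> and then in the direction \<open>w\<close>.
\<close>

lemma second_difference:
  fixes f :: "'a::real_normed_vector \<Rightarrow> real"
  assumes "Ck_on 2 f S" "h > 0"
    and mem: "\<And>s t. 0 \<le> s \<Longrightarrow> s \<le> h \<Longrightarrow> 0 \<le> t \<Longrightarrow> t \<le> h \<Longrightarrow> x + s *\<^sub>R v + t *\<^sub>R w \<in> S"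
  shows "\<exists>s t. 0 \<le> s \<and> s \<le> h \<and> 0 \<le> t \<and> t \<le> h \<and>
    f (x + h *\<^sub>R v + h *\<^sub>R w) - f (x + h *\<^sub>R v) - f (x + h *\<^sub>R w) + f x =
    h * (h * frechet_derivative (\<lambda>z. frechet_derivative f (at z) v) (at (x + s *\<^sub>R v + t *\<^sub>R w)) w)"
proof -
  have path: "((\<lambda>s. F (c + s *\<^sub>R d)) has_real_derivative frechet_derivative F (at (c + s *\<^sub>R d)) d) (at s)"
    if "Ck_on (Suc k) F S" "c + s *\<^sub>R d \<in> S" for F :: "'a \<Rightarrow> real" and k c d s
  proof -
    have "linear (frechet_derivative F (at (c + s *\<^sub>R d)))"
      using that by (intro linear_frechet_derivative) auto
    moreover have "((\<lambda>s. c + s *\<^sub>R d) has_derivative (\<lambda>t. t *\<^sub>R d)) (at s)"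
      by (auto intro!: derivative_eq_intros)
    ultimately show ?thesis
      using has_derivative_compose[where f = "\<lambda>s. c + s *\<^sub>R d" and f' = "\<lambda>t. t *\<^sub>R d" and x = s and s = UNIV,
          OF _ Ck_on_has_derivative[OF that]]
      by (simp add: has_field_derivative_def linear_cmul mult_commute_abs)
  qed
  have C2: "Ck_on (Suc (Suc 0)) f S" using assms(1) by (simp add: numeral_2_eq_2)
  have C1: "Ck_on (Suc 0) (\<lambda>z. frechet_derivative f (at z) v) S" using C2 by auto
  define G where "G s = f (x + h *\<^sub>R w + s *\<^sub>R v) - f (x + s *\<^sub>R v)" for s
  define G' where "G' s = frechet_derivative f (at (x + h *\<^sub>R w + s *\<^sub>R v)) v - frechet_derivative f (at (x + s *\<^sub>R v)) v" for s
  have "(G has_real_derivative G' s) (at s)" if "0 \<le> s" "s \<le> h" for s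
    unfolding G_def G'_def
    by (intro DERIV_diff path[OF C2])
      (use mem[of s h] mem[of s 0] that assms(2) in \<open>auto simp: add_ac\<close>)
  then obtain s where s: "0 < s" "s < h" "G h - G 0 = h * G' s"
    using MVT2[of 0 h G G'] assms(2) by auto
  define H where "H t = frechet_derivative f (at (x + s *\<^sub>R v + t *\<^sub>R w)) v" for t
  have "(H has_real_derivative frechet_derivative (\<lambda>z. frechet_derivative f (at z) v)
      (at (x + s *\<^sub>R v + t *\<^sub>R w)) w) (at t)" if "0 \<le> t" "t \<le> h" for t
    unfolding H_def by (rule path[OF C1]) (use mem[of s t] that s in auto)
  then obtain t where t: "0 < t" "t < h" "H h - H 0 = h * frechet_derivative
      (\<lambda>z. frechet_derivative f (at z) v) (at (x + s *\<^sub>R v + t *\<^sub>R w)) w"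
    using MVT2[of 0 h H "\<lambda>t. frechet_derivative
      (\<lambda>z. frechet_derivative f (at z) v) (at (x + s *\<^sub>R v + t *\<^sub>R w)) w"] assms(2) by auto
  have "G' s = H h - H 0" by (simp add: G'_def H_def add_ac)
  then show ?thesis
    using s t by (intro exI[of _ s] exI[of _ t]) (auto simp: G_def add_ac)
qed

lemma frechet_derivative_inner_left:
  assumes "f differentiable (at x)"
  shows "frechet_derivative (\<lambda>x. f x \<bullet> b) (at x) v = frechet_derivative f (at x) v \<bullet> b"
  using frechet_derivative_at[OF has_derivative_inner_left[OF
      assms[unfolded frechet_derivative_works]], of b] by metis

text \<open>
  Both iterated derivatives are limits of the second difference of \<open>f\<close> over a shrinking
  parallelogram.
\<close>

lemma frechet_derivative_symmetric_real:
  fixes f :: "'a::real_normed_vector \<Rightarrow> real"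
  assumes "open S" "Ck_on 2 f S" "x \<in> S"
  shows "frechet_derivative (\<lambda>z. frechet_derivative f (at z) v) (at x) w =
    frechet_derivative (\<lambda>z. frechet_derivative f (at z) w) (at x) v" (is "?A v w x = ?A w v x")
proof (rule ccontr)
  assume ne: "?A v w x \<noteq> ?A w v x"
  define e where "e = \<bar>?A v w x - ?A w v x\<bar> / 2"
  have e: "e > 0" using ne by (simp add: e_def)
  have cont: "isCont (?A v w) x" for v w
    using assms by (simp add: numeral_2_eq_2 continuous_on_eq_continuous_at)
  from assms(1,3) obtain d0 where d0: "d0 > 0" "ball x d0 \<subseteq> S"
    using open_contains_ball by blast
  obtain d1 where d1: "d1 > 0" "\<And>z. dist z x < d1 \<Longrightarrow> dist (?A v w z) (?A v w x) < e"
    using cont[of v w] e unfolding continuous_at_eps_delta by blast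
  obtain d2 where d2: "d2 > 0" "\<And>z. dist z x < d2 \<Longrightarrow> dist (?A w v z) (?A w v x) < e"
    using cont[of w v] e unfolding continuous_at_eps_delta by blast
  define d where "d = min d0 (min d1 d2)"
  have d: "d > 0" using d0 d1 d2 by (simp add: d_def)
  define h where "h = d / (norm v + norm w + 1)"
  have h: "h > 0" using d by (simp add: h_def add_nonneg_pos)
  have "h * (norm v + norm w + 1) = d"
    unfolding h_def by (smt (verit) norm_ge_zero nonzero_eq_divide_eq)
  then have hd: "h * norm v + h * norm w < d"
    using h by (simp add: algebra_simps)
  have near: "dist (x + s *\<^sub>R v + t *\<^sub>R w) x < d"
    if "0 \<le> s" "s \<le> h" "0 \<le> t" "t \<le> h" for s t
  proof -
    have "norm (s *\<^sub>R v + t *\<^sub>R w) \<le> h * norm v + h * norm w"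
      using that by (intro norm_triangle_mono) (auto intro: mult_right_mono)
    then show ?thesis using hd by (simp add: dist_norm add.assoc)
  qed
  have near': "dist (x + s *\<^sub>R w + t *\<^sub>R v) x < d"
    if "0 \<le> s" "s \<le> h" "0 \<le> t" "t \<le> h" for s t
    using near[OF that(3,4,1,2)] by (simp add: add_ac)
  have mem: "x + s *\<^sub>R v + t *\<^sub>R w \<in> S" "x + s *\<^sub>R w + t *\<^sub>R v \<in> S"
    if "0 \<le> s" "s \<le> h" "0 \<le> t" "t \<le> h" for s t
    using near[OF that] near'[OF that] d0(2) by (auto simp: d_def dist_commute subset_iff)
  obtain s t where st: "0 \<le> s" "s \<le> h" "0 \<le> t" "t \<le> h"
    "f (x + h *\<^sub>R v + h *\<^sub>R w) - f (x + h *\<^sub>R v) - f (x + h *\<^sub>R w) + f x = h * (h * ?A v w (x + s *\<^sub>R v + t *\<^sub>R w))"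
    using second_difference[OF assms(2) h mem(1)] by blast
  obtain s' t' where st': "0 \<le> s'" "s' \<le> h" "0 \<le> t'" "t' \<le> h"
    "f (x + h *\<^sub>R w + h *\<^sub>R v) - f (x + h *\<^sub>R w) - f (x + h *\<^sub>R v) + f x = h * (h * ?A w v (x + s' *\<^sub>R w + t' *\<^sub>R v))"
    using second_difference[OF assms(2) h mem(2)] by blast
  have "h * (h * ?A v w (x + s *\<^sub>R v + t *\<^sub>R w)) = h * (h * ?A w v (x + s' *\<^sub>R w + t' *\<^sub>R v))"
    using st(5) st'(5) unfolding add.commute[of "x + h *\<^sub>R w" "h *\<^sub>R v"] add.left_commute[of _ x]
      add.assoc[of x "h *\<^sub>R v"] add.commute[of "h *\<^sub>R w" "h *\<^sub>R v"] by linarith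
  then have eq: "?A v w (x + s *\<^sub>R v + t *\<^sub>R w) = ?A w v (x + s' *\<^sub>R w + t' *\<^sub>R v)"
    using h by simp
  have "\<bar>?A v w (x + s *\<^sub>R v + t *\<^sub>R w) - ?A v w x\<bar> < e"
    using d1(2)[of "x + s *\<^sub>R v + t *\<^sub>R w"] near[OF st(1-4)] by (simp add: d_def dist_real_def)
  moreover have "\<bar>?A w v (x + s' *\<^sub>R w + t' *\<^sub>R v) - ?A w v x\<bar> < e"
    using d2(2)[of "x + s' *\<^sub>R w + t' *\<^sub>R v"] near'[OF st'(1-4)] by (simp add: d_def dist_real_def)
  ultimately have "\<bar>?A v w x - ?A w v x\<bar> < 2 * e"
    unfolding eq by (simp add: abs_less_iff)
  then show False by (simp add: e_def)
qed

lemma frechet_derivative_symmetric: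
  fixes f :: "'a::real_normed_vector \<Rightarrow> 'b::euclidean_space"
  assumes "open S" "smooth_on S f" "x \<in> S"
  shows "frechet_derivative (\<lambda>z. frechet_derivative f (at z) v) (at x) w =
    frechet_derivative (\<lambda>z. frechet_derivative f (at z) w) (at x) v"
proof (rule euclidean_eqI)
  fix b :: 'b
  have *: "frechet_derivative (\<lambda>z. frechet_derivative f (at z) v) (at x) w \<bullet> b =
      frechet_derivative (\<lambda>z. frechet_derivative (\<lambda>y. f y \<bullet> b) (at z) v) (at x) w" for v w
  proof -
    have eq: "frechet_derivative (\<lambda>y. f y \<bullet> b) (at z) v = frechet_derivative f (at z) v \<bullet> b"
      if "z \<in> S" for z
      by (rule frechet_derivative_inner_left[OF smooth_on_differentiable[OF assms(2) that]])
    have d: "(\<lambda>z. frechet_derivative f (at z) v) differentiable (at x)"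
      by (rule smooth_on_differentiable[OF smooth_on_frechet_derivative[OF assms(2)] assms(3)])
    have "frechet_derivative (\<lambda>z. frechet_derivative f (at z) v \<bullet> b) (at x) =
        frechet_derivative (\<lambda>z. frechet_derivative (\<lambda>y. f y \<bullet> b) (at z) v) (at x)"
      by (rule frechet_derivative_transform_within_open[OF _ assms(1,3)])
        (use d eq in \<open>auto simp: differentiable_def intro: has_derivative_inner_left\<close>)
    then show ?thesis
      using frechet_derivative_inner_left[OF d] by metis
  qed
  have "smooth_on S (\<lambda>y. f y \<bullet> b)"
    by (rule smooth_on_bounded_linear[OF assms(1) bounded_linear_inner_left assms(2)])
  then show "frechet_derivative (\<lambda>z. frechet_derivative f (at z) v) (at x) w \<bullet> b =
      frechet_derivative (\<lambda>z. frechet_derivative f (at z) w) (at x) v \<bullet> b"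
    unfolding * using frechet_derivative_symmetric_real[OF assms(1) _ assms(3)]
    by (auto simp: smooth_on_def)
qed

text \<open>
  The product rule for \<open>z \<mapsto> Df(z) (g z)\<close>. Expanding \<open>g z\<close> in a basis reduces it to the
  directional derivatives of \<open>f\<close>, which are the only derivatives that \<open>smooth_on\<close> speaks of.
\<close>

lemma has_derivative_frechet_derivative_apply:
  fixes f :: "'a::euclidean_space \<Rightarrow> 'b::real_normed_vector"
    and g :: "'a \<Rightarrow> 'a"
  assumes "open S" "smooth_on S f" "x \<in> S" "(g has_derivative g') (at x)"
  shows "((\<lambda>z. frechet_derivative f (at z) (g z)) has_derivative
    (\<lambda>u. frechet_derivative (\<lambda>z. frechet_derivative f (at z) (g x)) (at x) u +
      frechet_derivative f (at x) (g' u))) (at x)"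
proof -
  let ?D = "\<lambda>z. frechet_derivative f (at z)"
  have lin: "linear (?D z)" if "z \<in> S" for z
    by (rule smooth_on_linear_derivative[OF assms(2) that])
  have D: "((\<lambda>z. ?D z v) has_derivative frechet_derivative (\<lambda>z. ?D z v) (at x)) (at x)" for v
    by (rule smooth_on_has_derivative[OF smooth_on_frechet_derivative[OF assms(2)] assms(3)])
  have "((\<lambda>z. \<Sum>b\<in>Basis. (c \<bullet> b) *\<^sub>R ?D z b) has_derivative
      (\<lambda>u. \<Sum>b\<in>Basis. (c \<bullet> b) *\<^sub>R frechet_derivative (\<lambda>z. ?D z b) (at x) u)) (at x)" for c
    by (auto intro!: derivative_eq_intros D)
  then have "((\<lambda>z. ?D z c) has_derivative
      (\<lambda>u. \<Sum>b\<in>Basis. (c \<bullet> b) *\<^sub>R frechet_derivative (\<lambda>z. ?D z b) (at x) u)) (at x)" for c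
    by (rule has_derivative_transform_within_open[OF _ assms(1,3)])
      (rule linear_expand_Basis[OF lin, symmetric])
  then have const: "(\<Sum>b\<in>Basis. (c \<bullet> b) *\<^sub>R frechet_derivative (\<lambda>z. ?D z b) (at x) u) =
      frechet_derivative (\<lambda>z. ?D z c) (at x) u" for c u
    by (rule fun_cong[OF frechet_derivative_at])
  have "((\<lambda>z. \<Sum>b\<in>Basis. (g z \<bullet> b) *\<^sub>R ?D z b) has_derivative
      (\<lambda>u. (\<Sum>b\<in>Basis. (g x \<bullet> b) *\<^sub>R frechet_derivative (\<lambda>z. ?D z b) (at x) u) +
        (\<Sum>b\<in>Basis. (g' u \<bullet> b) *\<^sub>R ?D x b))) (at x)"
    by (auto intro!: derivative_eq_intros D assms(4) simp: sum.distrib)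
  then have "((\<lambda>z. \<Sum>b\<in>Basis. (g z \<bullet> b) *\<^sub>R ?D z b) has_derivative
      (\<lambda>u. frechet_derivative (\<lambda>z. ?D z (g x)) (at x) u + ?D x (g' u))) (at x)"
    unfolding const linear_expand_Basis[OF lin[OF assms(3)], symmetric] .
  then show ?thesis
    by (rule has_derivative_transform_within_open[OF _ assms(1,3)])
      (rule linear_expand_Basis[OF lin, symmetric])
qed


section \<open>Integrals depending on a parameter\<close>

lemma Ck_on_imp_continuous_on: "Ck_on k f S \<Longrightarrow> continuous_on S f"
  by (cases k) (auto intro: differentiable_imp_continuous_on simp: differentiable_on_def differentiable_at_withinI)

text \<open>
  Differentiation under the integral sign. The Leibniz rule asks for a derivative that is continuous
  in the operator norm; in finite dimension continuity of the directional derivatives suffices.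
\<close>

lemma has_derivative_integral_param:
  fixes h :: "'a::euclidean_space \<times> real \<Rightarrow> 'b::banach"
  assumes "open S" "Ck_on (Suc k) h (S \<times> UNIV)" "z \<in> S"
  shows "((\<lambda>z. integral {0..1} (\<lambda>t. h (z, t))) has_derivative
    (\<lambda>a. integral {0..1} (\<lambda>t. frechet_derivative h (at (z, t)) (a, 0)))) (at z)"
proof -
  obtain e where e: "e > 0" "ball z e \<subseteq> S"
    using assms(1,3) open_contains_ball by blast
  have z: "z \<in> ball z e" using e(1) by simp
  define h' where "h' x t = Blinfun (\<lambda>a. frechet_derivative h (at (x, t)) (a, 0))" for x t
  have der: "((\<lambda>x. h (x, t)) has_derivative (\<lambda>a. frechet_derivative h (at (x, t)) (a, 0))) (at x)"
    if "x \<in> S" for x t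
  proof -
    have "((\<lambda>x. (x, t)) has_derivative (\<lambda>a. (a, 0))) (at x)"
      by (intro has_derivative_Pair has_derivative_ident has_derivative_const)
    then show ?thesis
      using has_derivative_compose[where f = "\<lambda>x. (x, t)" and f' = "\<lambda>a. (a, 0)" and x = x and s = UNIV,
        OF _ Ck_on_has_derivative[OF assms(2), of "(x, t)"]] that
      by simp
  qed
  have h': "blinfun_apply (h' x t) = (\<lambda>a. frechet_derivative h (at (x, t)) (a, 0))"
    if "x \<in> S" for x t
    unfolding h'_def using has_derivative_bounded_linear[OF der[OF that]]
    by (rule bounded_linear_Blinfun_apply)
  have conth: "continuous_on (S \<times> UNIV) h" by (rule Ck_on_imp_continuous_on[OF assms(2)])
  have conth': "continuous_on (S \<times> UNIV) (\<lambda>z. frechet_derivative h (at z) v)" for v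
  proof (rule Ck_on_imp_continuous_on)
    show "Ck_on k (\<lambda>z. frechet_derivative h (at z) v) (S \<times> UNIV)"
      using assms(2) unfolding Ck_on.simps by blast
  qed
  have cont: "continuous_on (ball z e \<times> {0..1}) (\<lambda>(x, t). h' x t)"
  proof (rule continuous_on_blinfun_componentwise)
    fix i :: 'a
    have "continuous_on (ball z e \<times> {0..1}) (\<lambda>p. frechet_derivative h (at p) (i, 0))"
      by (rule continuous_on_subset[OF conth']) (use e in auto)
    then show "continuous_on (ball z e \<times> {0..1}) (\<lambda>p. blinfun_apply (case p of (x, t) \<Rightarrow> h' x t) i)"
      by (rule continuous_on_eq) (use e h' in auto)
  qed
  have contz: "continuous_on {0..1} (h' z)"
  proof -
    have "continuous_on {0..1} (\<lambda>t. case (z, t) of (x, t) \<Rightarrow> h' x t)"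
      by (rule continuous_on_compose2[OF cont])
        (use z in \<open>auto simp: continuous_on_Pair continuous_on_id continuous_on_const\<close>)
    then show ?thesis by simp
  qed
  have "((\<lambda>x. integral (cbox 0 1) (\<lambda>t. h (x, t))) has_derivative integral (cbox 0 1) (h' z)) (at z within ball z e)"
  proof (rule leibniz_rule[OF _ _ _ z])
    show "((\<lambda>x. h (x, t)) has_derivative blinfun_apply (h' x t)) (at x within ball z e)"
      if "x \<in> ball z e" for x t
    proof -
      have "x \<in> S" using that e by auto
      then show ?thesis using der h' by (auto intro: has_derivative_at_withinI)
    qed
    show "(\<lambda>t. h (x, t)) integrable_on cbox 0 1" if "x \<in> ball z e" for x
      using that e
      by (intro integrable_continuous continuous_on_compose2[OF conth]) (auto intro!: continuous_intros)
  qed (use cont in auto)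
  then have "((\<lambda>x. integral {0..1} (\<lambda>t. h (x, t))) has_derivative integral {0..1} (h' z)) (at z)"
    using at_within_open[OF z] by simp
  moreover have "blinfun_apply (integral {0..1} (h' z)) =
      (\<lambda>a. integral {0..1} (\<lambda>t. frechet_derivative h (at (z, t)) (a, 0)))"
  proof (rule ext)
    fix a
    have "integral {0..1} ((\<lambda>F. blinfun_apply F a) \<circ> h' z) = blinfun_apply (integral {0..1} (h' z)) a"
      by (rule integral_linear[OF integrable_continuous_real[OF contz] blinfun.bounded_linear_left])
    then show "blinfun_apply (integral {0..1} (h' z)) a =
        integral {0..1} (\<lambda>t. frechet_derivative h (at (z, t)) (a, 0))"
      by (simp add: o_def h'[OF assms(3)])
  qed
  ultimately show ?thesis by simp
qed

lemma Ck_on_integral: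
  fixes h :: "'a::euclidean_space \<times> real \<Rightarrow> 'b::banach"
  assumes "open S" "Ck_on k h (S \<times> UNIV)"
  shows "Ck_on k (\<lambda>z. integral {0..1} (\<lambda>t. h (z, t))) S"
  using assms(2)
proof (induction k arbitrary: h)
  case 0
  then have "continuous_on (S \<times> cbox 0 1) (\<lambda>(x, t). h (x, t))"
    by (auto intro: continuous_on_subset)
  from integral_continuous_on_param[OF this] show ?case by simp
next
  case (Suc k)
  show ?case
  proof (rule Ck_on_SucI[OF assms(1) has_derivative_integral_param[OF assms(1) Suc.prems]])
    fix a
    show "Ck_on k (\<lambda>z. integral {0..1} (\<lambda>t. frechet_derivative h (at (z, t)) (a, 0))) S"
      using Suc.prems by (intro Suc.IH) auto
  qed
qed

lemma smooth_on_integral: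
  fixes h :: "'a::euclidean_space \<times> real \<Rightarrow> 'b::banach"
  assumes "open S" "smooth_on (S \<times> UNIV) h"
  shows "smooth_on S (\<lambda>z. integral {0..1} (\<lambda>t. h (z, t)))"
  using assms Ck_on_integral unfolding smooth_on_def by blast

text \<open>
  The Poincare lemma for a closed vector-valued \<open>1\<close>-form \<open>q\<close> on a vector space: differentiating
  under the integral and using the symmetry gives
  \<open>\<integral>\<^sub>0\<^sup>1 q(t y) a + t D(q a)(t y) y dt\<close>, and the integrand is the derivative of \<open>t q(t y) a\<close>.
\<close>

lemma integral_radial_derivative:
  fixes q :: "'b::euclidean_space \<Rightarrow> 'b \<Rightarrow> 'c::euclidean_space"
  assumes smooth: "\<And>a. smooth_on UNIV (\<lambda>y. q y a)"
    and lin: "\<And>y. linear (q y)"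
    and sym: "\<And>y a b. frechet_derivative (\<lambda>y. q y a) (at y) b = frechet_derivative (\<lambda>y. q y b) (at y) a"
  shows "((\<lambda>y. integral {0..1} (\<lambda>t. q (t *\<^sub>R y) y)) has_derivative q y) (at y)"
proof -
  define h where "h z = q (snd z *\<^sub>R fst z) (fst z)" for z :: "'b \<times> real"
  define D where "D a y b = frechet_derivative (\<lambda>y. q y a) (at y) b" for a b y
  have D: "((\<lambda>y. q y a) has_derivative D a y) (at y)" for a y
    using smooth_on_has_derivative[OF smooth, of y a] by (simp add: D_def[abs_def])
  have linD: "linear (D a y)" for a y
    using has_derivative_linear[OF D] .
  have symD: "D a y b = D b y a" for a b y by (simp add: D_def sym)
  have h_sum: "h = (\<lambda>z. \<Sum>b\<in>Basis. (fst z \<bullet> b) *\<^sub>R q (snd z *\<^sub>R fst z) b)"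
    unfolding h_def by (rule ext, rule linear_expand_Basis[OF lin])
  have "smooth_on UNIV h"
    unfolding h_sum
    by (intro smooth_on_sum smooth_on_scaleR smooth_on_compose[OF _ _ smooth]
        smooth_on_linear bounded_linear_intros smooth_on_bounded_linear[OF _ bounded_linear_inner_left]) auto
  then have Ck: "Ck_on (Suc 0) h (UNIV \<times> UNIV)"
    unfolding smooth_on_def UNIV_Times_UNIV by blast
  have der_h: "frechet_derivative h (at (y, t)) (a, 0) = q (t *\<^sub>R y) a + t *\<^sub>R D a (t *\<^sub>R y) y" for t a
  proof -
    have "((\<lambda>z. q (snd z *\<^sub>R fst z) b) has_derivative
        (\<lambda>v. D b (t *\<^sub>R y) (t *\<^sub>R fst v + snd v *\<^sub>R y))) (at (y, t))" for b
      by (rule has_derivative_compose[where f = "\<lambda>z. snd z *\<^sub>R fst z" and x = "(y, t)" and s = UNIV and g = "\<lambda>y. q y b"])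
        (auto intro!: derivative_eq_intros D)
    then have "(h has_derivative (\<lambda>v. \<Sum>b\<in>Basis. (y \<bullet> b) *\<^sub>R D b (t *\<^sub>R y) (t *\<^sub>R fst v + snd v *\<^sub>R y) +
        (fst v \<bullet> b) *\<^sub>R q (t *\<^sub>R y) b)) (at (y, t))"
      unfolding h_sum by (auto intro!: derivative_eq_intros)
    then have "frechet_derivative h (at (y, t)) = (\<lambda>v. \<Sum>b\<in>Basis. (y \<bullet> b) *\<^sub>R D b (t *\<^sub>R y) (t *\<^sub>R fst v + snd v *\<^sub>R y) +
        (fst v \<bullet> b) *\<^sub>R q (t *\<^sub>R y) b)"
      by (rule frechet_derivative_at[symmetric])
    then have "frechet_derivative h (at (y, t)) (a, 0) =
        t *\<^sub>R (\<Sum>b\<in>Basis. (y \<bullet> b) *\<^sub>R D a (t *\<^sub>R y) b) + (\<Sum>b\<in>Basis. (a \<bullet> b) *\<^sub>R q (t *\<^sub>R y) b)"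
      by (simp add: sum.distrib linear_cmul[OF linD] symD[of _ _ a] scaleR_sum_right mult.commute)
    then show ?thesis
      by (simp add: linear_expand_Basis[OF linD, of a _ y, symmetric] linear_expand_Basis[OF lin, of _ a, symmetric])
  qed
  have "integral {0..1} (\<lambda>t. frechet_derivative h (at (y, t)) (a, 0)) = q y a" for a
  proof -
    have "((\<lambda>t. q (t *\<^sub>R y) a + t *\<^sub>R D a (t *\<^sub>R y) y) has_integral
        (1 *\<^sub>R q (1 *\<^sub>R y) a - 0 *\<^sub>R q (0 *\<^sub>R y) a)) {0..1::real}"
    proof (rule fundamental_theorem_of_calculus)
      fix t :: real
      have "((\<lambda>t. q (t *\<^sub>R y) a) has_derivative (\<lambda>s. D a (t *\<^sub>R y) (s *\<^sub>R y))) (at t within {0..1})"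
        by (rule has_derivative_compose[where f = "\<lambda>t. t *\<^sub>R y" and g = "\<lambda>y. q y a"])
          (auto intro!: derivative_eq_intros D)
      then show "((\<lambda>t. t *\<^sub>R q (t *\<^sub>R y) a) has_vector_derivative q (t *\<^sub>R y) a + t *\<^sub>R D a (t *\<^sub>R y) y) (at t within {0..1})"
        unfolding has_vector_derivative_def
        by (auto intro!: derivative_eq_intros simp: linear_cmul[OF linD] algebra_simps)
    qed simp
    then show ?thesis unfolding der_h by (simp add: integral_unique)
  qed
  then show ?thesis
    using has_derivative_integral_param[OF open_UNIV Ck UNIV_I, of y] by (simp add: h_def)
qed


section \<open>Bump functions\<close>

text \<open>
  The factor \<open>(1 / t)\<^sup>n\<close> makes the span of these functions closed under differentiation, so that all of
  them are seen to be smooth at once.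
\<close>

definition flat_fun :: "nat \<Rightarrow> real \<Rightarrow> real" where
  "flat_fun n t = (if t > 0 then (1 / t) ^ n * exp (- 1 / t) else 0)"

lemma flat_fun_tendsto_0: "(flat_fun n \<longlongrightarrow> 0) (at 0)"
proof (rule filterlim_split_at)
  have "(flat_fun n \<longlongrightarrow> 0) (at_left 0) \<longleftrightarrow> ((\<lambda>t. 0::real) \<longlongrightarrow> 0) (at_left (0::real))"
    by (rule filterlim_cong) (auto simp: flat_fun_def eventually_at_filter)
  then show "(flat_fun n \<longlongrightarrow> 0) (at_left 0)" by simp
  have "((\<lambda>t::real. inverse t ^ n / exp (inverse t)) \<longlongrightarrow> 0) (at_right 0)"
    by (rule filterlim_compose[OF tendsto_power_div_exp_0 filterlim_inverse_at_top_right])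
  moreover have "(flat_fun n \<longlongrightarrow> 0) (at_right 0) \<longleftrightarrow> ((\<lambda>t::real. inverse t ^ n / exp (inverse t)) \<longlongrightarrow> 0) (at_right 0)"
    by (rule filterlim_cong) (auto simp: flat_fun_def eventually_at_filter exp_minus divide_simps)
  ultimately show "(flat_fun n \<longlongrightarrow> 0) (at_right 0)" by simp
qed

lemma flat_fun_derivative:
  "(flat_fun n has_real_derivative - real n * flat_fun (Suc n) t + flat_fun (Suc (Suc n)) t) (at t)"
proof -
  consider "t < 0" | "t = 0" | "t > 0" by linarith
  then show ?thesis
  proof cases
    case 1
    have "((\<lambda>t. 0) has_real_derivative 0) (at t)" by simp
    then have "(flat_fun n has_real_derivative 0) (at t)"
      by (rule has_field_derivative_transform_within_open[of _ _ _ "{..<0}"]) (use 1 in \<open>auto simp: flat_fun_def\<close>)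
    then show ?thesis using 1 by (simp add: flat_fun_def)
  next
    case 2
    have "flat_fun n h / h = flat_fun (Suc n) h" for h
      by (simp add: flat_fun_def)
    then have "(flat_fun n has_real_derivative 0) (at 0)"
      using flat_fun_tendsto_0[of "Suc n"]
      by (simp add: DERIV_def flat_fun_def[of _ 0])
    then show ?thesis using 2 by (simp add: flat_fun_def)
  next
    case 3
    have d: "((\<lambda>t. 1 / t) has_real_derivative - (1 / t)\<^sup>2) (at t)"
      using 3 by (auto intro!: derivative_eq_intros simp: power2_eq_square)
    have "((\<lambda>t. (1 / t) ^ n) has_real_derivative - real n * (1 / t) ^ Suc n) (at t)"
      by (rule DERIV_cong[OF DERIV_power[OF d]]) (cases n; simp add: power2_eq_square algebra_simps add_divide_distrib diff_divide_distrib)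
    moreover have "((\<lambda>t. exp (- 1 / t)) has_real_derivative exp (- 1 / t) * (1 / t)\<^sup>2) (at t)"
      using DERIV_fun_exp[OF DERIV_minus[OF d]] by simp
    ultimately have "((\<lambda>t. (1 / t) ^ n * exp (- 1 / t)) has_real_derivative
        - real n * (1 / t) ^ Suc n * exp (- 1 / t) + exp (- 1 / t) * (1 / t)\<^sup>2 * (1 / t) ^ n) (at t)"
      by (rule DERIV_mult)
    then have "((\<lambda>t. (1 / t) ^ n * exp (- 1 / t)) has_real_derivative
        - real n * flat_fun (Suc n) t + flat_fun (Suc (Suc n)) t) (at t)"
      by (rule DERIV_cong) (use 3 in \<open>simp add: flat_fun_def power2_eq_square algebra_simps\<close>)
    then show ?thesis
      by (rule has_field_derivative_transform_within_open[of _ _ _ "{0<..}"]) (use 3 in \<open>auto simp: flat_fun_def\<close>)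
  qed
qed

lemma smooth_on_flat_fun: "smooth_on UNIV (flat_fun n)"
proof -
  have "Ck_on k (flat_fun n) UNIV" for k
  proof (induction k arbitrary: n)
    case 0
    show ?case
      using DERIV_isCont[OF flat_fun_derivative] by (simp add: continuous_at_imp_continuous_on)
  next
    case (Suc k)
    show ?case
    proof (rule Ck_on_SucI[OF open_UNIV])
      show "(flat_fun n has_derivative (\<lambda>v. (- real n * flat_fun (Suc n) t + flat_fun (Suc (Suc n)) t) * v)) (at t)" for t
        using flat_fun_derivative by (simp add: has_field_derivative_def)
      show "Ck_on k (\<lambda>t. (- real n * flat_fun (Suc n) t + flat_fun (Suc (Suc n)) t) * v) UNIV" for v
        by (intro Ck_on_bounded_bilinear[OF _ bounded_bilinear_mult] Ck_on_add Ck_on_const Suc.IH) auto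
    qed
  qed
  then show ?thesis by (simp add: smooth_on_def)
qed

lemma smooth_on_inverse_real: "smooth_on {0<..} (inverse :: real \<Rightarrow> real)"
proof -
  have "Ck_on k (inverse :: real \<Rightarrow> real) {0<..}" for k
  proof (induction k)
    case 0
    show ?case by (auto intro!: continuous_intros)
  next
    case (Suc k)
    show ?case
    proof (rule Ck_on_SucI)
      show "((inverse::real \<Rightarrow> real) has_derivative (\<lambda>v. - (inverse t * v * inverse t))) (at t)" if "t \<in> {0<..}" for t
        using that has_derivative_inverse'[of t UNIV] by simp
      have "Ck_on k (\<lambda>t::real. - v * (inverse t * inverse t)) {0<..}" for v
        by (intro Ck_on_bounded_bilinear[OF _ bounded_bilinear_mult] Ck_on_const Suc.IH) auto
      then show "Ck_on k (\<lambda>t::real. - (inverse t * v * inverse t)) {0<..}" for v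
        by (simp add: mult_ac)
    qed auto
  qed
  then show ?thesis by (simp add: smooth_on_def)
qed

text \<open>
  With \<open>s = |x - c|\<^sup>2 / r\<^sup>2\<close> and \<open>g(t) = exp (- 1 / t)\<close> for \<open>t > 0\<close>, take
  \<open>g(4 - s) / (g(4 - s) + g(s - 1))\<close>.
\<close>

lemma smooth_bump:
  fixes c :: "'a::euclidean_space"
  assumes "r > 0"
  obtains \<psi> :: "'a \<Rightarrow> real" where "smooth_on UNIV \<psi>" "\<And>x. x \<in> ball c r \<Longrightarrow> \<psi> x = 1"
    "\<And>x. x \<notin> cball c (2 * r) \<Longrightarrow> \<psi> x = 0"
proof -
  let ?g = "flat_fun 0"
  define s where "s x = ((x - c) \<bullet> (x - c)) / r\<^sup>2" for x
  define \<psi> where "\<psi> x = ?g (4 - s x) * inverse (?g (4 - s x) + ?g (s x - 1))" for x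
  have pos: "?g (4 - t) + ?g (t - 1) > 0" for t :: real
    by (cases "t < 4") (auto simp: flat_fun_def intro: add_pos_nonneg)
  have s: "smooth_on UNIV s"
    unfolding s_def divide_inverse
    by (intro smooth_on_mult smooth_on_bounded_bilinear[OF _ bounded_bilinear_inner] smooth_on_diff
        smooth_on_const smooth_on_linear bounded_linear_ident) auto
  have g1: "smooth_on UNIV (\<lambda>x. ?g (4 - s x))"
    by (rule smooth_on_compose[OF _ _ smooth_on_flat_fun]) (auto intro!: smooth_on_diff smooth_on_const s)
  have g2: "smooth_on UNIV (\<lambda>x. ?g (s x - 1))"
    by (rule smooth_on_compose[OF _ _ smooth_on_flat_fun]) (auto intro!: smooth_on_diff smooth_on_const s)
  have "smooth_on UNIV \<psi>"
    unfolding \<psi>_def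
    by (intro smooth_on_mult smooth_on_compose[OF _ _ smooth_on_inverse_real] smooth_on_add g1 g2)
      (use pos in auto)
  moreover have "\<psi> x = 1" if "x \<in> ball c r" for x
  proof -
    have "norm (x - c) ^ 2 < r ^ 2" using that by (intro power_strict_mono) (auto simp: dist_norm norm_minus_commute)
    then have "s x < 1" using assms by (simp add: s_def power2_norm_eq_inner)
    then have "?g (s x - 1) = 0" by (simp add: flat_fun_def)
    then show ?thesis using pos[of "s x"] by (simp add: \<psi>_def)
  qed
  moreover have "\<psi> x = 0" if "x \<notin> cball c (2 * r)" for x
  proof -
    have "(2 * r) ^ 2 < norm (x - c) ^ 2"
      using that assms by (intro power_strict_mono) (auto simp: dist_norm norm_minus_commute)
    then have "s x > 4" using assms by (simp add: s_def power2_norm_eq_inner power_mult_distrib field_simps)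
    then show ?thesis by (simp add: \<psi>_def flat_fun_def)
  qed
  ultimately show thesis using that by blast
qed



section \<open>Tangent vectors in charts\<close>

text \<open>
  \<open>transport N i j p\<close> changes the coordinates of a tangent vector at \<open>p\<close> from chart \<open>i\<close> to
  chart \<open>j\<close>; \<open>tangent_vector N i p w\<close> is the tangent vector whose coordinates in chart \<open>i\<close>
  are \<open>w\<close>.
\<close>

definition transport :: "('p, 'i, 'e::euclidean_space) atlas \<Rightarrow> 'i \<Rightarrow> 'i \<Rightarrow> 'p \<Rightarrow> 'e \<Rightarrow> 'e" where
  "transport N i j p = frechet_derivative (transition N i j) (at (chart_map N i p))"

definition tangent_vector :: "('p, 'i, 'e::euclidean_space) atlas \<Rightarrow> 'i \<Rightarrow> 'p \<Rightarrow> 'e \<Rightarrow> 'i \<Rightarrow> 'e" where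
  "tangent_vector N i p w = (\<lambda>j. if j \<in> charts_at N p then transport N i j p w else 0)"

locale atlas_on =
  fixes N :: "('p, 'i, 'e::euclidean_space) atlas"
  assumes atlas: "smooth_atlas N"
begin

abbreviation cdom :: "'i \<Rightarrow> 'p set" where "cdom \<equiv> chart_dom N"
abbreviation chart :: "'i \<Rightarrow> 'p \<Rightarrow> 'e" where "chart \<equiv> chart_map N"
abbreviation param :: "'i \<Rightarrow> 'e \<Rightarrow> 'p" where "param \<equiv> chart_inv N"

lemma inj_chart: "i \<in> chart_index N \<Longrightarrow> inj_on (chart i) (cdom i)"
  and open_chart: "i \<in> chart_index N \<Longrightarrow> open (chart i ` cdom i)"
  and open_overlap: "i \<in> chart_index N \<Longrightarrow> j \<in> chart_index N \<Longrightarrow> open (chart i ` (cdom i \<inter> cdom j))"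
  and smooth_transition: "i \<in> chart_index N \<Longrightarrow> j \<in> chart_index N \<Longrightarrow>
    smooth_on (chart i ` (cdom i \<inter> cdom j)) (transition N i j)"
  using atlas by (auto simp: smooth_atlas_def)

lemma points_eq: "points N = (\<Union>i\<in>chart_index N. cdom i)"
  using atlas by (auto simp: smooth_atlas_def)

lemma charts_at_iff: "i \<in> charts_at N p \<longleftrightarrow> i \<in> chart_index N \<and> p \<in> cdom i"
  by (auto simp: charts_at_def)

lemma charts_at_empty: "p \<notin> points N \<Longrightarrow> i \<notin> charts_at N p"
  by (auto simp: charts_at_def points_eq)

lemma charts_at_ex: "p \<in> points N \<Longrightarrow> \<exists>i. i \<in> charts_at N p"
  by (auto simp: charts_at_def points_eq)

lemma dom_points: "i \<in> chart_index N \<Longrightarrow> p \<in> cdom i \<Longrightarrow> p \<in> points N"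
  by (auto simp: points_eq)

lemma param_chart: "i \<in> chart_index N \<Longrightarrow> p \<in> cdom i \<Longrightarrow> param i (chart i p) = p"
  by (simp add: chart_inv_def inj_chart)

lemma param_in_dom: "x \<in> chart i ` cdom i \<Longrightarrow> param i x \<in> cdom i"
  and chart_param: "x \<in> chart i ` cdom i \<Longrightarrow> chart i (param i x) = x"
  by (auto simp: chart_inv_def inv_into_into f_inv_into_f)

lemma param_overlap:
  assumes "i \<in> chart_index N" "x \<in> chart i ` (cdom i \<inter> D)"
  shows "param i x \<in> cdom i \<inter> D"
  using assms by (auto simp: param_chart)

lemma overlap_iff:
  assumes "i \<in> chart_index N" "x \<in> chart i ` cdom i"
  shows "x \<in> chart i ` (cdom i \<inter> D) \<longleftrightarrow> param i x \<in> D"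
  using assms by (auto simp: param_chart)

lemma param_transition:
  assumes "i \<in> chart_index N" "j \<in> chart_index N" "x \<in> chart i ` (cdom i \<inter> cdom j)"
  shows "param j (transition N i j x) = param i x"
  using param_overlap[OF assms(1,3)] assms(2) by (simp add: transition_def param_chart)

lemma has_derivative_transition:
  assumes "i \<in> charts_at N p" "j \<in> charts_at N p"
  shows "(transition N i j has_derivative transport N i j p) (at (chart i p))"
  unfolding transport_def
  by (rule smooth_on_has_derivative[OF smooth_transition]) (use assms in \<open>auto simp: charts_at_iff\<close>)

lemma linear_transport:
  "i \<in> charts_at N p \<Longrightarrow> j \<in> charts_at N p \<Longrightarrow> linear (transport N i j p)"
  using has_derivative_linear[OF has_derivative_transition] .

lemma transport_id:
  assumes "i \<in> charts_at N p"
  shows "transport N i i p = (\<lambda>v. v)"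
proof -
  have i: "i \<in> chart_index N" "p \<in> cdom i" using assms by (auto simp: charts_at_iff)
  have "(transition N i i has_derivative (\<lambda>v. v)) (at (chart i p))"
    by (rule has_derivative_transform_within_open[OF has_derivative_ident open_chart[OF i(1)]])
      (use i in \<open>auto simp: transition_def param_chart\<close>)
  then show ?thesis
    unfolding transport_def by (rule frechet_derivative_at[symmetric])
qed

text \<open>
  The chain rule for transition maps, which makes tangent vectors determined by one coordinate vector.
\<close>

lemma transport_trans:
  assumes "i \<in> charts_at N p" "j \<in> charts_at N p" "k \<in> charts_at N p"
  shows "transport N j k p (transport N i j p v) = transport N i k p v"
proof -
  have i: "i \<in> chart_index N" "j \<in> chart_index N" "k \<in> chart_index N" "p \<in> cdom i" "p \<in> cdom j" "p \<in> cdom k"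
    using assms by (auto simp: charts_at_iff)
  let ?U = "chart i ` (cdom i \<inter> cdom j) \<inter> chart i ` (cdom i \<inter> cdom k)"
  have eq: "transition N i j (chart i p) = chart j p"
    using i by (simp add: transition_def param_chart)
  have "((\<lambda>x. transition N j k (transition N i j x)) has_derivative
      (\<lambda>v. transport N j k p (transport N i j p v))) (at (chart i p))"
    by (rule has_derivative_compose[where g = "transition N j k", OF has_derivative_transition[OF assms(1,2)]])
      (simp add: eq has_derivative_transition[OF assms(2,3)])
  then have "(transition N i k has_derivative (\<lambda>v. transport N j k p (transport N i j p v))) (at (chart i p))"
  proof (rule has_derivative_transform_within_open)
    show "open ?U" using i by (intro open_Int open_overlap) auto
    show "chart i p \<in> ?U" using i by auto
    show "transition N j k (transition N i j x) = transition N i k x" if "x \<in> ?U" for x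
      using param_transition[OF i(1,2)] that by (simp add: transition_def)
  qed
  then show ?thesis
    using frechet_derivative_at unfolding transport_def by metis
qed

lemma tangent_space_iff:
  "v \<in> tangent_space N p \<longleftrightarrow> (\<forall>i. i \<notin> charts_at N p \<longrightarrow> v i = 0) \<and>
    (\<forall>i\<in>charts_at N p. \<forall>j\<in>charts_at N p. v j = transport N i j p (v i))"
  by (simp add: tangent_space_def transport_def)

lemma tangent_space_transport:
  assumes "v \<in> tangent_space N p" "i \<in> charts_at N p" "j \<in> charts_at N p"
  shows "v j = transport N i j p (v i)"
  by (rule assms(1)[unfolded tangent_space_iff, THEN conjunct2, rule_format, OF assms(2,3)])

lemma tangent_space_outside: "v \<in> tangent_space N p \<Longrightarrow> i \<notin> charts_at N p \<Longrightarrow> v i = 0"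
  by (simp add: tangent_space_def)

lemma tangent_vector_in:
  "i \<in> charts_at N p \<Longrightarrow> tangent_vector N i p w \<in> tangent_space N p"
  by (auto simp: tangent_space_iff tangent_vector_def transport_trans)

lemma tangent_vector_self: "i \<in> charts_at N p \<Longrightarrow> tangent_vector N i p w i = w"
  by (simp add: tangent_vector_def transport_id)

lemma tangent_vector_of:
  assumes "v \<in> tangent_space N p" "i \<in> charts_at N p"
  shows "tangent_vector N i p (v i) = v"
proof
  fix j
  show "tangent_vector N i p (v i) j = v j"
  proof (cases "j \<in> charts_at N p")
    case True
    then show ?thesis
      unfolding tangent_space_transport[OF assms True] by (simp only: tangent_vector_def if_True)
  next
    case False
    then show ?thesis
      unfolding tangent_space_outside[OF assms(1) False] by (simp only: tangent_vector_def if_False)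
  qed
qed

lemma tangent_space_eqI:
  assumes "v \<in> tangent_space N p" "w \<in> tangent_space N p" "i \<in> charts_at N p" "v i = w i"
  shows "v = w"
proof -
  have "v = tangent_vector N i p (v i)"
    by (rule tangent_vector_of[OF assms(1,3), symmetric])
  also have "\<dots> = tangent_vector N i p (w i)" by (simp only: assms(4))
  also have "\<dots> = w" by (rule tangent_vector_of[OF assms(2,3)])
  finally show ?thesis .
qed

lemma tangent_spaceI:
  assumes "\<And>i. i \<notin> charts_at N p \<Longrightarrow> v i = 0"
    "\<And>i j. i \<in> charts_at N p \<Longrightarrow> j \<in> charts_at N p \<Longrightarrow> v j = transport N i j p (v i)"
  shows "v \<in> tangent_space N p"
  unfolding tangent_space_iff by (intro conjI allI impI ballI assms)

lemma tangent_space_add: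
  assumes v: "v \<in> tangent_space N p" and w: "w \<in> tangent_space N p"
  shows "v + w \<in> tangent_space N p"
proof (rule tangent_spaceI)
  show "(v + w) i = 0" if "i \<notin> charts_at N p" for i
    by (simp add: tangent_space_outside[OF v that] tangent_space_outside[OF w that])
  show "(v + w) j = transport N i j p ((v + w) i)" if ij: "i \<in> charts_at N p" "j \<in> charts_at N p" for i j
    by (simp add: linear_add[OF linear_transport[OF ij]] tangent_space_transport[OF v ij]
        tangent_space_transport[OF w ij] transport_trans ij)
qed

lemma tangent_space_scaleR:
  assumes v: "v \<in> tangent_space N p"
  shows "(\<lambda>i. c *\<^sub>R v i) \<in> tangent_space N p"
proof (rule tangent_spaceI)
  show "c *\<^sub>R v i = 0" if "i \<notin> charts_at N p" for i
    by (simp add: tangent_space_outside[OF v that])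
  show "c *\<^sub>R v j = transport N i j p (c *\<^sub>R v i)" if ij: "i \<in> charts_at N p" "j \<in> charts_at N p" for i j
    by (simp add: linear_cmul[OF linear_transport[OF ij]] tangent_space_transport[OF v ij] transport_trans ij)
qed

lemma tangent_space_0: "0 \<in> tangent_space N p"
  by (rule tangent_spaceI) (simp_all add: linear_0[OF linear_transport])

section \<open>Vector fields and functions\<close>

abbreviation VF :: "('p \<Rightarrow> 'i \<Rightarrow> 'e) set" where "VF \<equiv> vector_fields N"
abbreviation SF :: "('p \<Rightarrow> real) set" where "SF \<equiv> smooth_functions N"

lemma vector_fieldsI:
  assumes "\<And>p. p \<in> points N \<Longrightarrow> X p \<in> tangent_space N p" "\<And>p. p \<notin> points N \<Longrightarrow> X p = 0"
    "\<And>i. i \<in> chart_index N \<Longrightarrow> smooth_on (chart i ` cdom i) (\<lambda>x. X (param i x) i)"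
  shows "X \<in> VF"
  using assms by (simp add: vector_fields_def)

lemma VF_tangent: "X \<in> VF \<Longrightarrow> p \<in> points N \<Longrightarrow> X p \<in> tangent_space N p"
  and VF_outside: "X \<in> VF \<Longrightarrow> p \<notin> points N \<Longrightarrow> X p = 0"
  and VF_smooth: "X \<in> VF \<Longrightarrow> i \<in> chart_index N \<Longrightarrow> smooth_on (chart i ` cdom i) (\<lambda>x. X (param i x) i)"
  by (simp_all add: vector_fields_def)

lemma SF_outside: "f \<in> SF \<Longrightarrow> p \<notin> points N \<Longrightarrow> f p = 0"
  and SF_smooth: "f \<in> SF \<Longrightarrow> i \<in> chart_index N \<Longrightarrow> smooth_on (chart i ` cdom i) (\<lambda>x. f (param i x))"
  by (simp_all add: smooth_functions_def)

lemma VF_add: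
  assumes X: "X \<in> VF" and Y: "Y \<in> VF"
  shows "X + Y \<in> VF"
proof (rule vector_fieldsI)
  show "(X + Y) p \<in> tangent_space N p" if "p \<in> points N" for p
    using tangent_space_add[OF VF_tangent[OF X that] VF_tangent[OF Y that]] by simp
  show "(X + Y) p = 0" if "p \<notin> points N" for p
    using VF_outside[OF X that] VF_outside[OF Y that] by simp
  show "smooth_on (chart i ` cdom i) (\<lambda>x. (X + Y) (param i x) i)" if "i \<in> chart_index N" for i
    using smooth_on_add[OF open_chart VF_smooth[OF X] VF_smooth[OF Y], OF that that that] by simp
qed

lemma VF_scale:
  assumes f: "f \<in> SF" and X: "X \<in> VF"
  shows "scale_field f X \<in> VF"
proof (rule vector_fieldsI)
  show "scale_field f X p \<in> tangent_space N p" if "p \<in> points N" for p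
    using tangent_space_scaleR[OF VF_tangent[OF X that]] by (simp add: scale_field_def)
  show "scale_field f X p = 0" if "p \<notin> points N" for p
    using VF_outside[OF X that] by (simp add: scale_field_def fun_eq_iff)
  show "smooth_on (chart i ` cdom i) (\<lambda>x. scale_field f X (param i x) i)" if "i \<in> chart_index N" for i
    using smooth_on_scaleR[OF open_chart SF_smooth[OF f] VF_smooth[OF X], OF that that that]
    by (simp add: scale_field_def)
qed

lemma VF_0: "0 \<in> VF"
  by (rule vector_fieldsI) (simp_all add: tangent_space_0 smooth_on_const)

lemma VF_sum: "(\<And>k. k \<in> A \<Longrightarrow> X k \<in> VF) \<Longrightarrow> sum X A \<in> VF"
  by (induction A rule: infinite_finite_induct) (auto simp: VF_0 VF_add)

lemma VF_diff:
  assumes "X \<in> VF" "Y \<in> VF"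
  shows "X - Y \<in> VF"
proof (rule vector_fieldsI)
  show "(X - Y) p \<in> tangent_space N p" if "p \<in> points N" for p
    using tangent_space_add[OF VF_tangent[OF assms(1) that] tangent_space_scaleR[OF VF_tangent[OF assms(2) that], of "-1"]]
    by (simp add: fun_diff_def plus_fun_def)
  show "(X - Y) p = 0" if "p \<notin> points N" for p
    using VF_outside[OF assms(1) that] VF_outside[OF assms(2) that] by simp
  show "smooth_on (chart i ` cdom i) (\<lambda>x. (X - Y) (param i x) i)" if "i \<in> chart_index N" for i
    using smooth_on_diff[OF open_chart VF_smooth[OF assms(1)] VF_smooth[OF assms(2)], OF that that that] by simp
qed

lemma SF_mult:
  assumes f: "f \<in> SF" and g: "g \<in> SF"
  shows "f * g \<in> SF"
  unfolding smooth_functions_def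
proof (intro CollectI conjI allI impI ballI)
  show "(f * g) p = 0" if "p \<notin> points N" for p
    using SF_outside[OF f that] by simp
  show "smooth_on (chart i ` cdom i) (\<lambda>x. (f * g) (param i x))" if "i \<in> chart_index N" for i
    using smooth_on_mult[OF open_chart SF_smooth[OF f] SF_smooth[OF g], OF that that that] by simp
qed

lemma VF_transform:
  assumes "X \<in> VF" "i \<in> chart_index N" "j \<in> chart_index N" "x \<in> chart i ` (cdom i \<inter> cdom j)"
  shows "X (param j (transition N i j x)) j = frechet_derivative (transition N i j) (at x) (X (param i x) i)"
proof -
  let ?p = "param i x"
  have p: "?p \<in> cdom i" "?p \<in> cdom j" "chart i ?p = x"
    using assms by (auto simp: param_chart)
  then have "X ?p j = transport N i j ?p (X ?p i)"
    using assms by (intro tangent_space_transport[OF VF_tangent[OF assms(1) dom_points[OF assms(2) p(1)]]])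
      (auto simp: charts_at_iff)
  then show ?thesis
    using param_transition[OF assms(2-4)] p by (simp add: transport_def)
qed

lemma local_field_has_derivative:
  assumes "X \<in> VF" "i \<in> charts_at N p"
  shows "((\<lambda>x. X (param i x) i) has_derivative
    frechet_derivative (\<lambda>x. X (param i x) i) (at (chart i p))) (at (chart i p))"
  by (rule smooth_on_has_derivative[OF VF_smooth]) (use assms in \<open>auto simp: charts_at_iff\<close>)

lemma local_fun_has_derivative:
  assumes "f \<in> SF" "i \<in> charts_at N p"
  shows "((\<lambda>x. f (param i x)) has_derivative
    frechet_derivative (\<lambda>x. f (param i x)) (at (chart i p))) (at (chart i p))"
  by (rule smooth_on_has_derivative[OF SF_smooth]) (use assms in \<open>auto simp: charts_at_iff\<close>)

text \<open>
  The second derivatives of the transition map that appear when a field is differentiated in two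
  charts cancel in the bracket because they are symmetric.
\<close>

lemma lie_bracket_in_VF:
  assumes X: "X \<in> VF" and Y: "Y \<in> VF"
  shows "lie_bracket N X Y \<in> VF"
proof (rule vector_fieldsI)
  show "lie_bracket N X Y p = 0" if "p \<notin> points N" for p
    using charts_at_empty[OF that] by (simp add: lie_bracket_def fun_eq_iff)
next
  fix i assume i: "i \<in> chart_index N"
  have "smooth_on (chart i ` cdom i) (\<lambda>x.
      frechet_derivative (\<lambda>x. Y (param i x) i) (at x) (X (param i x) i) -
      frechet_derivative (\<lambda>x. X (param i x) i) (at x) (Y (param i x) i))"
    by (intro smooth_on_diff smooth_on_frechet_derivative_apply[where g = "\<lambda>x. x", OF _ VF_smooth[OF Y i]]
        smooth_on_frechet_derivative_apply[where g = "\<lambda>x. x", OF _ VF_smooth[OF X i]]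
        VF_smooth[OF X i] VF_smooth[OF Y i] open_chart[OF i] smooth_on_linear bounded_linear_ident) auto
  then show "smooth_on (chart i ` cdom i) (\<lambda>x. lie_bracket N X Y (param i x) i)"
    by (rule smooth_on_cong[OF open_chart[OF i], rotated])
      (auto simp: lie_bracket_def charts_at_iff i param_chart)
next
  fix p assume "p \<in> points N"
  show "lie_bracket N X Y p \<in> tangent_space N p"
    unfolding tangent_space_iff
  proof (intro conjI allI impI ballI)
    show "lie_bracket N X Y p i = 0" if "i \<notin> charts_at N p" for i
      using that by (simp add: lie_bracket_def)
  next
    fix i j assume i: "i \<in> charts_at N p" and j: "j \<in> charts_at N p"
    have ij: "i \<in> chart_index N" "j \<in> chart_index N" "p \<in> cdom i" "p \<in> cdom j"
      using i j by (auto simp: charts_at_iff)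
    let ?S = "chart i ` (cdom i \<inter> cdom j)" and ?x = "chart i p" and ?\<phi> = "transition N i j"
    have x: "?x \<in> ?S" "?\<phi> ?x = chart j p" "param i ?x = p"
      using ij by (auto simp: transition_def param_chart)
    have S: "open ?S" "smooth_on ?S ?\<phi>" using ij by (auto intro: open_overlap smooth_transition)
    have *: "frechet_derivative (\<lambda>y. Z (param j y) j) (at (chart j p)) (W p j) =
        frechet_derivative (\<lambda>z. frechet_derivative ?\<phi> (at z) (Z p i)) (at ?x) (W p i) +
        transport N i j p (frechet_derivative (\<lambda>y. Z (param i y) i) (at ?x) (W p i))"
      if Z: "Z \<in> VF" and W: "W \<in> VF" for Z W
    proof -
      have "((\<lambda>z. Z (param j (?\<phi> z)) j) has_derivative
          (\<lambda>u. frechet_derivative (\<lambda>y. Z (param j y) j) (at (chart j p)) (transport N i j p u))) (at ?x)"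
        by (rule has_derivative_compose[where g = "\<lambda>y. Z (param j y) j", OF has_derivative_transition[OF i j]])
          (simp add: x local_field_has_derivative[OF Z j])
      moreover have "((\<lambda>z. Z (param j (?\<phi> z)) j) has_derivative
          (\<lambda>u. frechet_derivative (\<lambda>z. frechet_derivative ?\<phi> (at z) (Z (param i ?x) i)) (at ?x) u +
            frechet_derivative ?\<phi> (at ?x) (frechet_derivative (\<lambda>y. Z (param i y) i) (at ?x) u))) (at ?x)"
        by (rule has_derivative_transform_within_open[OF has_derivative_frechet_derivative_apply[OF S x(1)
                local_field_has_derivative[OF Z i]] S(1) x(1)])
          (simp add: VF_transform[OF Z ij(1,2)])
      ultimately have "frechet_derivative (\<lambda>y. Z (param j y) j) (at (chart j p)) (transport N i j p u) =
          frechet_derivative (\<lambda>z. frechet_derivative ?\<phi> (at z) (Z p i)) (at ?x) u +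
          transport N i j p (frechet_derivative (\<lambda>y. Z (param i y) i) (at ?x) u)" for u
        unfolding x(3) transport_def[symmetric] using has_derivative_unique by (metis (no_types, lifting))
      moreover have "W p j = transport N i j p (W p i)"
        by (rule tangent_space_transport[OF VF_tangent[OF W \<open>p \<in> points N\<close>] i j])
      ultimately show ?thesis by simp
    qed
    have sym: "frechet_derivative (\<lambda>z. frechet_derivative ?\<phi> (at z) (Y p i)) (at ?x) (X p i) =
        frechet_derivative (\<lambda>z. frechet_derivative ?\<phi> (at z) (X p i)) (at ?x) (Y p i)"
      by (rule frechet_derivative_symmetric[OF S x(1)])
    show "lie_bracket N X Y p j = transport N i j p (lie_bracket N X Y p i)"
      using i j sym by (simp add: lie_bracket_def *[OF Y X] *[OF X Y] linear_diff[OF linear_transport])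
  qed
qed

text \<open>
  \<open>apply_field\<close> uses an arbitrarily chosen chart; the chain rule shows that every chart gives the same
  value.
\<close>

lemma apply_field_local:
  assumes X: "X \<in> VF" and f: "f \<in> SF" and i: "i \<in> charts_at N p"
  shows "apply_field N X f p = frechet_derivative (\<lambda>x. f (param i x)) (at (chart i p)) (X p i)"
proof -
  have p: "p \<in> points N" using i charts_at_empty by blast
  have indep: "frechet_derivative (\<lambda>x. f (param i x)) (at (chart i p)) (X p i) =
      frechet_derivative (\<lambda>x. f (param j x)) (at (chart j p)) (X p j)"
    if j: "j \<in> charts_at N p" for j
  proof -
    have ij: "i \<in> chart_index N" "j \<in> chart_index N" "p \<in> cdom i" "p \<in> cdom j"
      using i j by (auto simp: charts_at_iff)
    have eq: "transition N i j (chart i p) = chart j p"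
      using ij by (simp add: transition_def param_chart)
    have "((\<lambda>x. f (param j (transition N i j x))) has_derivative
        (\<lambda>v. frechet_derivative (\<lambda>x. f (param j x)) (at (chart j p)) (transport N i j p v))) (at (chart i p))"
      by (rule has_derivative_compose[where g = "\<lambda>y. f (param j y)", OF has_derivative_transition[OF i j]])
        (simp add: eq local_fun_has_derivative[OF f j])
    then have "((\<lambda>x. f (param i x)) has_derivative
        (\<lambda>v. frechet_derivative (\<lambda>x. f (param j x)) (at (chart j p)) (transport N i j p v))) (at (chart i p))"
      by (rule has_derivative_transform_within_open[OF _ open_overlap[OF ij(1,2)]])
        (use ij in \<open>auto simp: param_transition\<close>)
    from fun_cong[OF frechet_derivative_at[OF this], of "X p i"]
    show ?thesis
      unfolding tangent_space_transport[OF VF_tangent[OF X p] i j, symmetric] by simp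
  qed
  have "(SOME i. i \<in> charts_at N p) \<in> charts_at N p"
    using i by (rule someI)
  from indep[OF this] show ?thesis
    using p by (simp add: apply_field_def Let_def)
qed

lemma apply_field_in_SF:
  assumes X: "X \<in> VF" and f: "f \<in> SF"
  shows "apply_field N X f \<in> SF"
  unfolding smooth_functions_def
proof (intro CollectI conjI allI impI ballI)
  show "apply_field N X f p = 0" if "p \<notin> points N" for p
    using that by (simp add: apply_field_def)
  fix i assume i: "i \<in> chart_index N"
  have "smooth_on (chart i ` cdom i) (\<lambda>x. frechet_derivative (\<lambda>x. f (param i x)) (at x) (X (param i x) i))"
    by (intro smooth_on_frechet_derivative_apply[where g = "\<lambda>x. x", OF _ SF_smooth[OF f i]]
        VF_smooth[OF X i] open_chart[OF i] smooth_on_linear bounded_linear_ident) auto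
  then show "smooth_on (chart i ` cdom i) (\<lambda>x. apply_field N X f (param i x))"
    by (rule smooth_on_cong[OF open_chart[OF i], rotated])
      (auto simp: apply_field_local[OF X f, of i] charts_at_iff i param_chart)
qed

section \<open>Cutoff functions and tensoriality\<close>

text \<open>
  \<open>\<beta>\<close> vanishes off a set \<open>K\<close> inside the chart \<open>i\<close>. The last clause says that \<open>K\<close> is
  closed, in the form needed when functions defined in chart \<open>i\<close> are extended by zero.
\<close>

definition cutoff :: "'i \<Rightarrow> 'p set \<Rightarrow> ('p \<Rightarrow> real) \<Rightarrow> bool" where
  "cutoff i K \<beta> \<longleftrightarrow> i \<in> chart_index N \<and> \<beta> \<in> SF \<and> K \<subseteq> cdom i \<and> (\<forall>q. q \<notin> K \<longrightarrow> \<beta> q = 0) \<and>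
     (\<forall>j\<in>chart_index N. open (chart j ` (cdom j - K)))"

lemma cutoff_open: "cutoff i K \<beta> \<Longrightarrow> j \<in> chart_index N \<Longrightarrow> open (chart j ` (cdom j - K))"
  by (simp add: cutoff_def)

text \<open>
  The two open sets \<open>cdom i\<close> and the complement of \<open>K\<close> cover the manifold, and smoothness is local.
\<close>

lemma smooth_on_glue:
  assumes i: "i \<in> chart_index N" and K: "K \<subseteq> cdom i" and op: "open (chart j ` (cdom j - K))"
    and j: "j \<in> chart_index N"
    and s: "smooth_on (chart j ` (cdom j \<inter> cdom i)) (\<lambda>x. G (param j x))"
    and z: "\<And>q. q \<in> cdom j \<Longrightarrow> q \<notin> K \<Longrightarrow> G q = 0"
  shows "smooth_on (chart j ` cdom j) (\<lambda>x. G (param j x))"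
proof (rule smooth_on_local)
  fix x assume x: "x \<in> chart j ` cdom j"
  show "\<exists>T. open T \<and> x \<in> T \<and> smooth_on T (\<lambda>x. G (param j x))"
  proof (cases "param j x \<in> K")
    case True
    then have "x \<in> chart j ` (cdom j \<inter> cdom i)"
      using overlap_iff[OF j x] K by blast
    then show ?thesis using s open_overlap[OF j i] by blast
  next
    case False
    have "smooth_on (chart j ` (cdom j - K)) (\<lambda>x. G (param j x))"
      by (rule smooth_on_cong[OF op _ smooth_on_const[of _ 0]]) (use z j in \<open>auto simp: param_chart\<close>)
    moreover have "x \<in> chart j ` (cdom j - K)"
      using overlap_iff[OF j x, of "- K"] False by (simp add: Diff_eq)
    ultimately show ?thesis using op by blast
  qed
qed

text \<open>
  The products of \<open>\<beta>\<close> with a function and with a constant field of the chart \<open>i\<close>, extended by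
  zero to the whole manifold.
\<close>

definition cut_fun :: "'i \<Rightarrow> ('p \<Rightarrow> real) \<Rightarrow> ('e \<Rightarrow> real) \<Rightarrow> 'p \<Rightarrow> real" where
  "cut_fun i \<beta> f q = (if q \<in> cdom i then \<beta> q * f (chart i q) else 0)"

definition cut_field :: "'i \<Rightarrow> ('p \<Rightarrow> real) \<Rightarrow> 'e \<Rightarrow> 'p \<Rightarrow> 'i \<Rightarrow> 'e" where
  "cut_field i \<beta> w q = (if q \<in> cdom i then (\<lambda>j. \<beta> q *\<^sub>R tangent_vector N i q w j) else 0)"

lemma smooth_transition_on:
  "i \<in> chart_index N \<Longrightarrow> j \<in> chart_index N \<Longrightarrow> smooth_on (chart j ` (cdom j \<inter> cdom i)) (\<lambda>x. chart i (param j x))"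
  using smooth_transition[of j i] by (simp add: transition_def[abs_def])

lemma cut_fun_in_SF:
  assumes c: "cutoff i K \<beta>" and f: "smooth_on (chart i ` cdom i) f"
  shows "cut_fun i \<beta> f \<in> SF"
  unfolding smooth_functions_def
proof (intro CollectI conjI allI impI ballI)
  have i: "i \<in> chart_index N" and \<beta>: "\<beta> \<in> SF" and K: "K \<subseteq> cdom i" and z: "\<And>q. q \<notin> K \<Longrightarrow> \<beta> q = 0"
    using c by (auto simp: cutoff_def)
  show "cut_fun i \<beta> f p = 0" if "p \<notin> points N" for p
    using that dom_points[OF i] by (auto simp: cut_fun_def)
  fix j assume j: "j \<in> chart_index N"
  show "smooth_on (chart j ` cdom j) (\<lambda>x. cut_fun i \<beta> f (param j x))"
  proof (rule smooth_on_glue[OF i K cutoff_open[OF c j] j])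
    have "smooth_on (chart j ` (cdom j \<inter> cdom i)) (\<lambda>x. \<beta> (param j x) * f (chart i (param j x)))"
      by (intro smooth_on_mult smooth_on_subset[OF SF_smooth[OF \<beta> j]] open_overlap i j
          smooth_on_compose[OF _ smooth_transition_on f]) (use j in \<open>auto simp: param_chart\<close>)
    then show "smooth_on (chart j ` (cdom j \<inter> cdom i)) (\<lambda>x. cut_fun i \<beta> f (param j x))"
      by (rule smooth_on_cong[OF open_overlap[OF j i], rotated]) (use j in \<open>auto simp: param_chart cut_fun_def\<close>)
  qed (use z in \<open>auto simp: cut_fun_def\<close>)
qed

lemma cut_field_in_VF:
  assumes c: "cutoff i K \<beta>"
  shows "cut_field i \<beta> w \<in> VF"
proof (rule vector_fieldsI)
  have i: "i \<in> chart_index N" and \<beta>: "\<beta> \<in> SF" and K: "K \<subseteq> cdom i" and z: "\<And>q. q \<notin> K \<Longrightarrow> \<beta> q = 0"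
    using c by (auto simp: cutoff_def)
  show "cut_field i \<beta> w p \<in> tangent_space N p" if "p \<in> points N" for p
    using that i by (auto simp: cut_field_def charts_at_iff intro!: tangent_space_scaleR tangent_vector_in tangent_space_0)
  show "cut_field i \<beta> w p = 0" if "p \<notin> points N" for p
    using that dom_points[OF i] by (auto simp: cut_field_def)
  fix j assume j: "j \<in> chart_index N"
  show "smooth_on (chart j ` cdom j) (\<lambda>x. cut_field i \<beta> w (param j x) j)"
  proof (rule smooth_on_glue[OF i K cutoff_open[OF c j] j, where G = "\<lambda>q. cut_field i \<beta> w q j"])
    have "smooth_on (chart j ` (cdom j \<inter> cdom i)) (\<lambda>x. \<beta> (param j x) *\<^sub>R
        frechet_derivative (transition N i j) (at (chart i (param j x))) w)"
      by (intro smooth_on_scaleR smooth_on_subset[OF SF_smooth[OF \<beta> j]] open_overlap i j smooth_on_const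
          smooth_on_frechet_derivative_apply[OF _ smooth_transition[OF i j] smooth_transition_on])
        (use j in \<open>auto simp: param_chart\<close>)
    then show "smooth_on (chart j ` (cdom j \<inter> cdom i)) (\<lambda>x. cut_field i \<beta> w (param j x) j)"
      by (rule smooth_on_cong[OF open_overlap[OF j i], rotated])
        (use i j in \<open>auto simp: param_chart cut_field_def tangent_vector_def charts_at_iff transport_def\<close>)
  qed (use z in \<open>auto simp: cut_field_def\<close>)
qed

lemma cutoff_in_charts: "cutoff i K \<beta> \<Longrightarrow> \<beta> q \<noteq> 0 \<Longrightarrow> i \<in> charts_at N q"
  by (auto simp: cutoff_def charts_at_iff)

lemma cut_field_at: "cutoff i K \<beta> \<Longrightarrow> \<beta> q = 1 \<Longrightarrow> cut_field i \<beta> w q = tangent_vector N i q w"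
  using cutoff_in_charts[of i K \<beta> q] by (auto simp: cut_field_def charts_at_iff)

lemma cut_field_at_self: "cutoff i K \<beta> \<Longrightarrow> \<beta> q = 1 \<Longrightarrow> cut_field i \<beta> w q i = w"
  using cutoff_in_charts[of i K \<beta> q] by (simp add: cut_field_at tangent_vector_self)

lemma cut_fun_at: "cutoff i K \<beta> \<Longrightarrow> \<beta> q = 1 \<Longrightarrow> cut_fun i \<beta> f q = f (chart i q)"
  using cutoff_in_charts[of i K \<beta> q] by (auto simp: cut_fun_def charts_at_iff)

lemma vector_1_form_in_VF: "T \<in> vector_1_forms N \<Longrightarrow> X \<in> VF \<Longrightarrow> T X \<in> VF"
  and vector_1_form_add: "T \<in> vector_1_forms N \<Longrightarrow> X \<in> VF \<Longrightarrow> Y \<in> VF \<Longrightarrow> T (X + Y) = T X + T Y"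
  and vector_1_form_scale: "T \<in> vector_1_forms N \<Longrightarrow> f \<in> SF \<Longrightarrow> X \<in> VF \<Longrightarrow>
    T (scale_field f X) = scale_field f (T X)"
  by (auto simp: vector_1_forms_def)

lemma vector_1_form_0: "T \<in> vector_1_forms N \<Longrightarrow> T 0 = 0"
  using vector_1_form_add[of T 0 0] VF_0 by simp

lemma vector_1_form_sum:
  assumes "T \<in> vector_1_forms N" "\<And>k. k \<in> A \<Longrightarrow> X k \<in> VF"
  shows "T (sum X A) = (\<Sum>k\<in>A. T (X k))"
  using assms(2)
  by (induction A rule: infinite_finite_induct)
    (auto simp: vector_1_form_0[OF assms(1)] vector_1_form_add[OF assms(1)] VF_sum)

lemma sum_field_apply: "(\<Sum>k\<in>A. X k) q i = (\<Sum>k\<in>A. X k q i)" for X :: "'k \<Rightarrow> 'p \<Rightarrow> 'i \<Rightarrow> 'e"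
  by (induction A rule: infinite_finite_induct) auto

text \<open>
  Tensoriality: only the value of \<open>X\<close> at \<open>q\<close> enters, since \<open>\<beta>\<^sup>2 X\<close> is a combination of the global
  fields \<open>\<beta> \<partial>\<^sub>k\<close> with global coefficient functions.
\<close>

lemma vector_1_form_local:
  assumes T: "T \<in> vector_1_forms N" and X: "X \<in> VF" and c: "cutoff i K \<beta>" and q: "\<beta> q = 1"
  shows "T X q j = (\<Sum>k\<in>Basis. (X q i \<bullet> k) *\<^sub>R T (cut_field i \<beta> k) q j)"
proof -
  have i: "i \<in> chart_index N" and \<beta>: "\<beta> \<in> SF" and K: "K \<subseteq> cdom i" and z: "\<And>q. q \<notin> K \<Longrightarrow> \<beta> q = 0"
    using c by (auto simp: cutoff_def)
  let ?c = "\<lambda>k. cut_fun i \<beta> (\<lambda>x. X (param i x) i \<bullet> k)"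
  have cS: "?c k \<in> SF" for k
    by (rule cut_fun_in_SF[OF c smooth_on_bounded_linear[OF open_chart[OF i] bounded_linear_inner_left VF_smooth[OF X i]]])
  \<comment> \<open>One factor of the square makes the components of the field global, the other the coordinate fields.\<close>
  have "scale_field (\<beta> * \<beta>) X = (\<Sum>k\<in>Basis. scale_field (?c k) (cut_field i \<beta> k))"
  proof (intro ext)
    fix p j
    show "scale_field (\<beta> * \<beta>) X p j = (\<Sum>k\<in>Basis. scale_field (?c k) (cut_field i \<beta> k)) p j"
    proof (cases "p \<in> cdom i")
      case True
      then have ci: "i \<in> charts_at N p" by (simp add: charts_at_iff i)
      have "X p j = (\<Sum>k\<in>Basis. (X p i \<bullet> k) *\<^sub>R tangent_vector N i p k j)"
      proof (cases "j \<in> charts_at N p")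
        case True
        have "X p j = transport N i j p (X p i)"
          using VF_tangent[OF X dom_points[OF i \<open>p \<in> cdom i\<close>]] ci True by (rule tangent_space_transport)
        also have "\<dots> = (\<Sum>k\<in>Basis. (X p i \<bullet> k) *\<^sub>R transport N i j p k)"
          by (rule linear_expand_Basis[OF linear_transport[OF ci True]])
        finally show ?thesis using True by (simp add: tangent_vector_def)
      next
        case False
        then have "X p j = 0"
          using VF_tangent[OF X dom_points[OF i \<open>p \<in> cdom i\<close>]] by (intro tangent_space_outside)
        then show ?thesis using False by (simp add: tangent_vector_def)
      qed
      then have "scale_field (\<beta> * \<beta>) X p j =
          (\<beta> p * \<beta> p) *\<^sub>R (\<Sum>k\<in>Basis. (X p i \<bullet> k) *\<^sub>R tangent_vector N i p k j)"
        by (simp add: scale_field_def)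
      then show ?thesis using True
        by (simp add: sum_field_apply scale_field_def cut_fun_def cut_field_def param_chart[OF i]
            scaleR_sum_right mult_ac)
    next
      case False
      then have "\<beta> p = 0" using K z by blast
      then show ?thesis using False by (simp add: sum_field_apply scale_field_def cut_fun_def)
    qed
  qed
  then have "T (scale_field (\<beta> * \<beta>) X) = (\<Sum>k\<in>Basis. T (scale_field (?c k) (cut_field i \<beta> k)))"
    by (simp add: vector_1_form_sum[OF T] VF_scale cS cut_field_in_VF[OF c])
  then have "scale_field (\<beta> * \<beta>) (T X) = (\<Sum>k\<in>Basis. scale_field (?c k) (T (cut_field i \<beta> k)))"
    by (simp add: vector_1_form_scale[OF T] SF_mult \<beta> X cS cut_field_in_VF[OF c])
  then have "scale_field (\<beta> * \<beta>) (T X) q j = (\<Sum>k\<in>Basis. scale_field (?c k) (T (cut_field i \<beta> k)) q j)"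
    by (simp add: sum_field_apply)
  moreover have "param i (chart i q) = q"
    using cutoff_in_charts[OF c, of q] q by (simp add: charts_at_iff param_chart)
  ultimately show ?thesis
    by (simp add: scale_field_def q cut_fun_at[OF c q])
qed

end



section \<open>The tangent bundle as an atlas\<close>

context atlas_on
begin

lemma points_tangent_bundle: "q \<in> points (tangent_bundle N) \<longleftrightarrow> fst q \<in> points N \<and> snd q \<in> tangent_space N (fst q)"
  by (auto simp: tangent_bundle_def)

lemma chart_index_tangent_bundle [simp]: "chart_index (tangent_bundle N) = chart_index N"
  by (simp add: tangent_bundle_def)

lemma chart_dom_tangent_bundle: "q \<in> chart_dom (tangent_bundle N) i \<longleftrightarrow> fst q \<in> cdom i \<and> snd q \<in> tangent_space N (fst q)"
  by (auto simp: tangent_bundle_def)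

lemma chart_map_tangent_bundle: "chart_map (tangent_bundle N) i q = (chart i (fst q), snd q i)"
  by (simp add: tangent_bundle_def split: prod.split)

text \<open>
  Every coordinate vector occurs, so the induced charts contain whole fibres.
\<close>

lemma chart_image_tangent_bundle:
  assumes i: "i \<in> chart_index N" and D: "\<And>q. q \<in> D' \<longleftrightarrow> fst q \<in> D \<and> snd q \<in> tangent_space N (fst q)" "D \<subseteq> cdom i"
  shows "chart_map (tangent_bundle N) i ` D' = (chart i ` D) \<times> UNIV"
proof
  show "chart_map (tangent_bundle N) i ` D' \<subseteq> (chart i ` D) \<times> UNIV"
    using D by (auto simp: chart_map_tangent_bundle)
  show "(chart i ` D) \<times> UNIV \<subseteq> chart_map (tangent_bundle N) i ` D'"
  proof
    fix z assume "z \<in> (chart i ` D) \<times> (UNIV :: 'e set)"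
    then obtain p y where z: "z = (chart i p, y)" "p \<in> D" by auto
    have c: "i \<in> charts_at N p" using z D(2) i by (auto simp: charts_at_iff)
    have "z = chart_map (tangent_bundle N) i (p, tangent_vector N i p y)"
      by (simp add: z chart_map_tangent_bundle tangent_vector_self[OF c])
    moreover have "(p, tangent_vector N i p y) \<in> D'"
      using z tangent_vector_in[OF c] by (simp add: D(1))
    ultimately show "z \<in> chart_map (tangent_bundle N) i ` D'" by blast
  qed
qed

lemma chart_image_dom_tangent_bundle:
  "i \<in> chart_index N \<Longrightarrow> chart_map (tangent_bundle N) i ` chart_dom (tangent_bundle N) i = (chart i ` cdom i) \<times> UNIV"
  by (rule chart_image_tangent_bundle) (auto simp: chart_dom_tangent_bundle)

lemma chart_image_overlap_tangent_bundle:
  "i \<in> chart_index N \<Longrightarrow>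
    chart_map (tangent_bundle N) i ` (chart_dom (tangent_bundle N) i \<inter> chart_dom (tangent_bundle N) j) =
    (chart i ` (cdom i \<inter> cdom j)) \<times> UNIV"
  by (rule chart_image_tangent_bundle) (auto simp: chart_dom_tangent_bundle)

lemma inj_on_chart_tangent_bundle:
  assumes i: "i \<in> chart_index N"
  shows "inj_on (chart_map (tangent_bundle N) i) (chart_dom (tangent_bundle N) i)"
proof (rule inj_onI)
  fix q q' assume q: "q \<in> chart_dom (tangent_bundle N) i" "q' \<in> chart_dom (tangent_bundle N) i"
    and eq: "chart_map (tangent_bundle N) i q = chart_map (tangent_bundle N) i q'"
  have p: "fst q = fst q'"
    using q eq inj_onD[OF inj_chart[OF i]] by (auto simp: chart_dom_tangent_bundle chart_map_tangent_bundle)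
  moreover have "snd q = snd q'"
    by (rule tangent_space_eqI[of _ "fst q" _ i])
      (use q eq p i in \<open>auto simp: chart_dom_tangent_bundle chart_map_tangent_bundle charts_at_iff\<close>)
  ultimately show "q = q'" by (simp add: prod_eq_iff)
qed

lemma chart_inv_tangent_bundle:
  assumes i: "i \<in> chart_index N" and x: "x \<in> chart i ` cdom i"
  shows "chart_inv (tangent_bundle N) i (x, y) = (param i x, tangent_vector N i (param i x) y)"
  unfolding chart_inv_def[of "tangent_bundle N"]
proof (rule inv_into_f_eq[OF inj_on_chart_tangent_bundle[OF i]])
  have c: "i \<in> charts_at N (param i x)" using param_in_dom[OF x] i by (simp add: charts_at_iff)
  show "(param i x, tangent_vector N i (param i x) y) \<in> chart_dom (tangent_bundle N) i"
    by (simp add: chart_dom_tangent_bundle param_in_dom[OF x] tangent_vector_in[OF c])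
  show "chart_map (tangent_bundle N) i (param i x, tangent_vector N i (param i x) y) = (x, y)"
    by (simp add: chart_map_tangent_bundle chart_param[OF x] tangent_vector_self[OF c])
qed

text \<open>
  The fibre coordinate transforms by the derivative of the transition map of the base, hence linearly.
\<close>

lemma transition_tangent_bundle:
  assumes i: "i \<in> chart_index N" and j: "j \<in> chart_index N" and z: "fst z \<in> chart i ` (cdom i \<inter> cdom j)"
  shows "transition (tangent_bundle N) i j z =
    (transition N i j (fst z), frechet_derivative (transition N i j) (at (fst z)) (snd z))"
proof -
  obtain x y where xy: "z = (x, y)" by force
  have x: "x \<in> chart i ` cdom i" using z xy by auto
  have "param i x \<in> cdom i" "param i x \<in> cdom j" using param_overlap[OF i z] xy by auto
  then have "j \<in> charts_at N (param i x)" by (simp add: charts_at_iff j)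
  then show ?thesis
    by (simp add: xy transition_def[of "tangent_bundle N"] chart_inv_tangent_bundle[OF i x] chart_map_tangent_bundle
        tangent_vector_def transport_def chart_param[OF x] transition_def[of N])
qed

lemma smooth_on_fst:
  assumes "open S" "smooth_on S f"
  shows "smooth_on (S \<times> UNIV) (\<lambda>z::'a::euclidean_space \<times> 'b::euclidean_space. f (fst z))"
  by (rule smooth_on_compose[OF _ _ assms(2)])
    (use assms(1) in \<open>auto intro!: smooth_on_linear bounded_linear_fst open_Times\<close>)

lemma smooth_atlas_tangent_bundle: "smooth_atlas (tangent_bundle N)"
  unfolding smooth_atlas_def
proof (intro conjI ballI)
  show "(\<Union>i\<in>chart_index (tangent_bundle N). chart_dom (tangent_bundle N) i) = points (tangent_bundle N)"
    by (auto simp: chart_dom_tangent_bundle points_tangent_bundle points_eq)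
next
  fix i assume "i \<in> chart_index (tangent_bundle N)"
  then have i: "i \<in> chart_index N" by simp
  show "inj_on (chart_map (tangent_bundle N) i) (chart_dom (tangent_bundle N) i)"
    by (rule inj_on_chart_tangent_bundle[OF i])
  show "open (chart_map (tangent_bundle N) i ` chart_dom (tangent_bundle N) i)"
    unfolding chart_image_dom_tangent_bundle[OF i] by (intro open_Times open_chart[OF i] open_UNIV)
  fix j assume "j \<in> chart_index (tangent_bundle N)"
  then have j: "j \<in> chart_index N" by simp
  let ?S = "chart i ` (cdom i \<inter> cdom j)"
  have S: "open ?S" by (rule open_overlap[OF i j])
  then show "open (chart_map (tangent_bundle N) i ` (chart_dom (tangent_bundle N) i \<inter> chart_dom (tangent_bundle N) j))"
    unfolding chart_image_overlap_tangent_bundle[OF i] by (intro open_Times open_UNIV)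
  have T: "open (?S \<times> (UNIV :: 'e set))" using S by (intro open_Times open_UNIV)
  have "smooth_on (?S \<times> UNIV) (\<lambda>z. (transition N i j (fst z), frechet_derivative (transition N i j) (at (fst z)) (snd z)))"
    by (intro smooth_on_Pair T smooth_on_fst[OF S] smooth_transition[OF i j]
        smooth_on_frechet_derivative_apply[OF T smooth_transition[OF i j]]
        smooth_on_linear bounded_linear_fst bounded_linear_snd) auto
  then have "smooth_on (?S \<times> UNIV) (transition (tangent_bundle N) i j)"
    by (rule smooth_on_cong[OF T, rotated]) (simp add: transition_tangent_bundle[OF i j] mem_Times_iff)
  then show "smooth_on (chart_map (tangent_bundle N) i ` (chart_dom (tangent_bundle N) i \<inter> chart_dom (tangent_bundle N) j))
      (transition (tangent_bundle N) i j)"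
    unfolding chart_image_overlap_tangent_bundle[OF i] .
qed

section \<open>Existence of cutoff functions\<close>

lemma topspace_atlas_topology: "topspace (atlas_topology N) = points N"
proof
  note op = openin_atlas_topology[OF atlas]
  show "topspace (atlas_topology N) \<subseteq> points N"
    using op[of "topspace (atlas_topology N)"] by simp
  have "points N \<inter> cdom j = cdom j" if "j \<in> chart_index N" for j
    using that by (auto simp: points_eq)
  then have "openin (atlas_topology N) (points N)"
    by (simp add: op open_chart)
  then show "points N \<subseteq> topspace (atlas_topology N)" by (rule openin_subset)
qed

text \<open>
  Compact sets of a Hausdorff space are closed; this lets functions supported in a chart extend by zero.
\<close>

lemma param_compact_closedin:
  assumes H: "Hausdorff_space (atlas_topology N)" and i: "i \<in> chart_index N"
    and C: "compact C" "C \<subseteq> chart i ` cdom i"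
  shows "closedin (atlas_topology N) (param i ` C)"
proof (rule compactin_imp_closedin[OF H])
  note op = openin_atlas_topology[OF atlas]
  have "continuous_map (top_of_set (chart i ` cdom i)) (atlas_topology N) (param i)"
    unfolding continuous_map_def
  proof (intro conjI allI impI)
    show "param i \<in> topspace (top_of_set (chart i ` cdom i)) \<rightarrow> topspace (atlas_topology N)"
      using i by (auto simp: topspace_atlas_topology param_chart dom_points)
    fix U assume "openin (atlas_topology N) U"
    then have "open (chart i ` (U \<inter> cdom i))" using i by (simp add: op)
    moreover have "{x \<in> topspace (top_of_set (chart i ` cdom i)). param i x \<in> U} = chart i ` (U \<inter> cdom i)"
      using i by (auto simp: param_chart)
    ultimately show "openin (top_of_set (chart i ` cdom i)) {x \<in> topspace (top_of_set (chart i ` cdom i)). param i x \<in> U}"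
      using openin_open_eq[OF open_chart[OF i]] by auto
  qed
  then show "compactin (atlas_topology N) (param i ` C)"
    by (rule image_compactin[rotated]) (use C in \<open>simp add: compactin_subtopology\<close>)
qed

lemma exists_cutoff:
  assumes H: "Hausdorff_space (atlas_topology N)" and ip: "i \<in> charts_at N p"
  obtains K \<beta> U where "cutoff i K \<beta>" "open U" "chart i p \<in> U" "U \<subseteq> chart i ` cdom i" "\<And>x. x \<in> U \<Longrightarrow> \<beta> (param i x) = 1"
proof -
  have i: "i \<in> chart_index N" "p \<in> cdom i" using ip by (auto simp: charts_at_iff)
  let ?x = "chart i p"
  have "?x \<in> chart i ` cdom i" using i by blast
  then obtain e where e: "e > 0" "cball ?x e \<subseteq> chart i ` cdom i"
    using open_contains_cball open_chart[OF i(1)] by meson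
  define r where "r = e / 2"
  have r: "r > 0" "2 * r = e" using e(1) by (auto simp: r_def)
  obtain \<psi> :: "'e \<Rightarrow> real" where \<psi>: "smooth_on UNIV \<psi>" "\<And>x. x \<in> ball ?x r \<Longrightarrow> \<psi> x = 1" "\<And>x. x \<notin> cball ?x e \<Longrightarrow> \<psi> x = 0"
    using smooth_bump[OF r(1), of ?x] unfolding r(2) by blast
  define K where "K = param i ` cball ?x e"
  define \<beta> where "\<beta> q = (if q \<in> cdom i then \<psi> (chart i q) else 0)" for q
  have K: "K \<subseteq> cdom i" using e(2) param_in_dom by (auto simp: K_def)
  have op: "open (chart j ` (cdom j - K))" if j: "j \<in> chart_index N" for j
  proof -
    have "closedin (atlas_topology N) K"
      unfolding K_def by (rule param_compact_closedin[OF H i(1) compact_cball e(2)])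
    then have "openin (atlas_topology N) (topspace (atlas_topology N) - K)" by blast
    then have "open (chart j ` ((topspace (atlas_topology N) - K) \<inter> cdom j))"
      using j by (simp add: openin_atlas_topology[OF atlas])
    moreover have "cdom j \<subseteq> topspace (atlas_topology N)"
      using dom_points[OF j] by (auto simp: topspace_atlas_topology)
    then have "(topspace (atlas_topology N) - K) \<inter> cdom j = cdom j - K" by blast
    ultimately show ?thesis by simp
  qed
  have z: "\<beta> q = 0" if "q \<notin> K" for q
  proof (cases "q \<in> cdom i")
    case True
    have "chart i q \<notin> cball ?x e"
      using that param_chart[OF i(1) True] unfolding K_def by (metis image_eqI)
    then show ?thesis by (simp add: \<beta>_def \<psi>(3))
  qed (simp add: \<beta>_def)
  have \<beta>: "\<beta> \<in> SF"
    unfolding smooth_functions_def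
  proof (intro CollectI conjI allI impI ballI)
    show "\<beta> q = 0" if "q \<notin> points N" for q
      using that dom_points[OF i(1)] by (auto simp: \<beta>_def)
    fix j assume j: "j \<in> chart_index N"
    show "smooth_on (chart j ` cdom j) (\<lambda>x. \<beta> (param j x))"
    proof (rule smooth_on_glue[OF i(1) K op[OF j] j])
      have "smooth_on (chart j ` (cdom j \<inter> cdom i)) (\<lambda>x. \<psi> (chart i (param j x)))"
        by (rule smooth_on_compose[OF open_overlap[OF j i(1)] smooth_transition_on[OF i(1) j] \<psi>(1)]) auto
      then show "smooth_on (chart j ` (cdom j \<inter> cdom i)) (\<lambda>x. \<beta> (param j x))"
        by (rule smooth_on_cong[OF open_overlap[OF j i(1)], rotated]) (use j in \<open>auto simp: param_chart \<beta>_def\<close>)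
    qed (use z in auto)
  qed
  have c: "cutoff i K \<beta>" using i(1) \<beta> K z op by (simp add: cutoff_def)
  show thesis
  proof (rule that[OF c open_ball])
    show "?x \<in> ball ?x r" using r by simp
    show "ball ?x r \<subseteq> chart i ` cdom i" using e(2) r by (auto simp: subset_iff)
    show "\<beta> (param i x) = 1" if "x \<in> ball ?x r" for x
    proof -
      have "x \<in> chart i ` cdom i" using that \<open>ball ?x r \<subseteq> chart i ` cdom i\<close> by blast
      then show ?thesis using \<psi>(2)[OF that] by (simp add: \<beta>_def param_in_dom chart_param)
    qed
  qed
qed

section \<open>Vanishing Froelicher--Nijenhuis bracket\<close>

lemma ext_deriv_1:
  "Z \<in> VF \<Longrightarrow> ext_deriv N \<omega> [Z] = apply_field N Z (\<omega> [])"
  by (simp add: ext_deriv_def nths_Cons fun_eq_iff)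

lemma ext_deriv_2:
  "X \<in> VF \<Longrightarrow> Y \<in> VF \<Longrightarrow> ext_deriv N \<omega> [X, Y] =
    (\<lambda>p. apply_field N X (\<omega> [Y]) p - apply_field N Y (\<omega> [X]) p - \<omega> [lie_bracket N X Y] p)"
  by (simp add: ext_deriv_def nths_Cons fun_eq_iff lessThan_Suc)

lemma insert_1_pair:
  "X \<in> VF \<Longrightarrow> Y \<in> VF \<Longrightarrow> insert_1 N K \<omega> [X, Y] = \<omega> [K X, Y] + \<omega> [X, K Y]"
  by (simp add: insert_1_def lessThan_Suc add.commute)

lemma apply_field_zero: "apply_field N X 0 = 0"
  by (simp add: apply_field_def fun_eq_iff Let_def)

lemma ext_deriv_zero: "ext_deriv N 0 = 0"
  by (simp add: ext_deriv_def fun_eq_iff apply_field_zero)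

text \<open>
  A function as a form of degree \<open>0\<close>, whose only argument list is the empty one.
\<close>

definition function_form :: "('p \<Rightarrow> real) \<Rightarrow> ('p, 'i, 'e) form" where
  "function_form f Xs = (if Xs = [] then f else 0)"

lemma function_form_in: "f \<in> SF \<Longrightarrow> function_form f \<in> forms N 0"
  by (auto simp: forms_def function_form_def)

lemma deriv_1_function:
  assumes L: "\<And>Z. Z \<in> VF \<Longrightarrow> L Z \<in> VF" and f: "f \<in> SF" and Z: "Z \<in> VF"
  shows "deriv_1 N L (function_form f) [Z] = apply_field N (L Z) f"
proof -
  have "insert_1 N L (function_form f) = 0"
    by (rule insert_degree_0(1)[OF function_form_in[OF f]])
  then have "deriv_1 N L (function_form f) [Z] = insert_1 N L (ext_deriv N (function_form f)) [Z]"
    by (simp add: deriv_1_def ext_deriv_zero)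
  also have "\<dots> = apply_field N (L Z) f"
    by (simp add: insert_degree_1(1)[OF Z Z] ext_deriv_1[OF L[OF Z]] function_form_def)
  finally show ?thesis .
qed

text \<open>
  \<open>d\<^sub>K d\<^sub>L f\<close> on a pair of fields, from the formula for the exterior derivative of the \<open>1\<close>-form
  \<open>d\<^sub>L f = df \<circ> L\<close>; the terms \<open>X (L K Y f)\<close> and \<open>Y (L K X f)\<close> cancel.
\<close>

lemma deriv_1_deriv_1_function:
  assumes K: "\<And>Z. Z \<in> VF \<Longrightarrow> K Z \<in> VF" and L: "\<And>Z. Z \<in> VF \<Longrightarrow> L Z \<in> VF"
    and f: "f \<in> SF" and X: "X \<in> VF" and Y: "Y \<in> VF"
  shows "deriv_1 N K (deriv_1 N L (function_form f)) [X, Y] p =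
    apply_field N (K X) (apply_field N (L Y) f) p - apply_field N (K Y) (apply_field N (L X) f) p
    - apply_field N (L (lie_bracket N (K X) Y)) f p - apply_field N (L (lie_bracket N X (K Y))) f p
    + apply_field N (L (K (lie_bracket N X Y))) f p"
proof -
  define \<alpha> where "\<alpha> = deriv_1 N L (function_form f)"
  have \<alpha>: "\<alpha> [Z] = apply_field N (L Z) f" if "Z \<in> VF" for Z
    unfolding \<alpha>_def using L f that by (rule deriv_1_function)
  have i\<alpha>: "insert_1 N K \<alpha> [Z] = apply_field N (L (K Z)) f" if "Z \<in> VF" for Z
    by (simp add: insert_degree_1(1)[OF that that] \<alpha>[OF K[OF that]])
  have "deriv_1 N K \<alpha> [X, Y] p = ext_deriv N \<alpha> [K X, Y] p + ext_deriv N \<alpha> [X, K Y] p - ext_deriv N (insert_1 N K \<alpha>) [X, Y] p"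
    by (simp add: deriv_1_def insert_1_pair[OF X Y])
  then show ?thesis
    unfolding \<alpha>_def[symmetric]
    by (simp add: ext_deriv_2 X Y K lie_bracket_in_VF \<alpha> i\<alpha>)
qed

lemma apply_field_zero_field:
  assumes "f \<in> SF"
  shows "apply_field N 0 f = 0"
proof
  fix p
  show "apply_field N 0 f p = 0 p"
  proof (cases "p \<in> points N")
    case True
    then obtain i where i: "i \<in> charts_at N p" using charts_at_ex by blast
    then show ?thesis
      using linear_0[OF has_derivative_linear[OF local_fun_has_derivative[OF assms i]]]
      by (simp add: apply_field_local[OF VF_0 assms i])
  qed (simp add: apply_field_def)
qed

text \<open>
  A vanishing bracket is used only through its action on functions; there it is an identity between
  second derivatives that can be evaluated on test fields.
\<close>

lemma FN_bracket_zero_function: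
  assumes FN: "FN_bracket N K L (zero_vector_2_form N)"
    and K: "\<And>Z. Z \<in> VF \<Longrightarrow> K Z \<in> VF" and L: "\<And>Z. Z \<in> VF \<Longrightarrow> L Z \<in> VF"
    and f: "f \<in> SF" and X: "X \<in> VF" and Y: "Y \<in> VF"
  shows "deriv_1 N K (deriv_1 N L (function_form f)) [X, Y] p +
    deriv_1 N L (deriv_1 N K (function_form f)) [X, Y] p = 0"
proof -
  have "deriv_2 N (zero_vector_2_form N) (function_form f) =
      deriv_1 N K (deriv_1 N L (function_form f)) + deriv_1 N L (deriv_1 N K (function_form f))"
    using FN function_form_in[OF f] by (auto simp: FN_bracket_def)
  moreover have "insert_2 N (zero_vector_2_form N) (function_form f) = 0"
    by (rule insert_degree_0(2)[OF function_form_in[OF f]])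
  then have "deriv_2 N (zero_vector_2_form N) (function_form f) [X, Y] = 0"
    by (simp add: deriv_2_def ext_deriv_zero insert_degree_1(2)[OF X Y] zero_vector_2_form_def X Y
        ext_deriv_1[OF VF_0] function_form_def apply_field_zero_field[OF f] flip: zero_fun_def)
  ultimately show ?thesis by (simp add: fun_eq_iff)
qed

end



section \<open>Vertical lifts, vertical endomorphism and cutoff functions on the tangent bundle\<close>

text \<open>
  A locale of its own, since interpreting the tangent bundle inside \<open>atlas_on\<close> itself would call for the
  tangent bundle of the tangent bundle, and so on. Facts about \<open>TM\<close> carry the prefix \<open>T\<close>.
\<close>

locale tangent_atlas = atlas_on M for M :: "('p, 'i, 'e::euclidean_space) atlas"

sublocale tangent_atlas \<subseteq> T: atlas_on "tangent_bundle M"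
  by unfold_locales (rule smooth_atlas_tangent_bundle)

context tangent_atlas
begin

abbreviation J where "J \<equiv> vertical_endo M"

lemma T_charts_at: "q \<in> points (tangent_bundle M) \<Longrightarrow> i \<in> charts_at (tangent_bundle M) q \<longleftrightarrow> i \<in> charts_at M (fst q)"
  by (auto simp: charts_at_def chart_dom_tangent_bundle points_tangent_bundle)

lemma T_charts_atD:
  assumes "i \<in> charts_at (tangent_bundle M) q"
  shows "q \<in> points (tangent_bundle M)" "i \<in> charts_at M (fst q)" "snd q \<in> tangent_space M (fst q)"
    "i \<in> chart_index M" "fst q \<in> cdom i"
  using assms T.charts_at_empty by (auto simp: charts_at_def chart_dom_tangent_bundle points_tangent_bundle points_eq)

lemma T_chart_in:
  "i \<in> charts_at (tangent_bundle M) q \<Longrightarrow> T.chart i q \<in> (chart i ` cdom i) \<times> UNIV"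
  using T_charts_atD[of i q] by (auto simp: chart_map_tangent_bundle)

lemma T_param_chart: "i \<in> charts_at (tangent_bundle M) q \<Longrightarrow> T.param i (T.chart i q) = q"
  by (auto simp: T.charts_at_iff T.param_chart)

lemma T_param_point:
  assumes "i \<in> chart_index M" "z \<in> (chart i ` cdom i) \<times> UNIV"
  shows "i \<in> charts_at (tangent_bundle M) (T.param i z)" "T.chart i (T.param i z) = z"
    "fst (T.param i z) = param i (fst z)"
proof -
  have z: "z \<in> T.chart i ` T.cdom i" using assms by (simp add: chart_image_dom_tangent_bundle)
  show "i \<in> charts_at (tangent_bundle M) (T.param i z)"
    using T.param_in_dom[OF z] assms(1) by (simp add: T.charts_at_iff)
  show "T.chart i (T.param i z) = z" by (rule T.chart_param[OF z])
  show "fst (T.param i z) = param i (fst z)"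
    using assms chart_inv_tangent_bundle[OF assms(1), of "fst z" "snd z"] by auto
qed

lemma open_T_chart: "i \<in> chart_index M \<Longrightarrow> open ((chart i ` cdom i) \<times> (UNIV :: 'e set))"
  by (intro open_Times open_chart open_UNIV)

text \<open>
  The derivative of \<open>(x, y) \<mapsto> (\<phi> x, D\<phi>(x) y)\<close>. Only its triangular shape matters in the sequel: the
  first component depends on \<open>fst w\<close> alone, and vertical vectors stay vertical.
\<close>

lemma transport_tangent_bundle:
  assumes i: "i \<in> charts_at (tangent_bundle M) q" and j: "j \<in> charts_at (tangent_bundle M) q"
  shows "transport (tangent_bundle M) i j q w =
    (transport M i j (fst q) (fst w),
     frechet_derivative (\<lambda>z. frechet_derivative (transition M i j) (at z) (snd q i)) (at (chart i (fst q))) (fst w) +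
     transport M i j (fst q) (snd w))"
proof -
  note i' = T_charts_atD[OF i] and j' = T_charts_atD[OF j]
  let ?S = "chart i ` (cdom i \<inter> cdom j)" and ?\<phi> = "transition M i j" and ?x = "chart i (fst q)"
  have S: "open ?S" "smooth_on ?S ?\<phi>" using i' j' by (auto intro: open_overlap smooth_transition)
  have x: "?x \<in> ?S" using i' j' by auto
  have ST: "open (?S \<times> (UNIV :: 'e set))" using S by (intro open_Times open_UNIV)
  have Z: "T.chart i q = (?x, snd q i)" by (rule chart_map_tangent_bundle)
  let ?D = "\<lambda>z. frechet_derivative ?\<phi> (at z)"
  define F where "F y = (\<lambda>u. frechet_derivative (\<lambda>z. ?D z y) (at ?x) u)" for y
  have F: "((\<lambda>z. ?D z y) has_derivative F y) (at ?x)" for y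
    unfolding F_def by (rule smooth_on_has_derivative[OF smooth_on_frechet_derivative[OF S(2)] x])
  have 1: "((\<lambda>z. ?\<phi> (fst z)) has_derivative (\<lambda>w. transport M i j (fst q) (fst w))) (at (?x, snd q i))"
    by (rule has_derivative_compose[where g = ?\<phi> and f = fst and x = "(?x, snd q i)"])
      (auto intro!: derivative_eq_intros has_derivative_transition i' j')
  have "((\<lambda>z. \<Sum>b\<in>Basis. (snd z \<bullet> b) *\<^sub>R ?D (fst z) b) has_derivative
      (\<lambda>w. \<Sum>b\<in>Basis. (snd q i \<bullet> b) *\<^sub>R F b (fst w) + (snd w \<bullet> b) *\<^sub>R ?D ?x b)) (at (?x, snd q i))"
  proof -
    have "((\<lambda>z. ?D (fst z) b) has_derivative (\<lambda>w. F b (fst w))) (at (?x, snd q i))" for b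
      by (rule has_derivative_compose[where g = "\<lambda>z. ?D z b" and f = fst and x = "(?x, snd q i)"])
        (auto intro!: derivative_eq_intros F)
    then show ?thesis by (auto intro!: derivative_eq_intros)
  qed
  moreover have linD: "linear (?D z)" if "z \<in> ?S" for z
    by (rule smooth_on_linear_derivative[OF S(2) that])
  moreover have "(\<Sum>b\<in>Basis. (snd q i \<bullet> b) *\<^sub>R F b u) = F (snd q i) u" for u
  proof -
    have "((\<lambda>z. \<Sum>b\<in>Basis. (snd q i \<bullet> b) *\<^sub>R ?D z b) has_derivative (\<lambda>u. \<Sum>b\<in>Basis. (snd q i \<bullet> b) *\<^sub>R F b u)) (at ?x)"
      by (auto intro!: derivative_eq_intros F)
    then have "((\<lambda>z. ?D z (snd q i)) has_derivative (\<lambda>u. \<Sum>b\<in>Basis. (snd q i \<bullet> b) *\<^sub>R F b u)) (at ?x)"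
      by (rule has_derivative_transform_within_open[OF _ S(1) x]) (rule linear_expand_Basis[OF linD, symmetric])
    from has_derivative_unique[OF this F] show ?thesis by (rule fun_cong)
  qed
  ultimately have "((\<lambda>z. \<Sum>b\<in>Basis. (snd z \<bullet> b) *\<^sub>R ?D (fst z) b) has_derivative
      (\<lambda>w. F (snd q i) (fst w) + ?D ?x (snd w))) (at (?x, snd q i))"
    by (simp only: sum.distrib linear_expand_Basis[OF linD[OF x], symmetric])
  then have "((\<lambda>z. ?D (fst z) (snd z)) has_derivative (\<lambda>w. F (snd q i) (fst w) + ?D ?x (snd w))) (at (?x, snd q i))"
    by (rule has_derivative_transform_within_open[OF _ ST])
      (use x linear_expand_Basis[OF linD, symmetric] in auto)
  from has_derivative_Pair[OF 1 this]
  have "((\<lambda>z. (?\<phi> (fst z), ?D (fst z) (snd z))) has_derivative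
      (\<lambda>w. (transport M i j (fst q) (fst w), F (snd q i) (fst w) + ?D ?x (snd w)))) (at (?x, snd q i))" .
  then have "(transition (tangent_bundle M) i j has_derivative
      (\<lambda>w. (transport M i j (fst q) (fst w), F (snd q i) (fst w) + ?D ?x (snd w)))) (at (?x, snd q i))"
    by (rule has_derivative_transform_within_open[OF _ ST])
      (use x i'(4) j'(4) in \<open>auto simp: transition_tangent_bundle\<close>)
  from fun_cong[OF frechet_derivative_at[OF this]] show ?thesis
    by (simp add: transport_def Z F_def)
qed

lemma fst_transport_tangent_bundle:
  "i \<in> charts_at (tangent_bundle M) q \<Longrightarrow> j \<in> charts_at (tangent_bundle M) q \<Longrightarrow>
    fst (transport (tangent_bundle M) i j q w) = transport M i j (fst q) (fst w)"
  by (simp add: transport_tangent_bundle)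

lemma transport_tangent_bundle_vertical:
  assumes i: "i \<in> charts_at (tangent_bundle M) q" and j: "j \<in> charts_at (tangent_bundle M) q"
  shows "transport (tangent_bundle M) i j q (0, b) = (0, transport M i j (fst q) b)"
proof -
  have S: "smooth_on (chart i ` (cdom i \<inter> cdom j)) (transition M i j)" "chart i (fst q) \<in> chart i ` (cdom i \<inter> cdom j)"
    using T_charts_atD[OF i] T_charts_atD[OF j] by (auto intro: smooth_transition)
  have "linear (frechet_derivative (\<lambda>z. frechet_derivative (transition M i j) (at z) (snd q i)) (at (chart i (fst q))))"
    by (rule smooth_on_linear_derivative[OF smooth_on_frechet_derivative[OF S(1)] S(2)])
  then show ?thesis
    using linear_transport[OF T_charts_atD(2)[OF i] T_charts_atD(2)[OF j]]
    by (simp add: transport_tangent_bundle[OF i j] linear_0)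
qed

lemma vlift_tangent_space:
  assumes q: "q \<in> points (tangent_bundle M)" and u: "u \<in> tangent_space M (fst q)"
  shows "vlift u \<in> tangent_space (tangent_bundle M) q"
proof (rule T.tangent_spaceI)
  show "vlift u i = 0" if "i \<notin> charts_at (tangent_bundle M) q" for i
    using tangent_space_outside[OF u, of i] that by (simp add: T_charts_at[OF q] vlift_def zero_prod_def)
  show "vlift u j = transport (tangent_bundle M) i j q (vlift u i)"
    if i: "i \<in> charts_at (tangent_bundle M) q" and j: "j \<in> charts_at (tangent_bundle M) q" for i j
    using tangent_space_transport[OF u T_charts_atD(2)[OF i] T_charts_atD(2)[OF j]]
    by (simp add: vlift_def transport_tangent_bundle_vertical[OF i j])
qed

lemma proj_deriv_tangent_space:
  assumes q: "q \<in> points (tangent_bundle M)" and w: "w \<in> tangent_space (tangent_bundle M) q"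
  shows "proj_deriv w \<in> tangent_space M (fst q)"
proof (rule tangent_spaceI)
  show "proj_deriv w i = 0" if "i \<notin> charts_at M (fst q)" for i
    using T.tangent_space_outside[OF w, of i] that by (simp add: T_charts_at[OF q] proj_deriv_def)
  show "proj_deriv w j = transport M i j (fst q) (proj_deriv w i)"
    if "i \<in> charts_at M (fst q)" "j \<in> charts_at M (fst q)" for i j
  proof -
    have i: "i \<in> charts_at (tangent_bundle M) q" and j: "j \<in> charts_at (tangent_bundle M) q"
      using that by (simp_all add: T_charts_at[OF q])
    show ?thesis
      unfolding proj_deriv_def T.tangent_space_transport[OF w i j] fst_transport_tangent_bundle[OF i j] ..
  qed
qed

lemma J_apply: "X \<in> T.VF \<Longrightarrow> J X q i = (0, fst (X q i))"
  by (simp add: vertical_endo_def vlift_def proj_deriv_def)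

lemma J_in_VF:
  assumes X: "X \<in> T.VF"
  shows "J X \<in> T.VF"
proof (rule T.vector_fieldsI)
  show "J X q \<in> tangent_space (tangent_bundle M) q" if "q \<in> points (tangent_bundle M)" for q
    using vlift_tangent_space[OF that proj_deriv_tangent_space[OF that T.VF_tangent[OF X that]]] X
    by (simp add: vertical_endo_def)
  show "J X q = 0" if "q \<notin> points (tangent_bundle M)" for q
    using T.VF_outside[OF X that] by (simp add: fun_eq_iff J_apply[OF X] zero_prod_def)
  fix i assume "i \<in> chart_index (tangent_bundle M)"
  then show "smooth_on (T.chart i ` T.cdom i) (\<lambda>x. J X (T.param i x) i)"
    unfolding J_apply[OF X]
    by (intro smooth_on_Pair smooth_on_const smooth_on_bounded_linear[OF _ bounded_linear_fst] T.VF_smooth[OF X] T.open_chart)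
qed

text \<open>
  A cutoff function that is constant along the fibres serves on \<open>TM\<close> because the charts of
  \<open>TM\<close> contain whole fibres.
\<close>

lemma cutoff_tangent_bundle:
  assumes c: "cutoff i K \<beta>"
  shows "T.cutoff i {q \<in> points (tangent_bundle M). fst q \<in> K} (\<lambda>q. if q \<in> points (tangent_bundle M) then \<beta> (fst q) else 0)"
    (is "T.cutoff i ?K ?\<beta>")
  unfolding T.cutoff_def
proof (intro conjI ballI allI impI)
  have i: "i \<in> chart_index M" and \<beta>: "\<beta> \<in> SF" and K: "K \<subseteq> cdom i" and z: "\<And>q. q \<notin> K \<Longrightarrow> \<beta> q = 0"
    using c by (auto simp: cutoff_def)
  show "i \<in> chart_index (tangent_bundle M)" using i by simp
  show "?K \<subseteq> T.cdom i" using K by (auto simp: chart_dom_tangent_bundle points_tangent_bundle)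
  show "?\<beta> q = 0" if "q \<notin> ?K" for q using that z by auto
  show "?\<beta> \<in> T.SF"
    unfolding smooth_functions_def
  proof (intro CollectI conjI allI impI ballI)
    fix j assume "j \<in> chart_index (tangent_bundle M)"
    then have j: "j \<in> chart_index M" by simp
    have "smooth_on ((chart j ` cdom j) \<times> (UNIV :: 'e set)) (\<lambda>z. \<beta> (param j (fst z)))"
      by (rule smooth_on_fst[OF open_chart[OF j] SF_smooth[OF \<beta> j]])
    then show "smooth_on (T.chart j ` T.cdom j) (\<lambda>x. ?\<beta> (T.param j x))"
      unfolding chart_image_dom_tangent_bundle[OF j]
      by (rule smooth_on_cong[OF open_T_chart[OF j], rotated])
        (use T_charts_atD(1)[OF T_param_point(1)[OF j]] T_param_point(3)[OF j] in auto)
  qed auto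
  fix j assume "j \<in> chart_index (tangent_bundle M)"
  then have j: "j \<in> chart_index M" by simp
  have "T.chart j ` (T.cdom j - ?K) = (chart j ` (cdom j - K)) \<times> UNIV"
    by (rule chart_image_tangent_bundle[OF j])
      (use j in \<open>auto simp: chart_dom_tangent_bundle points_tangent_bundle points_eq\<close>)
  then show "open (T.chart j ` (T.cdom j - ?K))"
    using cutoff_open[OF c j] by (simp add: open_Times)
qed

section \<open>The bracket of the vertical endomorphism with a vertical field\<close>

lemma vertical_fieldsD:
  "V \<in> vertical_fields M \<Longrightarrow> V \<in> T.VF"
  "V \<in> vertical_fields M \<Longrightarrow> fst (V q i) = 0"
  by (simp_all add: vertical_fields_def proj_deriv_def fun_eq_iff del: split_paired_All)

lemma form_field_bracket_vertical_in_VF: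
  assumes V: "V \<in> vertical_fields M" and X: "X \<in> T.VF"
  shows "form_field_bracket (tangent_bundle M) J V X \<in> T.VF"
  using T.VF_diff[OF T.lie_bracket_in_VF[OF J_in_VF[OF X] vertical_fieldsD(1)[OF V]]
      J_in_VF[OF T.lie_bracket_in_VF[OF X vertical_fieldsD(1)[OF V]]]] X
  by (simp add: form_field_bracket_def)

lemma frechet_derivative_fst:
  "f differentiable (at x) \<Longrightarrow> frechet_derivative (\<lambda>x. fst (f x)) (at x) v = fst (frechet_derivative f (at x) v)"
  using fun_cong[OF frechet_derivative_at[OF bounded_linear.has_derivative[OF bounded_linear_fst]]]
  by (metis frechet_derivative_works)

lemma frechet_derivative_snd:
  "f differentiable (at x) \<Longrightarrow> frechet_derivative (\<lambda>x. snd (f x)) (at x) v = snd (frechet_derivative f (at x) v)"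
  using fun_cong[OF frechet_derivative_at[OF bounded_linear.has_derivative[OF bounded_linear_snd]]]
  by (metis frechet_derivative_works)

text \<open>
  With \<open>X = (A, B)\<close> and \<open>V = (0, v)\<close>, the bracket \<open>[J X, V]\<close> is \<open>(0, D\<^sub>y v A - D\<^sub>y A v)\<close>
  and \<open>J [X, V]\<close> is \<open>(0, - D\<^sub>y A v)\<close>.
\<close>

lemma form_field_bracket_vertical:
  assumes V: "V \<in> vertical_fields M" and X: "X \<in> T.VF" and i: "i \<in> charts_at (tangent_bundle M) q"
  shows "form_field_bracket (tangent_bundle M) J V X q i =
    (0, frechet_derivative (\<lambda>z. snd (V (T.param i z) i)) (at (T.chart i q)) (0, fst (X q i)))"
proof -
  note V' = vertical_fieldsD(1)[OF V]
  let ?V = "\<lambda>z. V (T.param i z) i" and ?X = "\<lambda>z. X (T.param i z) i" and ?JX = "\<lambda>z. J X (T.param i z) i"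
  let ?z = "T.chart i q"
  have dV: "?V differentiable (at ?z)"
    using T.local_field_has_derivative[OF V' i]
    by (auto simp: differentiable_def)
  have fV: "fst (frechet_derivative ?V (at ?z) w) = 0" for w
    using frechet_derivative_fst[OF dV, of w] by (simp add: vertical_fieldsD(2)[OF V])
  have JX: "frechet_derivative ?JX (at ?z) w = (0, fst (frechet_derivative ?X (at ?z) w))" for w
  proof -
    have "(?JX has_derivative (\<lambda>w. (0, fst (frechet_derivative ?X (at ?z) w)))) (at ?z)"
      unfolding J_apply[OF X]
      by (intro has_derivative_Pair has_derivative_const has_derivative_fst T.local_field_has_derivative[OF X i])
    from fun_cong[OF frechet_derivative_at[OF this], of w] show ?thesis by simp
  qed
  have "form_field_bracket (tangent_bundle M) J V X q i =
      lie_bracket (tangent_bundle M) (J X) V q i - J (lie_bracket (tangent_bundle M) X V) q i"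
    using X by (simp add: form_field_bracket_def)
  also have "\<dots> = (0, snd (frechet_derivative ?V (at ?z) (0, fst (X q i))))"
    unfolding J_apply[OF T.lie_bracket_in_VF[OF X V']]
    using i by (simp add: lie_bracket_def JX[unfolded J_apply[OF X]] J_apply[OF X] fV prod_eq_iff)
  finally show ?thesis by (simp add: frechet_derivative_snd[OF dV])
qed

end



section \<open>Coefficients of a semibasic vector 1-form\<close>

locale semibasic_form = tangent_atlas M for M :: "('p, 'i, 'e::euclidean_space) atlas" +
  fixes L :: "('p \<times> ('i \<Rightarrow> 'e) \<Rightarrow> 'i \<Rightarrow> 'e \<times> 'e) \<Rightarrow> 'p \<times> ('i \<Rightarrow> 'e) \<Rightarrow> 'i \<Rightarrow> 'e \<times> 'e"
  assumes Hausdorff: "Hausdorff_space (atlas_topology M)"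
    and semibasic: "L \<in> semibasic_1_forms M"
begin

abbreviation TM where "TM \<equiv> tangent_bundle M"

lemma L_form: "L \<in> vector_1_forms TM"
  and L_J: "X \<in> T.VF \<Longrightarrow> L (J X) = 0"
  and J_L: "X \<in> T.VF \<Longrightarrow> J (L X) = 0"
  using semibasic by (auto simp: semibasic_1_forms_def)

lemma L_in_VF: "X \<in> T.VF \<Longrightarrow> L X \<in> T.VF"
  by (rule T.vector_1_form_in_VF[OF L_form])

lemma fst_L:
  assumes X: "X \<in> T.VF"
  shows "fst (L X q i) = 0"
proof -
  have "J (L X) q i = 0" by (simp add: J_L[OF X])
  then show ?thesis by (simp add: J_apply[OF L_in_VF[OF X]] zero_prod_def)
qed

text \<open>
  A cutoff function that is \<open>1\<close> near a point: in its neighbourhood \<open>W\<close> the cut-off coordinate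
  fields and functions can be differentiated as if they were uncut.
\<close>

lemma obtain_cutoff:
  assumes i: "i \<in> chart_index M" and z: "z \<in> (chart i ` cdom i) \<times> UNIV"
  obtains K \<beta> W where "T.cutoff i K \<beta>" "open W" "z \<in> W" "W \<subseteq> (chart i ` cdom i) \<times> UNIV"
    "\<forall>z\<in>W. \<beta> (T.param i z) = 1"
proof -
  have x: "fst z \<in> chart i ` cdom i" using z by auto
  then have c: "i \<in> charts_at M (param i (fst z))"
    using i by (simp add: charts_at_iff param_in_dom)
  obtain K \<beta> U where U: "cutoff i K \<beta>" "open U" "fst z \<in> U" "U \<subseteq> chart i ` cdom i" "\<And>x. x \<in> U \<Longrightarrow> \<beta> (param i x) = 1"
    using exists_cutoff[OF Hausdorff c] unfolding chart_param[OF x] by metis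
  show thesis
  proof (rule that[OF cutoff_tangent_bundle[OF U(1)]])
    show "open (U \<times> (UNIV :: 'e set))" using U(2) by (intro open_Times open_UNIV)
    show "z \<in> U \<times> UNIV" "U \<times> UNIV \<subseteq> chart i ` cdom i \<times> UNIV" using U(3,4) by (auto simp: mem_Times_iff)
    show "\<forall>z\<in>U \<times> UNIV. (if T.param i z \<in> points TM then \<beta> (fst (T.param i z)) else 0) = 1"
    proof
      fix z assume z: "z \<in> U \<times> (UNIV :: 'e set)"
      then have "z \<in> (chart i ` cdom i) \<times> UNIV" using U(4) by auto
      from T_param_point[OF i this] show "(if T.param i z \<in> points TM then \<beta> (fst (T.param i z)) else 0) = 1"
        using z U(5) T_charts_atD(1) by auto
    qed
  qed
qed

lemma obtain_cutoff_at:
  assumes "i \<in> charts_at TM q"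
  obtains K \<beta> where "T.cutoff i K \<beta>" "\<beta> q = 1"
  using obtain_cutoff[OF T_charts_atD(4)[OF assms] T_chart_in[OF assms]] T_param_chart[OF assms] by metis

text \<open>
  The linear map \<open>\<lambda>(q)\<close> of the chart \<open>i\<close>. Any field with horizontal coordinates \<open>a\<close> at \<open>q\<close> gives
  the same value, by the next two lemmas.
\<close>

definition vcoeff :: "'i \<Rightarrow> 'p \<times> ('i \<Rightarrow> 'e) \<Rightarrow> 'e \<Rightarrow> 'e" where
  "vcoeff i q a = snd (L (SOME X. X \<in> T.VF \<and> fst (X q i) = a) q i)"

text \<open>
  \<open>L\<close> is tensorial, and it kills vertical vectors because each of them is the value of some
  \<open>J E\<close>.
\<close>

lemma L_eq_at:
  assumes X: "X \<in> T.VF" and Y: "Y \<in> T.VF" and i: "i \<in> charts_at TM q" and eq: "fst (X q i) = fst (Y q i)"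
  shows "L X q i = L Y q i"
proof -
  obtain K \<beta> where c: "T.cutoff i K \<beta>" "\<beta> q = 1" by (rule obtain_cutoff_at[OF i])
  define \<Lambda> where "\<Lambda> w = (\<Sum>k\<in>Basis. (w \<bullet> k) *\<^sub>R L (T.cut_field i \<beta> k) q i)" for w
  have \<Lambda>: "L Z q i = \<Lambda> (Z q i)" if "Z \<in> T.VF" for Z
    unfolding \<Lambda>_def by (rule T.vector_1_form_local[OF L_form that c])
  have vert: "\<Lambda> (0, b) = 0" for b
  proof -
    have E: "T.cut_field i \<beta> (b, 0) \<in> T.VF" by (rule T.cut_field_in_VF[OF c(1)])
    have "J (T.cut_field i \<beta> (b, 0)) q i = (0, b)"
      by (simp add: J_apply[OF E] T.cut_field_at_self[OF c])
    then show ?thesis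
      using \<Lambda>[OF J_in_VF[OF E]] by (simp add: L_J[OF E])
  qed
  have "\<Lambda> (X q i) - \<Lambda> (Y q i) = \<Lambda> (X q i - Y q i)"
    by (simp add: \<Lambda>_def inner_diff_left scaleR_diff_left sum_subtractf)
  also have "X q i - Y q i = (0, snd (X q i) - snd (Y q i))"
    using eq by (simp add: prod_eq_iff)
  finally show ?thesis by (simp add: \<Lambda> X Y vert)
qed

lemma L_apply:
  assumes X: "X \<in> T.VF" and i: "i \<in> charts_at TM q"
  shows "L X q i = (0, vcoeff i q (fst (X q i)))"
proof -
  let ?Y = "SOME Y. Y \<in> T.VF \<and> fst (Y q i) = fst (X q i)"
  have "?Y \<in> T.VF \<and> fst (?Y q i) = fst (X q i)"
    by (rule someI[where P = "\<lambda>Y. Y \<in> T.VF \<and> fst (Y q i) = fst (X q i)" and x = X]) (simp add: X)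
  then have "L X q i = L ?Y q i" by (intro L_eq_at[OF X _ i]) auto
  then show ?thesis using fst_L[OF X, of q i] by (simp add: vcoeff_def prod_eq_iff)
qed

lemma vcoeff_cutoff:
  assumes c: "T.cutoff i K \<beta>" "\<beta> q = 1"
  shows "vcoeff i q a = snd (L (T.cut_field i \<beta> (a, 0)) q i)"
  using L_apply[OF T.cut_field_in_VF[OF c(1)] T.cutoff_in_charts[OF c(1)], of q "(a, 0)"] c
  by (simp add: T.cut_field_at_self[OF c])

lemma linear_vcoeff:
  assumes i: "i \<in> charts_at TM q"
  shows "linear (vcoeff i q)"
proof -
  obtain K \<beta> where c: "T.cutoff i K \<beta>" "\<beta> q = 1" by (rule obtain_cutoff_at[OF i])
  have "vcoeff i q a = (\<Sum>k\<in>Basis. (a \<bullet> fst k) *\<^sub>R snd (L (T.cut_field i \<beta> k) q i))" for a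
  proof -
    have "L (T.cut_field i \<beta> (a, 0)) q i =
        (\<Sum>k\<in>Basis. ((a, 0) \<bullet> k) *\<^sub>R L (T.cut_field i \<beta> k) q i)"
      using T.vector_1_form_local[OF L_form T.cut_field_in_VF[OF c(1)] c, of "(a, 0)" i]
      unfolding T.cut_field_at_self[OF c] .
    then show ?thesis
      by (simp add: vcoeff_cutoff[OF c] snd_sum inner_prod_def)
  qed
  then show ?thesis
    by (intro linearI) (simp_all add: inner_add_left scaleR_add_left sum.distrib scaleR_sum_right)
qed

lemma vcoeff_transport:
  assumes i: "i \<in> charts_at TM q" and j: "j \<in> charts_at TM q"
  shows "vcoeff j q (transport M i j (fst q) a) = transport M i j (fst q) (vcoeff i q a)"
proof -
  obtain K \<beta> where c: "T.cutoff i K \<beta>" "\<beta> q = 1" by (rule obtain_cutoff_at[OF i])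
  define X where "X = T.cut_field i \<beta> (a, 0)"
  have X: "X \<in> T.VF" unfolding X_def by (rule T.cut_field_in_VF[OF c(1)])
  have Xi: "X q i = (a, 0)" unfolding X_def by (rule T.cut_field_at_self[OF c])
  note q = T_charts_atD(1)[OF i]
  have "fst (X q j) = transport M i j (fst q) a"
    using T.tangent_space_transport[OF T.VF_tangent[OF X q] i j]
    by (simp add: fst_transport_tangent_bundle[OF i j] Xi)
  then have "L X q j = (0, vcoeff j q (transport M i j (fst q) a))"
    by (simp add: L_apply[OF X j])
  moreover have "L X q j = transport TM i j q (L X q i)"
    by (rule T.tangent_space_transport[OF T.VF_tangent[OF L_in_VF[OF X] q] i j])
  then have "L X q j = (0, transport M i j (fst q) (vcoeff i q a))"
    by (simp add: L_apply[OF X i] Xi transport_tangent_bundle_vertical[OF i j])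
  ultimately show ?thesis by simp
qed

lemma smooth_vcoeff:
  assumes i: "i \<in> chart_index M"
  shows "smooth_on ((chart i ` cdom i) \<times> UNIV) (\<lambda>z. vcoeff i (T.param i z) a)"
proof (rule smooth_on_local)
  fix z :: "'e \<times> 'e" assume z: "z \<in> (chart i ` cdom i) \<times> UNIV"
  obtain K \<beta> W where c: "T.cutoff i K \<beta>" "open W" "z \<in> W" "W \<subseteq> (chart i ` cdom i) \<times> UNIV"
    "\<forall>z\<in>W. \<beta> (T.param i z) = 1"
    by (rule obtain_cutoff[OF i z])
  have "smooth_on W (\<lambda>z. snd (L (T.cut_field i \<beta> (a, 0)) (T.param i z) i))"
    by (intro smooth_on_bounded_linear[OF c(2) bounded_linear_snd]
        smooth_on_subset[OF T.VF_smooth[OF L_in_VF[OF T.cut_field_in_VF[OF c(1)]]]])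
      (use i c(4) in \<open>simp_all add: chart_image_dom_tangent_bundle\<close>)
  then have "smooth_on W (\<lambda>z. vcoeff i (T.param i z) a)"
    by (rule smooth_on_cong[OF c(2), rotated]) (simp add: vcoeff_cutoff[OF c(1) c(5)[rule_format]])
  then show "\<exists>T. open T \<and> z \<in> T \<and> smooth_on T (\<lambda>z. vcoeff i (T.param i z) a)"
    using c by blast
qed

text \<open>
  Test \<open>[J, L] = 0\<close> near a point on the constant coordinate fields \<open>X = (a, 0)\<close> and \<open>Y = (b, 0)\<close> and
  on the linear function \<open>f = y \<bullet> c\<close>, all cut off. Then \<open>J X = (0, a)\<close> and \<open>L Y = (0, \<lambda> b)\<close>, and
  every term vanishes near the point except \<open>J X (L Y f) = D\<^sub>y (\<lambda> b) a \<bullet> c\<close> and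
  \<open>J Y (L X f) = D\<^sub>y (\<lambda> a) b \<bullet> c\<close>.
\<close>

lemma vcoeff_symmetric:
  assumes tf: "torsion_free M L" and i: "i \<in> chart_index M" and z: "z \<in> (chart i ` cdom i) \<times> UNIV"
  shows "frechet_derivative (\<lambda>z. vcoeff i (T.param i z) b) (at z) (0, a) =
    frechet_derivative (\<lambda>z. vcoeff i (T.param i z) a) (at z) (0, b)"
proof (rule euclidean_eqI)
  fix c :: 'e
  obtain K \<beta> W where cut: "T.cutoff i K \<beta>" and W: "open W" "z \<in> W" "W \<subseteq> (chart i ` cdom i) \<times> UNIV"
    "\<forall>z\<in>W. \<beta> (T.param i z) = 1"
    by (rule obtain_cutoff[OF i z])
  have ch: "i \<in> charts_at TM (T.param i z)" "T.chart i (T.param i z) = z" if "z \<in> W" for z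
    using T_param_point(1,2)[OF i] W(3) that by blast+
  define q where "q = T.param i z"
  have q: "i \<in> charts_at TM q" "T.chart i q = z" using ch[OF W(2)] by (simp_all add: q_def)
  define X where "X = T.cut_field i \<beta> (a, 0)"
  define Y where "Y = T.cut_field i \<beta> (b, 0)"
  define f where "f = T.cut_fun i \<beta> (\<lambda>z. snd z \<bullet> c)"
  have X: "X \<in> T.VF" and Y: "Y \<in> T.VF" unfolding X_def Y_def by (rule T.cut_field_in_VF[OF cut])+
  have f: "f \<in> T.SF"
    unfolding f_def
    by (intro T.cut_fun_in_SF[OF cut] smooth_on_bounded_linear[OF _ bounded_linear_inner_left]
        smooth_on_linear bounded_linear_snd T.open_chart) (use i in simp_all)
  have Xl: "X (T.param i z) i = (a, 0)" "J X (T.param i z) i = (0, a)"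
    and Yl: "Y (T.param i z) i = (b, 0)" "J Y (T.param i z) i = (0, b)" if "z \<in> W" for z
    using T.cut_field_at_self[OF cut W(4)[rule_format, OF that]] by (simp_all add: J_apply X Y) (simp_all add: X_def Y_def)
  have const_der: "frechet_derivative F (at z) w = 0" if "\<And>z. z \<in> W \<Longrightarrow> F z = k" for F :: "'e \<times> 'e \<Rightarrow> 'd::real_normed_vector" and k w
  proof -
    have "(F has_derivative (\<lambda>w. 0)) (at z)"
      by (rule has_derivative_transform_within_open[OF has_derivative_const[of k] W(1,2)]) (use that in simp)
    from fun_cong[OF frechet_derivative_at[OF this], of w] show ?thesis by simp
  qed
  have Zf: "apply_field TM Z f (T.param i z) = snd (Z (T.param i z) i) \<bullet> c" if "Z \<in> T.VF" "z \<in> W" for Z z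
  proof -
    have "((\<lambda>z. f (T.param i z)) has_derivative (\<lambda>w. snd w \<bullet> c)) (at z)"
      by (rule has_derivative_transform_within_open[OF _ W(1) that(2), where f = "\<lambda>z. snd z \<bullet> c"])
        (auto intro!: derivative_eq_intros simp: f_def T.cut_fun_at[OF cut W(4)[rule_format]] ch)
    from fun_cong[OF frechet_derivative_at[OF this]]
    show ?thesis by (simp add: T.apply_field_local[OF that(1) f ch(1)[OF that(2)]] ch(2)[OF that(2)])
  qed
  have ZZf: "apply_field TM Z' (apply_field TM Z f) q =
      frechet_derivative (\<lambda>z. snd (Z (T.param i z) i) \<bullet> c) (at z) (Z' q i)" if "Z \<in> T.VF" "Z' \<in> T.VF" for Z Z'
  proof -
    have sf: "apply_field TM Z f \<in> T.SF" by (rule T.apply_field_in_SF[OF that(1) f])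
    have "((\<lambda>z. snd (Z (T.param i z) i) \<bullet> c) has_derivative
        frechet_derivative (\<lambda>z. apply_field TM Z f (T.param i z)) (at z)) (at z)"
      by (rule has_derivative_transform_within_open[OF T.local_fun_has_derivative[OF sf q(1), unfolded q(2)] W(1,2)])
        (simp add: Zf that)
    from fun_cong[OF frechet_derivative_at[OF this]] show ?thesis
      by (simp add: T.apply_field_local[OF that(2) sf q(1)] q(2))
  qed
  have vcoeff_der: "frechet_derivative (\<lambda>z. snd (L Z (T.param i z) i) \<bullet> c) (at z) w =
      frechet_derivative (\<lambda>z. vcoeff i (T.param i z) d) (at z) w \<bullet> c"
    if Z: "Z \<in> T.VF" and d: "\<And>z. z \<in> W \<Longrightarrow> Z (T.param i z) i = (d, 0)" for Z d w
  proof -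
    have "((\<lambda>z. snd (L Z (T.param i z) i) \<bullet> c) has_derivative
        (\<lambda>w. frechet_derivative (\<lambda>z. vcoeff i (T.param i z) d) (at z) w \<bullet> c)) (at z)"
      by (rule has_derivative_transform_within_open[OF has_derivative_inner_left[OF
              smooth_on_has_derivative[OF smooth_vcoeff[OF i] z]] W(1,2)])
        (simp add: L_apply[OF Z ch(1)] d)
    from fun_cong[OF frechet_derivative_at[OF this], of w] show ?thesis by simp
  qed
  have LJf: "apply_field TM (L (J Z)) f q = 0" "apply_field TM (J (L Z)) f q = 0" if "Z \<in> T.VF" for Z
    by (simp_all add: L_J[OF that] J_L[OF that] T.apply_field_zero_field[OF f])
  have Zfq: "apply_field TM Z f q = snd (Z q i) \<bullet> c" if "Z \<in> T.VF" for Z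
    using Zf[OF that W(2)] by (simp add: q_def)
  \<comment> \<open>The bracket of two fields that are constant in the chart near the point vanishes there.\<close>
  have brL: "apply_field TM (L (lie_bracket TM Z Z')) f q = 0"
    if "Z \<in> T.VF" "Z' \<in> T.VF" "\<And>z. z \<in> W \<Longrightarrow> Z (T.param i z) i = w" "\<And>z. z \<in> W \<Longrightarrow> Z' (T.param i z) i = w'" for Z Z' w w'
  proof -
    note br = T.lie_bracket_in_VF[OF that(1,2)]
    have "lie_bracket TM Z Z' q i = 0"
      using q by (simp add: lie_bracket_def const_der[of "\<lambda>z. Z (T.param i z) i", OF that(3)]
          const_der[of "\<lambda>z. Z' (T.param i z) i", OF that(4)])
    then show ?thesis
      by (simp add: Zfq[OF L_in_VF[OF br]] L_apply[OF br q(1)] linear_0[OF linear_vcoeff[OF q(1)]])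
  qed
  have Lder: "fst (frechet_derivative (\<lambda>z. L Z (T.param i z) i) (at z) w) = 0" if Z: "Z \<in> T.VF" for Z w
  proof -
    have "(\<lambda>z. L Z (T.param i z) i) differentiable (at z)"
      using T.local_field_has_derivative[OF L_in_VF[OF Z] q(1)] unfolding q(2) by (rule differentiableI)
    from frechet_derivative_fst[OF this, of w] show ?thesis by (simp add: fst_L[OF Z])
  qed
  \<comment> \<open>The bracket of a vertical field with a constant one is vertical, so it is killed by J.\<close>
  have brJ: "apply_field TM (J (lie_bracket TM (L Z) Z')) f q = 0" "apply_field TM (J (lie_bracket TM Z' (L Z))) f q = 0"
    if "Z \<in> T.VF" "Z' \<in> T.VF" "\<And>z. z \<in> W \<Longrightarrow> Z' (T.param i z) i = w'" for Z Z' w'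
  proof -
    note br = T.lie_bracket_in_VF[OF L_in_VF[OF that(1)] that(2)] T.lie_bracket_in_VF[OF that(2) L_in_VF[OF that(1)]]
    have "fst (lie_bracket TM (L Z) Z' q i) = 0" "fst (lie_bracket TM Z' (L Z) q i) = 0"
      using q by (simp_all add: lie_bracket_def const_der[of "\<lambda>z. Z' (T.param i z) i", OF that(3)] Lder[OF that(1)])
    then show "apply_field TM (J (lie_bracket TM (L Z) Z')) f q = 0" "apply_field TM (J (lie_bracket TM Z' (L Z))) f q = 0"
      by (simp_all add: Zfq[OF J_in_VF] br J_apply)
  qed
  have Jq: "J X q i = (0, a)" "J Y q i = (0, b)" using Xl(2)[OF W(2)] Yl(2)[OF W(2)] by (simp_all add: q_def)
  have Jder: "frechet_derivative (\<lambda>z. snd (J X (T.param i z) i) \<bullet> c) (at z) w = 0"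
    "frechet_derivative (\<lambda>z. snd (J Y (T.param i z) i) \<bullet> c) (at z) w = 0" for w
    by (rule const_der, simp add: Xl, rule const_der, simp add: Yl)
  have "deriv_1 TM J (deriv_1 TM L (T.function_form f)) [X, Y] q +
      deriv_1 TM L (deriv_1 TM J (T.function_form f)) [X, Y] q = 0"
    by (rule T.FN_bracket_zero_function[OF tf[unfolded torsion_free_def] J_in_VF L_in_VF f X Y])
  moreover have "deriv_1 TM J (deriv_1 TM L (T.function_form f)) [X, Y] q =
      frechet_derivative (\<lambda>z. vcoeff i (T.param i z) b) (at z) (0, a) \<bullet> c -
      frechet_derivative (\<lambda>z. vcoeff i (T.param i z) a) (at z) (0, b) \<bullet> c"
    by (simp add: T.deriv_1_deriv_1_function[OF J_in_VF L_in_VF f X Y] ZZf L_in_VF J_in_VF X Y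
        vcoeff_der[OF X Xl(1)] vcoeff_der[OF Y Yl(1)] Jq LJf(1)[OF T.lie_bracket_in_VF[OF X Y]]
        brL[OF J_in_VF[OF X] Y Xl(2) Yl(1)] brL[OF X J_in_VF[OF Y] Xl(1) Yl(2)])
  moreover have "deriv_1 TM L (deriv_1 TM J (T.function_form f)) [X, Y] q = 0"
    by (simp add: T.deriv_1_deriv_1_function[OF L_in_VF J_in_VF f X Y] ZZf L_in_VF J_in_VF X Y
        Jder LJf(2)[OF T.lie_bracket_in_VF[OF X Y]]
        brJ(1)[OF X Y Yl(1)] brJ(2)[OF Y X Xl(1)])
  ultimately show "frechet_derivative (\<lambda>z. vcoeff i (T.param i z) b) (at z) (0, a) \<bullet> c =
    frechet_derivative (\<lambda>z. vcoeff i (T.param i z) a) (at z) (0, b) \<bullet> c"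
    by simp
qed

text \<open>
  Both sides of \<open>L = [J, V]\<close> yield vector fields, so it is enough to compare them in one chart around
  each point.
\<close>

lemma L_eq_bracket_iff:
  assumes V: "V \<in> vertical_fields M"
  shows "L = form_field_bracket TM J V \<longleftrightarrow> (\<forall>i\<in>chart_index M. \<forall>z\<in>(chart i ` cdom i) \<times> UNIV. \<forall>a.
    frechet_derivative (\<lambda>z. snd (V (T.param i z) i)) (at z) (0, a) = vcoeff i (T.param i z) a)"
proof (intro iffI ballI allI)
  fix i z a
  assume eq: "L = form_field_bracket TM J V" and i: "i \<in> chart_index M" and z: "z \<in> (chart i ` cdom i) \<times> (UNIV :: 'e set)"
  note ch = T_param_point(1,2)[OF i z]
  obtain K \<beta> where c: "T.cutoff i K \<beta>" "\<beta> (T.param i z) = 1" by (rule obtain_cutoff_at[OF ch(1)])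
  let ?X = "T.cut_field i \<beta> (a, 0)"
  have X: "?X \<in> T.VF" by (rule T.cut_field_in_VF[OF c(1)])
  have "L ?X (T.param i z) i = form_field_bracket TM J V ?X (T.param i z) i" using eq by simp
  then show "frechet_derivative (\<lambda>z. snd (V (T.param i z) i)) (at z) (0, a) = vcoeff i (T.param i z) a"
    unfolding L_apply[OF X ch(1)] form_field_bracket_vertical[OF V X ch(1)] ch(2) T.cut_field_at_self[OF c] by simp
next
  assume *: "\<forall>i\<in>chart_index M. \<forall>z\<in>(chart i ` cdom i) \<times> UNIV. \<forall>a.
    frechet_derivative (\<lambda>z. snd (V (T.param i z) i)) (at z) (0, a) = vcoeff i (T.param i z) a"
  show "L = form_field_bracket TM J V"
  proof
    fix X
    show "L X = form_field_bracket TM J V X"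
    proof (cases "X \<in> T.VF")
      case False
      moreover have "L \<in> T.VF \<rightarrow>\<^sub>E T.VF" using L_form by (simp add: vector_1_forms_def)
      ultimately show ?thesis by (simp add: form_field_bracket_def PiE_arb[of L "T.VF" "\<lambda>_. T.VF"])
    next
      case X: True
      note B = form_field_bracket_vertical_in_VF[OF V X]
      show ?thesis
      proof
        fix q
        show "L X q = form_field_bracket TM J V X q"
        proof (cases "q \<in> points TM")
          case True
          then obtain i where i: "i \<in> charts_at TM q" using T.charts_at_ex by blast
          have "frechet_derivative (\<lambda>z. snd (V (T.param i z) i)) (at (T.chart i q)) (0, fst (X q i)) = vcoeff i q (fst (X q i))"
            using * T_charts_atD(4)[OF i] T_chart_in[OF i] T_param_chart[OF i] by metis
          then have "L X q i = form_field_bracket TM J V X q i"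
            by (simp add: L_apply[OF X i] form_field_bracket_vertical[OF V X i])
          with T.VF_tangent[OF L_in_VF[OF X] True] T.VF_tangent[OF B True] i show ?thesis
            by (rule T.tangent_space_eqI)
        next
          case False
          then show ?thesis by (simp only: T.VF_outside[OF L_in_VF[OF X] False] T.VF_outside[OF B False])
        qed
      qed
    qed
  qed
qed

section \<open>The radial potential\<close>

definition potential :: "'i \<Rightarrow> 'e \<times> 'e \<Rightarrow> 'e" where
  "potential i z = integral {0..1} (\<lambda>t. vcoeff i (T.param i (fst z, t *\<^sub>R snd z)) (snd z))"

definition potential_field :: "'p \<times> ('i \<Rightarrow> 'e) \<Rightarrow> 'i \<Rightarrow> 'e \<times> 'e" where
  "potential_field q i = (if i \<in> charts_at TM q then (0, potential i (T.chart i q)) else 0)"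

lemma smooth_potential_integrand:
  assumes i: "i \<in> chart_index M"
  shows "smooth_on (((chart i ` cdom i) \<times> UNIV) \<times> UNIV)
    (\<lambda>zt. vcoeff i (T.param i (fst (fst zt), snd zt *\<^sub>R snd (fst zt))) (snd (fst zt)))" (is "smooth_on ?S _")
proof -
  have S: "open ?S" by (intro open_Times open_chart[OF i] open_UNIV)
  have lin: "smooth_on ?S snd" "smooth_on ?S (\<lambda>zt. fst (fst zt))" "smooth_on ?S (\<lambda>zt. snd (fst zt))"
    by (intro smooth_on_linear S bounded_linear_intros)+
  have ray: "smooth_on ?S (\<lambda>zt. (fst (fst zt), snd zt *\<^sub>R snd (fst zt)))"
    by (rule smooth_on_Pair[OF S lin(2) smooth_on_scaleR[OF S lin(1,3)]])
  have "smooth_on ?S (\<lambda>zt. \<Sum>b\<in>Basis. (snd (fst zt) \<bullet> b) *\<^sub>R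
      vcoeff i (T.param i (fst (fst zt), snd zt *\<^sub>R snd (fst zt))) b)"
    by (intro smooth_on_sum smooth_on_scaleR S smooth_on_compose[OF S ray smooth_vcoeff[OF i]]
        smooth_on_bounded_linear[OF S bounded_linear_inner_left lin(3)]) auto
  then show ?thesis
    by (rule smooth_on_cong[OF S, rotated])
      (use linear_expand_Basis[OF linear_vcoeff[OF T_param_point(1)[OF i]], symmetric] in auto)
qed

lemma smooth_potential:
  assumes i: "i \<in> chart_index M"
  shows "smooth_on ((chart i ` cdom i) \<times> UNIV) (potential i)"
  using smooth_on_integral[OF open_T_chart[OF i] smooth_potential_integrand[OF i]]
  by (simp add: potential_def[abs_def])

lemma potential_derivative:
  assumes tf: "torsion_free M L" and i: "i \<in> chart_index M" and z: "z \<in> (chart i ` cdom i) \<times> UNIV"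
  shows "frechet_derivative (potential i) (at z) (0, a) = vcoeff i (T.param i z) a"
proof -
  obtain x y where xy: "z = (x, y)" "x \<in> chart i ` cdom i" using z by auto
  define q where "q y = vcoeff i (T.param i (x, y))" for y
  have sq: "smooth_on UNIV (\<lambda>y. q y a)" for a
    unfolding q_def
    by (rule smooth_on_compose[OF open_UNIV smooth_on_Pair[OF open_UNIV smooth_on_const
            smooth_on_linear[OF open_UNIV bounded_linear_ident]] smooth_vcoeff[OF i]])
      (use xy in auto)
  have dq: "frechet_derivative (\<lambda>y. q y a) (at y) b = frechet_derivative (\<lambda>z. vcoeff i (T.param i z) a) (at (x, y)) (0, b)" for a b y
  proof -
    have "((\<lambda>y. q y a) has_derivative (\<lambda>b. frechet_derivative (\<lambda>z. vcoeff i (T.param i z) a) (at (x, y)) (0, b))) (at y)"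
      unfolding q_def
      by (rule has_derivative_compose[where f = "\<lambda>y. (x, y)" and g = "\<lambda>z. vcoeff i (T.param i z) a" and x = y,
            OF has_derivative_Pair[OF has_derivative_const has_derivative_ident]
            smooth_on_has_derivative[OF smooth_vcoeff[OF i]]]) (use xy in simp)
    from fun_cong[OF frechet_derivative_at[OF this], of b] show ?thesis by simp
  qed
  have "((\<lambda>y. integral {0..1} (\<lambda>t. q (t *\<^sub>R y) y)) has_derivative q y) (at y)"
  proof (rule integral_radial_derivative[OF sq])
    show "linear (q y)" for y
      unfolding q_def by (rule linear_vcoeff[OF T_param_point(1)[OF i]]) (use xy in simp)
    show "frechet_derivative (\<lambda>y. q y a) (at y) b = frechet_derivative (\<lambda>y. q y b) (at y) a" for y a b
      unfolding dq by (rule vcoeff_symmetric[OF tf i]) (use xy in simp)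
  qed
  then have 1: "((\<lambda>y. potential i (x, y)) has_derivative q y) (at y)"
    by (simp add: potential_def q_def)
  have "((\<lambda>y. potential i (x, y)) has_derivative (\<lambda>b. frechet_derivative (potential i) (at (x, y)) (0, b))) (at y)"
    by (rule has_derivative_compose[where f = "\<lambda>y. (x, y)" and g = "potential i" and x = y,
          OF has_derivative_Pair[OF has_derivative_const has_derivative_ident]
          smooth_on_has_derivative[OF smooth_potential[OF i]]]) (use xy in simp)
  from has_derivative_unique[OF this 1] show ?thesis
    unfolding xy(1) q_def by (rule fun_cong)
qed

text \<open>
  The point \<open>r t\<close> of the fibre, \<open>t\<close> times the given vector, has fibre coordinates proportional to
  \<open>t\<close> in both charts, so the two radial integrals run over the same points and their integrands
  differ by a linear map that does not depend on \<open>t\<close>.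
\<close>

lemma potential_transport:
  assumes i: "i \<in> charts_at TM q" and j: "j \<in> charts_at TM q"
  shows "potential j (T.chart j q) = transport M i j (fst q) (potential i (T.chart i q))"
proof -
  note i' = T_charts_atD[OF i] and j' = T_charts_atD[OF j]
  define r where "r t = (fst q, \<lambda>k. t *\<^sub>R snd q k)" for t
  have r: "k \<in> charts_at TM (r t)" "T.param k (chart k (fst q), t *\<^sub>R snd q k) = r t"
    if "k \<in> charts_at TM q" for k t
  proof -
    note k' = T_charts_atD[OF that]
    have "r t \<in> points TM"
      using k'(1) by (simp add: points_tangent_bundle r_def tangent_space_scaleR)
    then show c: "k \<in> charts_at TM (r t)"
      using k' by (simp add: T_charts_at r_def)
    show "T.param k (chart k (fst q), t *\<^sub>R snd q k) = r t"
      using T_param_chart[OF c] by (simp add: chart_map_tangent_bundle r_def)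
  qed
  let ?g = "\<lambda>t. vcoeff i (r t) (snd q i)"
  have lin: "bounded_linear (transport M i j (fst q))"
    using linear_transport[OF i'(2) j'(2)] by (rule linear_conv_bounded_linear[THEN iffD1])
  have "continuous_on {0..1} ?g"
  proof -
    have "continuous_on {0..1} (\<lambda>t. vcoeff i (T.param i (chart i (fst q), t *\<^sub>R snd q i)) (snd q i))"
      by (rule continuous_on_compose2[OF smooth_on_imp_continuous_on[OF smooth_vcoeff[OF i'(4)]]])
        (use i'(5) in \<open>auto intro!: continuous_intros\<close>)
    then show ?thesis by (simp add: r[OF i])
  qed
  then have int: "?g integrable_on {0..1}" by (rule integrable_continuous_real)
  have "snd q j = transport M i j (fst q) (snd q i)"
    by (rule tangent_space_transport[OF i'(3,2) j'(2)])
  then have "vcoeff j (r t) (snd q j) = transport M i j (fst q) (?g t)" for t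
    using vcoeff_transport[OF r(1)[OF i] r(1)[OF j]] by (simp add: r_def)
  then have "potential j (T.chart j q) = integral {0..1} (transport M i j (fst q) \<circ> ?g)"
    by (simp add: potential_def chart_map_tangent_bundle r[OF j] o_def)
  also have "\<dots> = transport M i j (fst q) (integral {0..1} ?g)"
    by (rule integral_linear[OF int lin])
  also have "integral {0..1} ?g = potential i (T.chart i q)"
    by (simp add: potential_def chart_map_tangent_bundle r[OF i])
  finally show ?thesis .
qed

lemma potential_field_local:
  assumes i: "i \<in> chart_index M" and z: "z \<in> (chart i ` cdom i) \<times> UNIV"
  shows "potential_field (T.param i z) i = (0, potential i z)"
  using T_param_point[OF i z] by (simp add: potential_field_def)

lemma potential_field_vertical: "potential_field \<in> vertical_fields M"
proof -
  have "potential_field \<in> T.VF"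
  proof (rule T.vector_fieldsI)
    fix q assume q: "q \<in> points TM"
    show "potential_field q \<in> tangent_space TM q"
      by (rule T.tangent_spaceI)
        (simp_all add: potential_field_def transport_tangent_bundle_vertical flip: potential_transport)
  next
    show "potential_field q = 0" if "q \<notin> points TM" for q
      using T.charts_at_empty[OF that] by (simp add: potential_field_def fun_eq_iff)
  next
    fix i assume "i \<in> chart_index TM"
    then have i: "i \<in> chart_index M" by simp
    have "smooth_on ((chart i ` cdom i) \<times> UNIV) (\<lambda>z. (0 :: 'e, potential i z))"
      by (intro smooth_on_Pair smooth_on_const smooth_potential[OF i] open_T_chart[OF i])
    then show "smooth_on (T.chart i ` T.cdom i) (\<lambda>z. potential_field (T.param i z) i)"
      unfolding chart_image_dom_tangent_bundle[OF i]
      by (rule smooth_on_cong[OF open_T_chart[OF i], rotated]) (simp add: potential_field_local[OF i])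
  qed
  then show ?thesis
    by (auto simp: vertical_fields_def proj_deriv_def potential_field_def fun_eq_iff)
qed

lemma L_eq_bracket_potential:
  assumes tf: "torsion_free M L"
  shows "L = form_field_bracket TM J potential_field"
  unfolding L_eq_bracket_iff[OF potential_field_vertical]
proof (intro ballI allI)
  fix i z a assume i: "i \<in> chart_index M" and z: "z \<in> (chart i ` cdom i) \<times> (UNIV :: 'e set)"
  have "frechet_derivative (\<lambda>z. snd (potential_field (T.param i z) i)) (at z) = frechet_derivative (potential i) (at z)"
    by (rule frechet_derivative_transform_within_open[OF _ open_T_chart[OF i] z, symmetric])
      (simp_all add: potential_field_local[OF i] smooth_on_differentiable[OF smooth_potential[OF i] z])
  then show "frechet_derivative (\<lambda>z. snd (potential_field (T.param i z) i)) (at z) (0, a) = vcoeff i (T.param i z) a"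
    by (simp add: potential_derivative[OF tf i z])
qed

section \<open>Uniqueness up to vertical lifts\<close>

lemma vertical_lift_local:
  assumes i: "i \<in> chart_index M" and z: "z \<in> (chart i ` cdom i) \<times> UNIV"
  shows "vertical_lift M X (T.param i z) i = (0, X (param i (fst z)) i)"
  using T_charts_atD(1)[OF T_param_point(1)[OF i z]]
  by (simp add: vertical_lift_def vlift_def T_param_point(3)[OF i z])

lemma vertical_lift_vertical:
  assumes X: "X \<in> VF"
  shows "vertical_lift M X \<in> vertical_fields M"
proof -
  have "vertical_lift M X \<in> T.VF"
  proof (rule T.vector_fieldsI)
    show "vertical_lift M X q \<in> tangent_space TM q" if "q \<in> points TM" for q
      using that vlift_tangent_space[OF that VF_tangent[OF X]]
      by (simp add: vertical_lift_def points_tangent_bundle)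
    show "vertical_lift M X q = 0" if "q \<notin> points TM" for q
      using that by (simp add: vertical_lift_def)
    fix i assume "i \<in> chart_index TM"
    then have i: "i \<in> chart_index M" by simp
    have "smooth_on ((chart i ` cdom i) \<times> UNIV) (\<lambda>z :: 'e \<times> 'e. (0 :: 'e, X (param i (fst z)) i))"
      by (intro smooth_on_Pair smooth_on_const smooth_on_fst[OF open_chart[OF i] VF_smooth[OF X i]] open_T_chart[OF i])
    then show "smooth_on (T.chart i ` T.cdom i) (\<lambda>z. vertical_lift M X (T.param i z) i)"
      unfolding chart_image_dom_tangent_bundle[OF i]
      by (rule smooth_on_cong[OF open_T_chart[OF i], rotated]) (simp add: vertical_lift_local[OF i])
  qed
  then show ?thesis
    by (auto simp: vertical_fields_def proj_deriv_def vertical_lift_def vlift_def fun_eq_iff)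
qed

lemma smooth_snd_local:
  assumes V: "V \<in> vertical_fields M" and i: "i \<in> chart_index M"
  shows "smooth_on ((chart i ` cdom i) \<times> UNIV) (\<lambda>z. snd (V (T.param i z) i))"
proof -
  have "smooth_on ((chart i ` cdom i) \<times> UNIV) (\<lambda>z. V (T.param i z) i)"
    using T.VF_smooth[OF vertical_fieldsD(1)[OF V], of i] i by (simp add: chart_image_dom_tangent_bundle)
  then show ?thesis by (rule smooth_on_bounded_linear[OF open_T_chart[OF i] bounded_linear_snd])
qed

text \<open>
  Fibres are connected, so such a field is constant along them. The field on the base is read off along
  the zero section, where it inherits smoothness and the transformation law.
\<close>

lemma vertical_field_basic_lift:
  assumes W: "W \<in> vertical_fields M"
    and der: "\<And>i z a. i \<in> chart_index M \<Longrightarrow> z \<in> (chart i ` cdom i) \<times> UNIV \<Longrightarrow>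
      frechet_derivative (\<lambda>z. snd (W (T.param i z) i)) (at z) (0, a) = 0"
  shows "\<exists>X\<in>VF. W = vertical_lift M X"
proof -
  note WV = vertical_fieldsD(1)[OF W]
  have const: "snd (W (T.param i (x, y)) i) = snd (W (T.param i (x, 0)) i)"
    if i: "i \<in> chart_index M" and x: "x \<in> chart i ` cdom i" for i x y
  proof -
    have "((\<lambda>y. snd (W (T.param i (x, y)) i)) has_derivative (\<lambda>b. 0)) (at y within UNIV)" for y
    proof -
      have "((\<lambda>y. snd (W (T.param i (x, y)) i)) has_derivative
          (\<lambda>b. frechet_derivative (\<lambda>z. snd (W (T.param i z) i)) (at (x, y)) (0, b))) (at y)"
        by (rule has_derivative_compose[where f = "\<lambda>y. (x, y)" and g = "\<lambda>z. snd (W (T.param i z) i)" and x = y,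
              OF has_derivative_Pair[OF has_derivative_const has_derivative_ident]
              smooth_on_has_derivative[OF smooth_snd_local[OF W i]]]) (use x in simp)
      then show ?thesis using der[OF i] x by simp
    qed
    from has_derivative_zero_constant[OF convex_UNIV this] show ?thesis by auto
  qed
  define X where "X p = (\<lambda>i. snd (W (p, 0) i))" for p
  have zero: "(p, 0) \<in> points TM \<longleftrightarrow> p \<in> points M" for p
    by (simp add: points_tangent_bundle tangent_space_0)
  have X: "X \<in> VF"
  proof (rule vector_fieldsI)
    fix p assume p: "p \<in> points M"
    then have q: "(p, 0) \<in> points TM" by (simp add: zero)
    note Wq = T.VF_tangent[OF WV q]
    show "X p \<in> tangent_space M p"
    proof (rule tangent_spaceI)
      show "X p i = 0" if "i \<notin> charts_at M p" for i
        using T.tangent_space_outside[OF Wq, of i] that by (simp add: X_def T_charts_at[OF q])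
      fix i j assume ij: "i \<in> charts_at M p" "j \<in> charts_at M p"
      then have i: "i \<in> charts_at TM (p, 0)" and j: "j \<in> charts_at TM (p, 0)"
        by (simp_all add: T_charts_at[OF q])
      have "W (p, 0) i = (0, X p i)"
        by (simp add: X_def prod_eq_iff vertical_fieldsD(2)[OF W])
      then have "W (p, 0) j = (0, transport M i j p (X p i))"
        unfolding T.tangent_space_transport[OF Wq i j] by (simp add: transport_tangent_bundle_vertical[OF i j])
      moreover have "X p j = snd (W (p, 0) j)" by (simp add: X_def)
      ultimately show "X p j = transport M i j p (X p i)" by simp
    qed
  next
    show "X p = 0" if "p \<notin> points M" for p
      using T.VF_outside[OF WV, of "(p, 0)"] that by (simp add: X_def zero fun_eq_iff)
  next
    fix i assume i: "i \<in> chart_index M"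
    have "smooth_on (chart i ` cdom i) (\<lambda>x. snd (W (T.param i (x, 0)) i))"
      by (rule smooth_on_compose[OF open_chart[OF i] smooth_on_Pair[OF open_chart[OF i]
              smooth_on_linear[OF open_chart[OF i] bounded_linear_ident] smooth_on_const]
            smooth_snd_local[OF W i]]) auto
    then show "smooth_on (chart i ` cdom i) (\<lambda>x. X (param i x) i)"
    proof (rule smooth_on_cong[OF open_chart[OF i], rotated])
      fix x assume x: "x \<in> chart i ` cdom i"
      then have "i \<in> charts_at M (param i x)" using i param_in_dom by (simp add: charts_at_iff)
      from tangent_vector_of[OF tangent_space_0 this]
      show "snd (W (T.param i (x, 0)) i) = X (param i x) i"
        by (simp add: chart_inv_tangent_bundle[OF i x] X_def)
    qed
  qed
  have "W = vertical_lift M X"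
  proof
    fix q
    show "W q = vertical_lift M X q"
    proof (cases "q \<in> points TM")
      case True
      then obtain i where i: "i \<in> charts_at TM q" using T.charts_at_ex by blast
      note i' = T_charts_atD[OF i]
      have x: "chart i (fst q) \<in> chart i ` cdom i" using i'(5) by blast
      have "W q i = vertical_lift M X q i"
      proof -
        have "snd (W q i) = snd (W (T.param i (chart i (fst q), 0)) i)"
          using const[OF i'(4) x, of "snd q i"] T_param_chart[OF i] by (simp add: chart_map_tangent_bundle)
        also have "T.param i (chart i (fst q), 0) = (fst q, 0)"
          using tangent_vector_of[OF tangent_space_0 i'(2)]
          by (simp add: chart_inv_tangent_bundle[OF i'(4) x] param_chart i')
        finally show ?thesis
          using True vertical_fieldsD(2)[OF W, of q i]
          by (simp add: vertical_lift_def vlift_def X_def prod_eq_iff)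
      qed
      with T.VF_tangent[OF WV True] T.VF_tangent[OF vertical_fieldsD(1)[OF vertical_lift_vertical[OF X]] True] i
      show ?thesis by (rule T.tangent_space_eqI)
    next
      case False
      then show ?thesis by (simp add: T.VF_outside[OF WV False] vertical_lift_def)
    qed
  qed
  then show ?thesis using X by blast
qed

lemma vertical_fields_add:
  "V \<in> vertical_fields M \<Longrightarrow> W \<in> vertical_fields M \<Longrightarrow> V + W \<in> vertical_fields M"
  and vertical_fields_diff:
  "V \<in> vertical_fields M \<Longrightarrow> W \<in> vertical_fields M \<Longrightarrow> V - W \<in> vertical_fields M"
  by (auto simp: vertical_fields_def T.VF_add T.VF_diff proj_deriv_def fun_eq_iff)

lemma vertical_derivative_add:
  assumes "V \<in> vertical_fields M" "W \<in> vertical_fields M" "i \<in> chart_index M" "z \<in> (chart i ` cdom i) \<times> UNIV"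
  shows "frechet_derivative (\<lambda>z. snd ((V + W) (T.param i z) i)) (at z) w =
    frechet_derivative (\<lambda>z. snd (V (T.param i z) i)) (at z) w + frechet_derivative (\<lambda>z. snd (W (T.param i z) i)) (at z) w"
  using fun_cong[OF frechet_derivative_at[OF has_derivative_add[OF
        smooth_on_has_derivative[OF smooth_snd_local[OF assms(1,3)] assms(4)]
        smooth_on_has_derivative[OF smooth_snd_local[OF assms(2,3)] assms(4)]]], of w]
  by simp

lemma vertical_derivative_lift:
  assumes X: "X \<in> VF" and i: "i \<in> chart_index M" and z: "z \<in> (chart i ` cdom i) \<times> UNIV"
  shows "frechet_derivative (\<lambda>z. snd (vertical_lift M X (T.param i z) i)) (at z) (0, a) = 0"
proof -
  have x: "fst z \<in> chart i ` cdom i" using z by auto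
  let ?D = "frechet_derivative (\<lambda>x. X (param i x) i) (at (fst z))"
  have D: "((\<lambda>x. X (param i x) i) has_derivative ?D) (at (fst z))"
    by (rule smooth_on_has_derivative[OF VF_smooth[OF X i] x])
  have "((\<lambda>z. X (param i (fst z)) i) has_derivative (\<lambda>w. ?D (fst w))) (at z)"
    by (rule has_derivative_compose[where f = fst and g = "\<lambda>x. X (param i x) i" and x = z, OF _ D])
      (intro has_derivative_fst has_derivative_ident)
  then have "((\<lambda>z. snd (vertical_lift M X (T.param i z) i)) has_derivative (\<lambda>w. ?D (fst w))) (at z)"
    by (rule has_derivative_transform_within_open[OF _ open_T_chart[OF i] z]) (simp add: vertical_lift_local[OF i])
  from fun_cong[OF frechet_derivative_at[OF this], of "(0, a)"] show ?thesis
    using linear_0[OF has_derivative_linear[OF D]] by simp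
qed

lemma L_eq_bracket_iff_lift:
  assumes V: "V \<in> vertical_fields M" "L = form_field_bracket TM J V" and U: "U \<in> vertical_fields M"
  shows "L = form_field_bracket TM J U \<longleftrightarrow> (\<exists>X\<in>VF. U = V + vertical_lift M X)"
proof
  assume "\<exists>X\<in>VF. U = V + vertical_lift M X"
  then obtain X where X: "X \<in> VF" "U = V + vertical_lift M X" by blast
  show "L = form_field_bracket TM J U"
    unfolding L_eq_bracket_iff[OF U]
  proof (intro ballI allI)
    fix i z a assume iz: "i \<in> chart_index M" "z \<in> (chart i ` cdom i) \<times> (UNIV :: 'e set)"
    have "frechet_derivative (\<lambda>z. snd (V (T.param i z) i)) (at z) (0, a) = vcoeff i (T.param i z) a"
      using V(2) iz unfolding L_eq_bracket_iff[OF V(1)] by blast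
    then show "frechet_derivative (\<lambda>z. snd (U (T.param i z) i)) (at z) (0, a) = vcoeff i (T.param i z) a"
      unfolding X(2) vertical_derivative_add[OF V(1) vertical_lift_vertical[OF X(1)] iz]
        vertical_derivative_lift[OF X(1) iz] by simp
  qed
next
  assume L: "L = form_field_bracket TM J U"
  let ?W = "U - V"
  have W: "?W \<in> vertical_fields M" by (rule vertical_fields_diff[OF U V(1)])
  have "frechet_derivative (\<lambda>z. snd (?W (T.param i z) i)) (at z) (0, a) = 0"
    if i: "i \<in> chart_index M" and z: "z \<in> (chart i ` cdom i) \<times> UNIV" for i z a
  proof -
    have "frechet_derivative (\<lambda>z. snd (U (T.param i z) i)) (at z) (0, a) =
        frechet_derivative (\<lambda>z. snd (V (T.param i z) i)) (at z) (0, a) +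
        frechet_derivative (\<lambda>z. snd (?W (T.param i z) i)) (at z) (0, a)"
      using vertical_derivative_add[OF V(1) W i z, of "(0, a)"] by simp
    moreover have "frechet_derivative (\<lambda>z. snd (U (T.param i z) i)) (at z) (0, a) = vcoeff i (T.param i z) a"
      using L i z unfolding L_eq_bracket_iff[OF U] by blast
    moreover have "frechet_derivative (\<lambda>z. snd (V (T.param i z) i)) (at z) (0, a) = vcoeff i (T.param i z) a"
      using V(2) i z unfolding L_eq_bracket_iff[OF V(1)] by blast
    ultimately show ?thesis by simp
  qed
  from vertical_field_basic_lift[OF W this] obtain X where "X \<in> VF" "?W = vertical_lift M X" by blast
  then show "\<exists>X\<in>VF. U = V + vertical_lift M X"
    by (intro bexI[of _ X]) (simp_all flip: \<open>?W = vertical_lift M X\<close>)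
qed

end

theorem proposition5:
  fixes M :: "('p, 'i, 'e::euclidean_space) atlas"
    and L :: "('p \<times> ('i \<Rightarrow> 'e) \<Rightarrow> 'i \<Rightarrow> 'e \<times> 'e) \<Rightarrow> 'p \<times> ('i \<Rightarrow> 'e) \<Rightarrow> 'i \<Rightarrow> 'e \<times> 'e"
  assumes "smooth_manifold M"
    and "connected_space (atlas_topology M)"
    and "L \<in> semibasic_1_forms M"
    and "torsion_free M L"
  shows "\<exists>V\<^sub>L\<in>vertical_fields M.
    L = form_field_bracket (tangent_bundle M) (vertical_endo M) V\<^sub>L \<and>
    {V \<in> vertical_fields M. L = form_field_bracket (tangent_bundle M) (vertical_endo M) V} =
    {V\<^sub>L + vertical_lift M X |X. X \<in> vector_fields M}"
proof -
  interpret semibasic_form M L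
    by unfold_locales (use assms in \<open>auto simp: smooth_manifold_def\<close>)
  note V = potential_field_vertical and LV = L_eq_bracket_potential[OF assms(4)]
  have "{V \<in> vertical_fields M. L = form_field_bracket TM J V} = {potential_field + vertical_lift M X |X. X \<in> VF}"
    using L_eq_bracket_iff_lift[OF V LV] vertical_fields_add[OF V vertical_lift_vertical] by blast
  with V LV show ?thesis by blast
qed

end
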